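(* For $\theta\in[0,2\pi)$ let $\varphi^{(\theta)}$ and $\psi^{(\theta)}$ be the father and mother functions in $L^2(\mathbb{R})$ associated with the coefficients $$a_0=\tfrac{1}{2\sqrt2}(1-\cos\theta+\sin\theta),\quad a_1=\tfrac{1}{2\sqrt2}(1-\cos\theta-\sin\theta),\quad a_2=\tfrac{1}{2\sqrt2}(1+\cos\theta-\sin\theta),\quad a_3=\tfrac{1}{2\sqrt2}(1+\cos\theta+\sin\theta).$$ Then $\theta=\frac{\pi}{2}$ is the unique value of $\theta$ for which the family $$\psi^{(\theta)}_{j,k}(x)=2^{-j/2}\,\psi^{(\theta)}(2^{-j}x-k),\qquad j,k\in\mathbb{Z},$$ is a tight frame for $L^2(\mathbb{R})$ which is not an orthonormal basis of $L^2(\mathbb{R})$; for all $\theta\neq\frac{\pi}{2}$ this family is an orthonormal basis of $L^2(\mathbb{R})$.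
   Context: Put $m_0^{(\theta)}(z)=\sum_{k=0}^3a_kz^k$. The father (scaling) function $\varphi^{(\theta)}\in L^2(\mathbb{R})$ is defined by its Fourier transform $$\widehat{\varphi^{(\theta)}}(t)=(2\pi)^{-1/2}\prod_{k=1}^\infty\Bigl(2^{-1/2}m_0^{(\theta)}\bigl(e^{-it2^{-k}}\bigr)\Bigr),\qquad \hat f(t)=(2\pi)^{-1/2}\int_{\mathbb{R}}e^{-itx}f(x)\,dx;$$ it satisfies $\frac{1}{\sqrt2}\varphi^{(\theta)}(\frac x2)=\sum_{k=0}^3a_k\varphi^{(\theta)}(x-k)$. The mother function is defined by $\frac{1}{\sqrt2}\psi^{(\theta)}(\frac x2)=\sum_{k=0}^3(-1)^ka_{3-k}\varphi^{(\theta)}(x-k)$. *)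

theory Defs
  imports "HOL-Analysis.Analysis"
begin

(* The Hilbert space L^2(R) of complex-valued functions is represented by Borel
   representatives; two functions stand for the same element iff they agree a.e. *)

definition L2 :: "(real \<Rightarrow> complex) set" where
  "L2 = {f \<in> borel_measurable lborel. integrable lborel (\<lambda>x. (cmod (f x))\<^sup>2)}"

definition L2_inner :: "(real \<Rightarrow> complex) \<Rightarrow> (real \<Rightarrow> complex) \<Rightarrow> complex" where
  "L2_inner f g = (LINT x|lborel. f x * cnj (g x))"

definition L2_norm :: "(real \<Rightarrow> complex) \<Rightarrow> real" where
  "L2_norm f = sqrt (LINT x|lborel. (cmod (f x))\<^sup>2)"

definition is_orthonormal_basis :: "('i \<Rightarrow> real \<Rightarrow> complex) \<Rightarrow> bool" where
  "is_orthonormal_basis e \<longleftrightarrow>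
     (\<forall>i. e i \<in> L2) \<and>
     (\<forall>i j. L2_inner (e i) (e j) = (if i = j then 1 else 0)) \<and>
     (\<forall>f\<in>L2. \<forall>\<epsilon>>0. \<exists>F c. finite F \<and> L2_norm (\<lambda>x. f x - (\<Sum>i\<in>F. c i * e i x)) < \<epsilon>)"

definition is_tight_frame :: "('i \<Rightarrow> real \<Rightarrow> complex) \<Rightarrow> bool" where
  "is_tight_frame e \<longleftrightarrow>
     (\<forall>i. e i \<in> L2) \<and>
     (\<exists>A>0. \<forall>f\<in>L2. ((\<lambda>i. (cmod (L2_inner f (e i)))\<^sup>2) has_sum (A * (L2_norm f)\<^sup>2)) UNIV)"

definition fourier_integral :: "(real \<Rightarrow> complex) \<Rightarrow> real \<Rightarrow> complex" where
  "fourier_integral f t =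
     complex_of_real (1 / sqrt (2 * pi)) * (LINT x|lborel. exp (- \<i> * of_real (t * x)) * f x)"

(* The integral need not converge for f in L^2, so the transform on L^2 is the usual
   limit in mean: g is the L^2-limit of the transforms of the truncations of f to [-N,N]. *)

definition has_L2_fourier_transform :: "(real \<Rightarrow> complex) \<Rightarrow> (real \<Rightarrow> complex) \<Rightarrow> bool" where
  "has_L2_fourier_transform f g \<longleftrightarrow>
     f \<in> L2 \<and> g \<in> L2 \<and>
     (\<lambda>N::nat. \<integral>\<^sup>+ t. ennreal ((cmod (g t -
         fourier_integral (\<lambda>x. indicator {- real N..real N} x * f x) t))\<^sup>2) \<partial>lborel) \<longlonglongrightarrow> 0"

definition filter_coeff :: "real \<Rightarrow> nat \<Rightarrow> real" where
  "filter_coeff \<theta> k = 1 / (2 * sqrt 2) *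
     (if k = 0 then 1 - cos \<theta> + sin \<theta>
      else if k = 1 then 1 - cos \<theta> - sin \<theta>
      else if k = 2 then 1 + cos \<theta> - sin \<theta>
      else if k = 3 then 1 + cos \<theta> + sin \<theta>
      else 0)"

definition m0 :: "real \<Rightarrow> complex \<Rightarrow> complex" where
  "m0 \<theta> z = (\<Sum>k=0..3. of_real (filter_coeff \<theta> k) * z ^ k)"

(* Index shift: the product over k >= 1 becomes a product over k >= 0 with 2^(k+1). *)

definition father_hat :: "real \<Rightarrow> real \<Rightarrow> complex" where
  "father_hat \<theta> t = complex_of_real (1 / sqrt (2 * pi)) *
     (\<Prod>k. complex_of_real (1 / sqrt 2) * m0 \<theta> (exp (- \<i> * of_real (t / 2 ^ Suc k))))"

definition is_father_function :: "real \<Rightarrow> (real \<Rightarrow> complex) \<Rightarrow> bool" where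
  "is_father_function \<theta> \<phi> \<longleftrightarrow> has_L2_fourier_transform \<phi> (father_hat \<theta>)"

definition is_mother_function :: "real \<Rightarrow> (real \<Rightarrow> complex) \<Rightarrow> (real \<Rightarrow> complex) \<Rightarrow> bool" where
  "is_mother_function \<theta> \<phi> \<psi> \<longleftrightarrow> \<psi> \<in> L2 \<and>
     (AE x in lborel. complex_of_real (1 / sqrt 2) * \<psi> (x / 2) =
        (\<Sum>k=0..3. of_real ((- 1) ^ k * filter_coeff \<theta> (3 - k)) * \<phi> (x - real k)))"

definition wavelet :: "(real \<Rightarrow> complex) \<Rightarrow> int \<times> int \<Rightarrow> real \<Rightarrow> complex" where
  "wavelet \<psi> = (\<lambda>(j, k) x.
     of_real (2 powr (- of_int j / 2)) * \<psi> (2 powr (- of_int j) * x - of_int k))"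

end

(* By the quadrature mirror relations, sum_k |<f, phi_(j-1,k)>|^2 splits into the same sum at
   level j plus sum_k |<f, psi_(j,k)>|^2.  For any compactly supported square-integrable phi with
   integral 1 the phi-sums tend to the squared norm of f at fine scales and to 0 at coarse scales,
   so telescoping gives a tight frame with constant 1 for every theta; it is an orthonormal basis
   iff psi has norm 1.

   The support, integral and refinement equation of phi are read off its Fourier transform without
   Plancherel's theorem: the partial products are bounded by 1 and are transforms of discrete
   measures on [0,3], and trapezoid functions are transforms of integrable functions.

   The autocorrelation of phi is a fixed vector of Lawton's transition matrix; unless
   a_0 a_3 = 1/2, i.e. theta = pi/2, this forces the integer translates of phi to be orthonormal
   and psi to have norm 1.  At theta = pi/2, phi is 1/3 on [0,3] and psi has squared norm 1/3. *)
theory Submission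
  imports Defs
begin

section \<open>Square-integrable functions\<close>

text \<open>The translates of the father function are not known to be orthonormal, so no projections
  onto a chain of subspaces are at hand. What telescopes instead are the sums \<open>energy\<close>,
  and compact support makes them finite: at a fixed scale every point lies in the supports of
  boundedly many translates. The frame identity comes before any orthogonality, and orthonormality
  is read off from it.

  In the norm argument the angle survives only in \<open>a 0 * a 3\<close>, which equals sin
  \<theta> (1 + sin \<theta>) / 4. The fixed-vector equation reduces to R = 2 a0 a3 conj R for the
  autocorrelation R at shift 1, and the factor has modulus 1 only if sin \<theta> = 1. There the
  filter is the Haar filter with its second tap moved from 1 to 3, and the father function is a
  stretched box.

  The father function is given only by a limit in mean of transforms of truncations. Against an
  integrable function whose own transform has compact support the truncation is eventually
  invisible, and this is enough to pass between the two sides. Trapezoids are used because their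
  transforms decay like t^(-2), while the transform of an indicator of an interval is not
  integrable.\<close>

lemma L2_measurable [measurable_dest]: "f \<in> L2 \<Longrightarrow> f \<in> borel_measurable borel"
  by (simp add: L2_def)

lemma L2_sq_integrable [simp]: "f \<in> L2 \<Longrightarrow> integrable lborel (\<lambda>x. (cmod (f x))\<^sup>2)"
  by (simp add: L2_def)

lemma L2_I:
  assumes "f \<in> borel_measurable borel" "integrable lborel h" "\<And>x. (cmod (f x))\<^sup>2 \<le> h x"
  shows "f \<in> L2"
proof -
  have "integrable lborel (\<lambda>x. (cmod (f x))\<^sup>2)"
    using assms(1,3) by (intro Bochner_Integration.integrable_bound[OF assms(2)])
      (auto intro!: AE_I2 order_trans[OF assms(3)])
  then show ?thesis
    using assms(1) unfolding L2_def by simp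
qed

lemma cmod_add_sq_le: "(cmod (a + b))\<^sup>2 \<le> 2 * (cmod a)\<^sup>2 + 2 * (cmod b)\<^sup>2"
proof -
  have "(cmod (a + b))\<^sup>2 \<le> (cmod a + cmod b)\<^sup>2"
    by (intro power_mono norm_triangle_ineq) auto
  also have "\<dots> \<le> 2 * (cmod a)\<^sup>2 + 2 * (cmod b)\<^sup>2"
    using zero_le_power2[of "cmod a - cmod b"] by (simp add: power2_eq_square algebra_simps)
  finally show ?thesis .
qed

lemma L2_add: "f \<in> L2 \<Longrightarrow> g \<in> L2 \<Longrightarrow> (\<lambda>x. f x + g x) \<in> L2"
  by (rule L2_I[where h = "\<lambda>x. 2 * (cmod (f x))\<^sup>2 + 2 * (cmod (g x))\<^sup>2"])
     (auto intro!: cmod_add_sq_le)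

lemma L2_scale: "f \<in> L2 \<Longrightarrow> (\<lambda>x. c * f x) \<in> L2"
  by (rule L2_I[where h = "\<lambda>x. (cmod c)\<^sup>2 * (cmod (f x))\<^sup>2"])
     (auto simp: norm_mult power_mult_distrib)

lemma L2_zero: "(\<lambda>x. 0) \<in> L2"
  unfolding L2_def by simp

lemma L2_diff: "f \<in> L2 \<Longrightarrow> g \<in> L2 \<Longrightarrow> (\<lambda>x. f x - g x) \<in> L2"
  using L2_add[of f "\<lambda>x. - 1 * g x"] L2_scale[of g "- 1"] by simp

lemma L2_sum: "(\<And>i. i \<in> F \<Longrightarrow> f i \<in> L2) \<Longrightarrow> (\<lambda>x. \<Sum>i\<in>F. f i x) \<in> L2"
  by (induction F rule: infinite_finite_induct) (auto intro: L2_zero L2_add)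

lemma borel_measurable_cnj [measurable (raw)]:
  assumes "f \<in> borel_measurable M" shows "(\<lambda>x. cnj (f x)) \<in> borel_measurable M"
  by (rule measurable_compose[OF assms borel_measurable_continuous_onI]) (intro continuous_intros)

lemma L2_cnj: "f \<in> L2 \<Longrightarrow> (\<lambda>x. cnj (f x)) \<in> L2"
  by (rule L2_I[where h = "\<lambda>x. (cmod (f x))\<^sup>2"]) (auto intro: borel_measurable_cnj L2_measurable)

lemma L2_indicator_times:
  assumes "f \<in> L2" "A \<in> sets borel"
  shows "(\<lambda>x. indicator A x * f x) \<in> L2"
proof -
  have "f \<in> borel_measurable borel"
    using assms by (simp add: L2_measurable)
  then show ?thesis
    using assms
    by (intro L2_I[where h = "\<lambda>x. (cmod (f x))\<^sup>2"])
       (auto simp: indicator_def)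
qed

lemma L2_indicator:
  assumes "A \<in> sets borel" "emeasure lborel A < \<infinity>"
  shows "(\<lambda>x. indicator A x :: complex) \<in> L2"
  using assms
  by (intro L2_I[where h = "\<lambda>x. indicator A x"])
     (auto intro: integrable_real_indicator split: split_indicator)

lemma cmod_mult_le_sq: "cmod (a * b) \<le> (cmod a)\<^sup>2 + (cmod b)\<^sup>2"
  using zero_le_power2[of "cmod a - cmod b"] mult_nonneg_nonneg[of "cmod a" "cmod b"]
  by (simp add: norm_mult power2_eq_square algebra_simps del: mult_nonneg_nonneg zero_le_power2 zero_le_mult_iff)

lemma L2_mult_integrable:
  assumes "f \<in> L2" "g \<in> L2" shows "integrable lborel (\<lambda>x. f x * g x)"
proof (rule Bochner_Integration.integrable_bound)
  show "integrable lborel (\<lambda>x. (cmod (f x))\<^sup>2 + (cmod (g x))\<^sup>2)"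
    using assms by auto
  show "(\<lambda>x. f x * g x) \<in> borel_measurable lborel"
    using assms by auto
  show "AE x in lborel. cmod (f x * g x) \<le> norm ((cmod (f x))\<^sup>2 + (cmod (g x))\<^sup>2)"
    by (intro AE_I2 order_trans[OF cmod_mult_le_sq]) auto
qed

lemma L2_inner_integrable:
  "f \<in> L2 \<Longrightarrow> g \<in> L2 \<Longrightarrow> integrable lborel (\<lambda>x. f x * cnj (g x))"
  using L2_mult_integrable L2_cnj by blast

lemma L2_inner_add_left:
  "f \<in> L2 \<Longrightarrow> g \<in> L2 \<Longrightarrow> h \<in> L2 \<Longrightarrow> L2_inner (\<lambda>x. f x + g x) h = L2_inner f h + L2_inner g h"
  by (simp add: L2_inner_def distrib_right L2_inner_integrable)

lemma L2_inner_diff_left: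
  "f \<in> L2 \<Longrightarrow> g \<in> L2 \<Longrightarrow> h \<in> L2 \<Longrightarrow> L2_inner (\<lambda>x. f x - g x) h = L2_inner f h - L2_inner g h"
  by (simp add: L2_inner_def left_diff_distrib L2_inner_integrable)

lemma L2_inner_scale_left: "L2_inner (\<lambda>x. c * f x) h = c * L2_inner f h"
  by (simp add: L2_inner_def mult.assoc)

lemma L2_inner_sum_left:
  "(\<And>i. i \<in> F \<Longrightarrow> f i \<in> L2) \<Longrightarrow> h \<in> L2 \<Longrightarrow>
     L2_inner (\<lambda>x. \<Sum>i\<in>F. f i x) h = (\<Sum>i\<in>F. L2_inner (f i) h)"
  by (simp add: L2_inner_def sum_distrib_right L2_inner_integrable)

lemma L2_inner_commute: "L2_inner f g = cnj (L2_inner g f)"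
  using Bochner_Integration.integral_cnj[of lborel "\<lambda>x. g x * cnj (f x)"] by (simp add: L2_inner_def mult.commute)

lemma L2_inner_scale_right: "L2_inner f (\<lambda>x. c * h x) = cnj c * L2_inner f h"
  by (subst (1 2) L2_inner_commute) (simp add: L2_inner_scale_left)

lemma L2_inner_sum_right:
  assumes "\<And>i. i \<in> F \<Longrightarrow> f i \<in> L2" "h \<in> L2"
  shows "L2_inner h (\<lambda>x. \<Sum>i\<in>F. f i x) = (\<Sum>i\<in>F. L2_inner h (f i))"
  by (subst (1 2) L2_inner_commute) (simp add: L2_inner_sum_left assms)

lemma L2_inner_diff_right:
  assumes "f \<in> L2" "g \<in> L2" "h \<in> L2"
  shows "L2_inner h (\<lambda>x. f x - g x) = L2_inner h f - L2_inner h g"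
  by (subst (1 2 3) L2_inner_commute) (simp add: L2_inner_diff_left assms)

lemma L2_inner_cong_AE:
  assumes "f \<in> borel_measurable borel" "g \<in> borel_measurable borel"
      "f' \<in> borel_measurable borel" "g' \<in> borel_measurable borel"
      "AE x in lborel. f x = f' x" "AE x in lborel. g x = g' x"
  shows "L2_inner f g = L2_inner f' g'"
  unfolding L2_inner_def using assms by (intro integral_cong_AE) auto

lemma L2_norm_sq: "(L2_norm f)\<^sup>2 = (LINT x|lborel. (cmod (f x))\<^sup>2)"
  unfolding L2_norm_def by (intro real_sqrt_pow2 integral_nonneg_AE) auto

lemma L2_norm_nonneg: "0 \<le> L2_norm f"
  unfolding L2_norm_def by (intro real_sqrt_ge_zero integral_nonneg_AE) auto

lemma L2_inner_self: "L2_inner f f = of_real ((L2_norm f)\<^sup>2)"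
  unfolding L2_inner_def L2_norm_sq integral_complex_of_real[symmetric]
  by (simp only: complex_norm_square)

lemma L2_norm_scale: "L2_norm (\<lambda>x. c * f x) = cmod c * L2_norm f"
  by (simp add: L2_norm_def norm_mult power_mult_distrib real_sqrt_mult)

lemma L2_norm_diff_sq:
  assumes "f \<in> L2" "g \<in> L2"
  shows "(L2_norm (\<lambda>x. f x - g x))\<^sup>2 = (L2_norm f)\<^sup>2 - 2 * Re (L2_inner f g) + (L2_norm g)\<^sup>2"
proof -
  have "complex_of_real ((L2_norm (\<lambda>x. f x - g x))\<^sup>2) =
      L2_inner f f - L2_inner f g - L2_inner g f + L2_inner g g"
    unfolding L2_inner_self[symmetric] using assms
    by (simp add: L2_inner_diff_left L2_inner_diff_right L2_diff)
  from arg_cong[OF this, of Re] show ?thesis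
    by (subst (asm) (3) L2_inner_commute) (simp add: L2_inner_self)
qed

lemma L2_Cauchy_Schwarz:
  assumes "f \<in> L2" "g \<in> L2"
  shows "cmod (L2_inner f g) \<le> L2_norm f * L2_norm g"
proof -
  define z where "z = L2_inner f g"
  define a where "a = (L2_norm f)\<^sup>2"
  define b where "b = (L2_norm g)\<^sup>2"
  have ab: "0 \<le> a" "0 \<le> b"
    by (simp_all add: a_def b_def)
  \<comment> \<open>Expand the squared norm of \<open>f - s * z * g\<close>: with \<open>z\<close>
    itself in the coefficient the cross term is real.\<close>
  have key: "2 * s * (cmod z)\<^sup>2 \<le> a + s\<^sup>2 * (cmod z)\<^sup>2 * b" for s :: real
  proof -
    have "0 \<le> (L2_norm (\<lambda>x. f x - (of_real s * z) * g x))\<^sup>2"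
      by simp
    also have "\<dots> = a - 2 * Re (cnj (of_real s * z) * z) + (cmod (of_real s * z))\<^sup>2 * b"
      using assms by (subst L2_norm_diff_sq)
        (simp_all add: L2_scale L2_inner_scale_right L2_norm_scale a_def b_def z_def power_mult_distrib)
    also have "cnj (of_real s * z) * z = of_real (s * (cmod z)\<^sup>2)"
      using complex_norm_square[of z] by (simp add: mult.commute mult.left_commute)
    finally show ?thesis
      by (simp add: norm_mult power_mult_distrib)
  qed
  have "(cmod z)\<^sup>2 \<le> a * b"
  proof (cases "b = 0")
    case True
    show ?thesis
    proof (rule ccontr)
      assume "\<not> ?thesis"
      then have "(cmod z)\<^sup>2 > 0" using True by simp
      \<comment> \<open>For \<open>b = 0\<close> the left side of \<open>key\<close> is unbounded in
        \<open>s\<close>; this \<open>s\<close> turns it into \<open>a + 1 \<le> a\<close>.\<close>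
      then show False
        using key[of "(a + 1) / (2 * (cmod z)\<^sup>2)"] True by (simp add: field_simps)
    qed
  next
    case False
    with ab have "b > 0" by simp
    then show ?thesis
      \<comment> \<open>The value of \<open>s\<close> for which \<open>key\<close> is
        sharpest.\<close>
      using key[of "1 / b"] by (simp add: field_simps power2_eq_square)
  qed
  then have "(cmod z)\<^sup>2 \<le> (L2_norm f * L2_norm g)\<^sup>2"
    by (simp add: a_def b_def power_mult_distrib)
  then show ?thesis
    unfolding z_def by (rule power2_le_imp_le) (simp add: L2_norm_nonneg)
qed

lemma L2_norm_diff_le:
  assumes "f \<in> L2" "g \<in> L2"
  shows "L2_norm (\<lambda>x. f x - g x) \<le> L2_norm f + L2_norm g"
proof (rule power2_le_imp_le)
  have "- Re (L2_inner f g) \<le> L2_norm f * L2_norm g"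
    using L2_Cauchy_Schwarz[OF assms] abs_Re_le_cmod[of "L2_inner f g"] by linarith
  then show "(L2_norm (\<lambda>x. f x - g x))\<^sup>2 \<le> (L2_norm f + L2_norm g)\<^sup>2"
    by (simp add: L2_norm_diff_sq assms power2_sum)
qed (simp add: L2_norm_nonneg)

lemma L2_norm_add_le:
  assumes "f \<in> L2" "g \<in> L2"
  shows "L2_norm (\<lambda>x. f x + g x) \<le> L2_norm f + L2_norm g"
  using L2_norm_diff_le[OF assms(1) L2_scale[OF assms(2), of "-1"]] L2_norm_scale[of "-1" g] by simp

lemma L2_norm_zero_AE:
  assumes "f \<in> L2" "L2_norm f = 0" shows "AE x in lborel. f x = 0"
proof -
  have "(LINT x|lborel. (cmod (f x))\<^sup>2) = 0"
    using assms(2) L2_norm_sq[of f] by simp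
  then show ?thesis
    using integral_nonneg_eq_0_iff_AE[OF L2_sq_integrable[OF assms(1)]] by simp
qed

section \<open>Dilations and translations\<close>

lemma L2_affine: "f \<in> L2 \<Longrightarrow> c \<noteq> 0 \<Longrightarrow> (\<lambda>x. f (t + c * x)) \<in> L2"
  using lborel_integrable_real_affine[of "\<lambda>x. (cmod (f x))\<^sup>2" c t] unfolding L2_def by auto

lemma L2_inner_affine:
  assumes "c \<noteq> 0"
  shows "L2_inner f g = of_real \<bar>c\<bar> * L2_inner (\<lambda>x. f (t + c * x)) (\<lambda>x. g (t + c * x))"
  using lborel_integral_real_affine[OF assms, of "\<lambda>x. f x * cnj (g x)" t]
  by (simp add: L2_inner_def scaleR_conv_of_real)

lemma wavelet_eq: "wavelet u (j, k) x =
    of_real (2 powr (- of_int j / 2)) * u (- of_int k + 2 powr (- of_int j) * x)"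
  by (simp add: wavelet_def)

lemma L2_wavelet: "u \<in> L2 \<Longrightarrow> wavelet u i \<in> L2"
  by (cases i) (simp only: wavelet_eq[abs_def], intro L2_scale L2_affine, auto)

text \<open>The substitution x = 2^j (y + k) moves dilation and translation from \<open>u\<close> to
  \<open>f\<close>. All coefficients become inner products with one fixed function, so limits in the
  scale concern \<open>f\<close> alone.\<close>

lemma L2_inner_wavelet:
  "L2_inner f (wavelet u (j, k)) = of_real (2 powr (of_int j / 2)) *
     L2_inner (\<lambda>y. f (2 powr of_int j * (y + of_int k))) u"
proof -
  have "L2_inner f (wavelet u (j, k)) = 
    of_real (2 powr of_int j) * L2_inner (\<lambda>x. f (2 powr of_int j * of_int k + 2 powr of_int j * x))
     (\<lambda>x. wavelet u (j, k) (2 powr of_int j * of_int k + 2 powr of_int j * x))"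
    by (subst L2_inner_affine[where c = "2 powr of_int j" and t = "2 powr of_int j * of_int k"]) auto
  also have "(\<lambda>x. wavelet u (j, k) (2 powr of_int j * of_int k + 2 powr of_int j * x)) =
      (\<lambda>x. of_real (2 powr (- of_int j / 2)) * u x)"
    by (rule ext) (simp add: wavelet_eq distrib_left powr_minus field_simps)
  also have "L2_inner (\<lambda>x. f (2 powr of_int j * of_int k + 2 powr of_int j * x)) \<dots> =
     of_real (2 powr (- of_int j / 2)) * L2_inner (\<lambda>y. f (2 powr of_int j * (y + of_int k))) u"
    by (simp only: L2_inner_scale_right complex_cnj_complex_of_real) (simp add: algebra_simps)
  also have "complex_of_real (2 powr of_int j) * (of_real (2 powr (- of_int j / 2)) * 
     L2_inner (\<lambda>y. f (2 powr of_int j * (y + of_int k))) u) =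
     of_real (2 powr (of_int j / 2)) * L2_inner (\<lambda>y. f (2 powr of_int j * (y + of_int k))) u"
    by (simp add: powr_add[symmetric] flip: of_real_mult mult.assoc)
  finally show ?thesis .
qed

lemma L2_norm_wavelet: "L2_norm (wavelet u i) = L2_norm u"
proof (cases i)
  case (Pair j k)
  have "complex_of_real ((L2_norm (wavelet u i))\<^sup>2) = of_real ((L2_norm u)\<^sup>2)"
  proof -
    have "L2_inner (wavelet u (j,k)) (wavelet u (j,k)) =
       of_real (2 powr (of_int j / 2)) *
       L2_inner (\<lambda>y. of_real (2 powr (- of_int j / 2)) * u y) u"
      by (subst L2_inner_wavelet) (simp add: wavelet_eq powr_minus field_simps)
    also have "\<dots> = L2_inner u u"
      by (simp add: L2_inner_scale_left powr_add[symmetric] flip: of_real_mult mult.assoc)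
    finally show ?thesis
      by (simp add: Pair L2_inner_self)
  qed
  then have "(L2_norm (wavelet u i))\<^sup>2 = (L2_norm u)\<^sup>2"
    by (simp only: of_real_eq_iff)
  then show ?thesis
    by (simp add: L2_norm_nonneg)
qed

section \<open>Approximation in mean and density\<close>

lemma L2_norm_tendsto_0_dominated:
  fixes s :: "nat \<Rightarrow> real \<Rightarrow> complex"
  assumes "\<And>n. s n \<in> borel_measurable borel" "f \<in> borel_measurable borel" "integrable lborel w"
    and "AE x in lborel. (\<lambda>n. s n x) \<longlonglongrightarrow> f x" "\<And>n x. (cmod (s n x - f x))\<^sup>2 \<le> w x"
  shows "(\<lambda>n. L2_norm (\<lambda>x. s n x - f x)) \<longlonglongrightarrow> 0"
proof -
  have "(\<lambda>n. LINT x|lborel. (cmod (s n x - f x))\<^sup>2) \<longlonglongrightarrow> (LINT x::real|lborel. (0::real))"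
  proof (rule integral_dominated_convergence[where w = w])
    show "AE x in lborel. (\<lambda>n. (cmod (s n x - f x))\<^sup>2) \<longlonglongrightarrow> 0"
      using assms(4)
    proof eventually_elim
      case (elim x)
      then have "(\<lambda>n. (cmod (s n x - f x))\<^sup>2) \<longlonglongrightarrow> (cmod (f x - f x))\<^sup>2"
        by (intro tendsto_intros)
      then show "(\<lambda>n. (cmod (s n x - f x))\<^sup>2) \<longlonglongrightarrow> 0" by simp
    qed
  qed (use assms in auto)
  then show ?thesis
    unfolding L2_norm_def using tendsto_real_sqrt by fastforce
qed

lemma L2_indicator_interval: "(\<lambda>x. indicator {a<..<b} x :: complex) \<in> L2" for a b :: real
  using emeasure_bounded_finite[of "{a<..<b}"] by (intro L2_indicator) auto

text \<open>A Dynkin-system argument: open intervals form an intersection-stable generator of the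
  Borel sets, and linearity together with limits in mean carries the property from intervals to
  bounded Borel sets, to simple functions, and to all of \<open>L2\<close>.\<close>

lemma L2_induct [consumes 1, case_names interval add scale lim]:
  assumes f: "f \<in> L2"
    and interval: "\<And>a b. a < b \<Longrightarrow> P (\<lambda>x. indicator {a<..<b} x)"
    and add: "\<And>f g. f \<in> L2 \<Longrightarrow> g \<in> L2 \<Longrightarrow> P f \<Longrightarrow> P g \<Longrightarrow> P (\<lambda>x. f x + g x)"
    and scale: "\<And>c f. f \<in> L2 \<Longrightarrow> P f \<Longrightarrow> P (\<lambda>x. c * f x)"
    and lim: "\<And>s f. (\<And>n. s n \<in> L2) \<Longrightarrow> f \<in> L2 \<Longrightarrow> (\<And>n. P (s n)) \<Longrightarrow>
      (\<lambda>n::nat. L2_norm (\<lambda>x. s n x - f x)) \<longlonglongrightarrow> 0 \<Longrightarrow> P f"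
  shows "P f"
proof -
  have zero: "P (\<lambda>x. 0)"
    using scale[OF L2_indicator_interval interval[of 0 1], of 0] by simp
  \<comment> \<open>Finite sums are treated for two index types, since a local fact has a fixed
    type: naturals index a disjoint union, complex numbers the values of a simple function.\<close>
  have sum_nat: "P (\<lambda>x. \<Sum>i\<in>F. g i x)" if "\<And>i. i \<in> F \<Longrightarrow> g i \<in> L2" "\<And>i. i \<in> F \<Longrightarrow> P (g i)"
    for F :: "nat set" and g
    using that by (induction F rule: infinite_finite_induct) (auto intro!: zero add L2_sum)
  have sum_cpx: "P (\<lambda>x. \<Sum>i\<in>F. g i x)" if "\<And>i. i \<in> F \<Longrightarrow> g i \<in> L2" "\<And>i. i \<in> F \<Longrightarrow> P (g i)"
    for F :: "complex set" and g
    using that by (induction F rule: infinite_finite_induct) (auto intro!: zero add L2_sum)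
  \<comment> \<open>Cutting with a bounded interval keeps all sets of finite measure; otherwise
    complements would leave \<open>L2\<close>.\<close>
  have ind: "P (\<lambda>x. indicator (A \<inter> {-r<..<r}) x)" if A: "A \<in> sets borel" for A and r :: real
  proof -
    let ?I = "{-r<..<r}"
    have L2I: "(\<lambda>x. indicator (B \<inter> ?I) x :: complex) \<in> L2" if "B \<in> sets borel" for B
    proof (rule L2_indicator)
      have "emeasure lborel (B \<inter> ?I) \<le> emeasure lborel ?I"
        by (rule emeasure_mono) auto
      also have "\<dots> < \<infinity>" using emeasure_bounded_finite[of ?I] by auto
      finally show "emeasure lborel (B \<inter> ?I) < \<infinity>" .
    qed (use that in auto)
    have pI: "P (\<lambda>x. indicator {a<..<b} x)" for a b :: real
      using interval[of a b] zero by (cases "a < b") auto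
    have gen: "sets borel = sigma_sets UNIV (range (\<lambda>(a, b). {a<..<b::real}))"
      by (subst borel_eq_box) (simp add: box_real case_prod_unfold)
    have "Int_stable (range (\<lambda>(a, b). {a<..<b::real}))"
    proof (rule Int_stableI)
      fix X Y assume "X \<in> range (\<lambda>(a, b). {a<..<b::real})" "Y \<in> range (\<lambda>(a, b). {a<..<b::real})"
      then obtain a b c d where "X = {a<..<b}" "Y = {c<..<d}" by auto
      then have "X \<inter> Y = (case (max a c, min b d) of (a, b) \<Rightarrow> {a<..<b})" by auto
      then show "X \<inter> Y \<in> range (\<lambda>(a, b). {a<..<b})" by blast
    qed
    moreover have "range (\<lambda>(a, b). {a<..<b::real}) \<subseteq> Pow UNIV" by auto
    moreover have "A \<in> sigma_sets UNIV (range (\<lambda>(a, b). {a<..<b::real}))"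
      using A gen by simp
    ultimately show ?thesis
    proof (induction rule: sigma_sets_induct_disjoint)
      case (basic A)
      then obtain a b where "A = {a<..<b}" by auto
      then have "A \<inter> ?I = {max a (-r)<..<min b r}" by auto
      then show ?case using pI by simp
    next
      case empty
      then show ?case using zero by simp
    next
      case (compl A)
      then have A: "A \<in> sets borel" using gen by simp
      have "P (\<lambda>x. indicator ?I x + (-1) * indicator (A \<inter> ?I) x)"
        using compl A by (intro add scale L2I pI L2_scale L2_indicator_interval)
      moreover have "(\<lambda>x. indicator ?I x + (-1) * indicator (A \<inter> ?I) x) =
          (\<lambda>x. indicator ((UNIV - A) \<inter> ?I) x :: complex)"
        by (auto simp: indicator_def)
      ultimately show ?case by simp
    next
      case (union A)
      then have A: "A n \<in> sets borel" for n using gen by auto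
      let ?s = "\<lambda>n x. \<Sum>i<n. indicator (A i \<inter> ?I) x :: complex"
      have s: "?s n x = indicator ((\<Union>i<n. A i) \<inter> ?I) x" for n x
      proof -
        have "disjoint_family_on A {..<n}"
          using union.hyps(1) by (auto simp: disjoint_family_on_def)
        then have "indicator (\<Union>i<n. A i) x = (\<Sum>i<n. indicator (A i) x :: complex)"
          by (intro indicator_UN_disjoint) auto
        then show ?thesis
          by (simp add: indicator_inter_arith sum_distrib_right)
      qed
      show ?case
      proof (rule lim)
        show "?s n \<in> L2" for n
          by (intro L2_sum L2I A)
        show "P (?s n)" for n
          using union by (intro sum_nat L2I A) auto
        show "(\<lambda>x. indicator (\<Union> (range A) \<inter> ?I) x :: complex) \<in> L2"
          using A by (intro L2I) auto
        show "(\<lambda>n. L2_norm (\<lambda>x. ?s n x - indicator (\<Union> (range A) \<inter> ?I) x)) \<longlonglongrightarrow> 0"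
        proof (rule L2_norm_tendsto_0_dominated[where w = "indicator ?I"])
          show "integrable lborel (indicator ?I :: real \<Rightarrow> real)"
            using emeasure_bounded_finite[of ?I] by (intro integrable_real_indicator) auto
          show "AE x in lborel. (\<lambda>n. ?s n x) \<longlonglongrightarrow> indicator (\<Union> (range A) \<inter> ?I) x"
            unfolding s unfolding indicator_inter_arith
            by (intro AE_I2 tendsto_mult tendsto_const LIMSEQ_indicator_UN)
        qed (use A in \<open>auto simp: s split: split_indicator\<close>)
      qed
    qed
  qed
  from borel_measurable_implies_sequence_metric[of f lborel 0] f
  obtain s where s: "\<And>i. simple_function lborel (s i)" "\<And>x. (\<lambda>i. s i x) \<longlonglongrightarrow> f x"
      "\<And>i x. cmod (s i x) \<le> 2 * cmod (f x)"
    by (auto simp: L2_measurable)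
  have sm [measurable]: "s i \<in> borel_measurable borel" for i
    using borel_measurable_simple_function[OF s(1)[of i]] by simp
  let ?t = "\<lambda>n x. indicator {- real n<..<real n} x * s n x"
  have bound: "cmod (?t n x) \<le> 2 * cmod (f x)" for n x
    using s(3)[of n x] by (auto simp: indicator_def)
  show "P f"
  proof (rule lim)
    show L2t: "?t n \<in> L2" for n
    proof (rule L2_I[where h = "\<lambda>x. 4 * (cmod (f x))\<^sup>2"])
      show "(cmod (?t n x))\<^sup>2 \<le> 4 * (cmod (f x))\<^sup>2" for x
        using power_mono[OF bound[of n x], of 2] by (simp add: power_mult_distrib)
    qed (use f in auto)
    show "P (?t n)" for n
    proof -
      let ?A = "\<lambda>y. s n -` {y} \<inter> {-real n<..<real n}"
      have fin: "finite (range (s n))"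
        using simple_functionD(1)[OF s(1)[of n]] by simp
      have mA: "s n -` {y} \<in> sets borel" for y
        using simple_functionD(2)[OF s(1)[of n], of "{y}"] by simp
      have "?t n = (\<lambda>x. \<Sum>y\<in>range (s n). y * indicator (?A y) x)"
      proof
        fix x
        have "(\<Sum>y\<in>range (s n). y * indicator (?A y) x) =
           (\<Sum>y\<in>range (s n). if y = s n x then y * indicator {-real n<..<real n} x else 0)"
          by (intro sum.cong) (auto simp: indicator_def)
        then show "?t n x = (\<Sum>y\<in>range (s n). y * indicator (?A y) x)"
          using fin by simp
      qed
      moreover have "P (\<lambda>x. \<Sum>y\<in>range (s n). y * indicator (?A y) x)"
      proof (intro sum_cpx scale L2_scale ind mA)
        fix y
        show "(\<lambda>x. indicator (?A y) x :: complex) \<in> L2"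
        proof (rule L2_indicator)
          have "emeasure lborel (?A y) \<le> emeasure lborel {-real n<..<real n}"
            by (rule emeasure_mono) auto
          also have "\<dots> < \<infinity>" using emeasure_bounded_finite[of "{-real n<..<real n}"] by auto
          finally show "emeasure lborel (?A y) < \<infinity>" .
        qed (use mA in auto)
        then show "(\<lambda>x. indicator (?A y) x :: complex) \<in> L2" .
      qed
      ultimately show ?thesis by simp
    qed
    show "(\<lambda>n. L2_norm (\<lambda>x. ?t n x - f x)) \<longlonglongrightarrow> 0"
    \<comment> \<open>The approximants are bounded by \<open>2 * cmod (f x)\<close>, hence their
      distance to \<open>f x\<close> by \<open>3 * cmod (f x)\<close>; 9 is the square of 3.\<close>
    proof (rule L2_norm_tendsto_0_dominated[where w = "\<lambda>x. 9 * (cmod (f x))\<^sup>2"])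
      show "AE x in lborel. (\<lambda>n. ?t n x) \<longlonglongrightarrow> f x"
      proof (rule AE_I2)
        fix x
        obtain N where N: "\<bar>x\<bar> < real N" using reals_Archimedean2 by blast
        have "eventually (\<lambda>n. s n x = ?t n x) sequentially"
          using eventually_ge_at_top[of N]
          by eventually_elim (use N in \<open>auto simp: indicator_def abs_less_iff\<close>)
        then show "(\<lambda>n. ?t n x) \<longlonglongrightarrow> f x"
          by (rule Lim_transform_eventually[OF s(2)])
      qed
      show "(cmod (?t n x - f x))\<^sup>2 \<le> 9 * (cmod (f x))\<^sup>2" for n x
      proof -
        have "cmod (?t n x - f x) \<le> 3 * cmod (f x)"
          using norm_triangle_ineq4[of "?t n x" "f x"] bound[of n x] by simp
        then show ?thesis
          using power_mono[of "cmod (?t n x - f x)" "3 * cmod (f x)" 2] by (simp add: power_mult_distrib)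
      qed
    qed (use f in auto)
  qed (rule f)
qed

lemma L2_inner_tendsto_left:
  assumes "\<And>n. s n \<in> L2" "f \<in> L2" "g \<in> L2" "(\<lambda>n. L2_norm (\<lambda>x. s n x - f x)) \<longlonglongrightarrow> 0"
  shows "(\<lambda>n. L2_inner (s n) g) \<longlonglongrightarrow> L2_inner f g"
proof -
  have "(\<lambda>n. L2_norm (\<lambda>x. s n x - f x) * L2_norm g) \<longlonglongrightarrow> 0 * L2_norm g"
    by (intro tendsto_mult assms tendsto_const)
  moreover have "norm (L2_inner (s n) g - L2_inner f g) \<le> L2_norm (\<lambda>x. s n x - f x) * L2_norm g" for n
    using L2_Cauchy_Schwarz[OF L2_diff[OF assms(1)[of n] assms(2)] assms(3)]
    by (simp add: L2_inner_diff_left assms)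
  ultimately have "(\<lambda>n. L2_inner (s n) g - L2_inner f g) \<longlonglongrightarrow> 0"
    using Lim_null_comparison[of "\<lambda>n. L2_inner (s n) g - L2_inner f g"
        "\<lambda>n. L2_norm (\<lambda>x. s n x - f x) * L2_norm g" sequentially]
    by (simp only: mult_zero_left always_eventually simp_thms)
  then show ?thesis
    by (rule LIM_zero_cancel)
qed

text \<open>Vanishing of the pairing with \<open>cnj f\<close> is stable under everything in
  \<open>L2_induct\<close>, so it extends from intervals to all of \<open>L2\<close>; pairing
  \<open>cnj f\<close> with itself gives norm 0.\<close>

lemma L2_AE_zero_if_interval_integrals_zero:
  assumes f: "f \<in> L2" and zero: "\<And>a b. a < b \<Longrightarrow> (LINT x|lborel. indicator {a<..<b} x * f x) = 0"
  shows "AE x in lborel. f x = 0"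
proof -
  let ?h = "\<lambda>x. cnj (f x)"
  have h: "?h \<in> L2" using f by (rule L2_cnj)
  have "L2_inner g ?h = 0" if "g \<in> L2" for g
    using that
  proof (induction rule: L2_induct)
    case (interval a b)
    then show ?case using zero by (simp add: L2_inner_def)
  next
    case (lim s g)
    then show ?case
      using L2_inner_tendsto_left[OF lim(1,2) h lim(3)] lim(4) by (simp add: LIMSEQ_const_iff)
  qed (auto simp: L2_inner_add_left L2_inner_scale_left h)
  from this[OF h] have "L2_norm ?h = 0"
    by (simp add: L2_inner_self)
  from L2_norm_zero_AE[OF h this] show ?thesis by simp
qed

text \<open>Almost everywhere continuity is enough for Riemann sums and, unlike continuity, admits step functions.\<close>

definition test_function :: "(real \<Rightarrow> complex) \<Rightarrow> bool" where
  "test_function g \<longleftrightarrow> g \<in> borel_measurable borel \<and> (\<exists>B. \<forall>x. cmod (g x) \<le> B) \<and>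
     (\<exists>r. \<forall>x. r < \<bar>x\<bar> \<longrightarrow> g x = 0) \<and> (AE x in lborel. isCont g x)"

lemma L2_test_function:
  assumes "test_function g" shows "g \<in> L2"
proof -
  obtain B r where B: "\<And>x. cmod (g x) \<le> B" and r: "\<And>x. r < \<bar>x\<bar> \<Longrightarrow> g x = 0"
    and g: "g \<in> borel_measurable borel"
    using assms by (auto simp: test_function_def)
  show ?thesis
  proof (rule L2_I[where h = "\<lambda>x. B\<^sup>2 * indicator {-r..r} x"])
    show "(cmod (g x))\<^sup>2 \<le> B\<^sup>2 * indicator {-r..r} x" for x
      using power_mono[OF B[of x], of 2] r[of x] by (auto simp: indicator_def not_less abs_le_iff)
    show "integrable lborel (\<lambda>x. B\<^sup>2 * indicator {-r..r} x)"
      using emeasure_bounded_finite[of "{-r..r}"] by (intro integrable_mult_right integrable_real_indicator) auto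
  qed (rule g)
qed

lemma test_function_dense:
  assumes "f \<in> L2" "0 < e"
  shows "\<exists>g. test_function g \<and> L2_norm (\<lambda>x. f x - g x) < e"
  using assms
proof (induction arbitrary: e rule: L2_induct)
  case (interval a b)
  have "AE x in lborel. isCont (\<lambda>x. indicator {a<..<b} x :: complex) x"
  proof (rule AE_I[where N = "{a, b}"])
    show "{x \<in> space lborel. \<not> isCont (\<lambda>x. indicator {a<..<b} x :: complex) x} \<subseteq> {a, b}"
    proof
      fix x assume "x \<in> {x \<in> space lborel. \<not> isCont (\<lambda>x. indicator {a<..<b} x :: complex) x}"
      moreover have "(\<lambda>x. indicator {a<..<b} x) = (\<lambda>x. complex_of_real (indicator {a<..<b} x))"
        by (auto simp: indicator_def)
      ultimately have "\<not> isCont (indicator {a<..<b} :: real \<Rightarrow> real) x"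
        using continuous_of_real[of "at x" "indicator {a<..<b}"] by auto
      with interval show "x \<in> {a, b}"
        by (auto simp: isCont_indicator frontier_def)
    qed
  qed (auto intro: emeasure_lborel_countable)
  then have "test_function (\<lambda>x. indicator {a<..<b} x)"
    unfolding test_function_def
    by (intro conjI exI[of _ "1::real"] exI[of _ "\<bar>a\<bar> + \<bar>b\<bar>"] allI)
       (auto split: split_indicator)
  then show ?case
    using interval by (intro exI[of _ "\<lambda>x. indicator {a<..<b} x"]) (auto simp: L2_norm_def)
next
  case (add f1 f2)
  obtain g1 g2 where g: "test_function g1" "test_function g2"
     "L2_norm (\<lambda>x. f1 x - g1 x) < e / 2" "L2_norm (\<lambda>x. f2 x - g2 x) < e / 2"
    using add.IH[of "e / 2"] add.prems by fastforce
  have gL: "g1 \<in> L2" "g2 \<in> L2" using g L2_test_function by auto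
  have "test_function (\<lambda>x. g1 x + g2 x)"
  proof -
    obtain B1 r1 B2 r2 where *: "\<And>x. cmod (g1 x) \<le> B1" "\<And>x. r1 < \<bar>x\<bar> \<Longrightarrow> g1 x = 0"
       "\<And>x. cmod (g2 x) \<le> B2" "\<And>x. r2 < \<bar>x\<bar> \<Longrightarrow> g2 x = 0"
      using g(1,2) unfolding test_function_def by metis
    have "cmod (g1 x + g2 x) \<le> B1 + B2" for x
      using norm_triangle_ineq[of "g1 x" "g2 x"] *(1,3)[of x] by linarith
    moreover have "\<forall>x. max r1 r2 < \<bar>x\<bar> \<longrightarrow> g1 x + g2 x = 0"
      using * by auto
    moreover have "AE x in lborel. isCont (\<lambda>x. g1 x + g2 x) x"
    proof -
      have "AE x in lborel. isCont g1 x" "AE x in lborel. isCont g2 x"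
        using g by (auto simp: test_function_def)
      then show ?thesis by eventually_elim (rule continuous_add)
    qed
    moreover have "(\<lambda>x. g1 x + g2 x) \<in> borel_measurable borel"
      using gL by auto
    ultimately show ?thesis
      unfolding test_function_def by blast
  qed
  moreover have "L2_norm (\<lambda>x. (f1 x + f2 x) - (g1 x + g2 x)) < e"
    using L2_norm_add_le[of "\<lambda>x. f1 x - g1 x" "\<lambda>x. f2 x - g2 x"] g gL add.hyps
    by (simp add: L2_diff algebra_simps)
  ultimately show ?case by blast
next
  case (scale c f)
  \<comment> \<open>The summand 1 keeps the denominator positive when \<open>c = 0\<close>.\<close>
  obtain g where g: "test_function g" "L2_norm (\<lambda>x. f x - g x) < e / (cmod c + 1)"
    using scale.IH[of "e / (cmod c + 1)"] scale.prems
    by (metis add_pos_nonneg divide_pos_pos norm_ge_zero add.commute zero_less_one)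
  have "test_function (\<lambda>x. c * g x)"
  proof -
    obtain B r where *: "\<And>x. cmod (g x) \<le> B" "\<And>x. r < \<bar>x\<bar> \<Longrightarrow> g x = 0"
      using g(1) unfolding test_function_def by metis
    have "cmod (c * g x) \<le> cmod c * B" for x
      using *(1)[of x] by (simp add: norm_mult mult_left_mono)
    moreover have "AE x in lborel. isCont (\<lambda>x. c * g x) x"
    proof -
      have "AE x in lborel. isCont g x"
        using g by (auto simp: test_function_def)
      then show ?thesis by eventually_elim (auto intro: continuous_mult)
    qed
    moreover have "\<forall>x. r < \<bar>x\<bar> \<longrightarrow> c * g x = 0" using * by simp
    moreover have "(\<lambda>x. c * g x) \<in> borel_measurable borel"
      using g(1) by (auto simp: test_function_def)
    ultimately show ?thesis
      unfolding test_function_def by blast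
  qed
  moreover have "L2_norm (\<lambda>x. c * f x - c * g x) < e"
  proof -
    have "L2_norm (\<lambda>x. c * f x - c * g x) = cmod c * L2_norm (\<lambda>x. f x - g x)"
      using L2_norm_scale[of c "\<lambda>x. f x - g x"] by (simp add: right_diff_distrib)
    also have "\<dots> \<le> cmod c * (e / (cmod c + 1))"
      using g(2) by (intro mult_left_mono) auto
    also have "\<dots> < e"
      using scale.prems by (simp add: field_simps add_pos_nonneg)
    finally show ?thesis .
  qed
  ultimately show ?case by blast
next
  case (lim s f)
  have "eventually (\<lambda>n. L2_norm (\<lambda>x. s n x - f x) < e / 2) sequentially"
    using lim.prems lim.hyps by (intro order_tendstoD) auto
  then obtain n where n: "L2_norm (\<lambda>x. s n x - f x) < e / 2"
    by (auto simp: eventually_sequentially)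
  obtain g where g: "test_function g" "L2_norm (\<lambda>x. s n x - g x) < e / 2"
    using lim.IH[of "e / 2" n] lim.prems by auto
  have "L2_norm (\<lambda>x. (s n x - g x) - (s n x - f x)) < e"
    using L2_norm_diff_le[of "\<lambda>x. s n x - g x" "\<lambda>x. s n x - f x"] n g lim.hyps
    by (simp add: L2_diff L2_test_function)
  then show ?case
    using g by (auto simp: algebra_simps)
qed

section \<open>Energies of dilates and translates\<close>

lemma wavelet_AE_zero:
  fixes u :: "real \<Rightarrow> complex"
  assumes [measurable]: "u \<in> borel_measurable borel" "A \<in> sets borel"
    and "AE x in lborel. x \<notin> A \<longrightarrow> u x = 0"
  shows "AE x in lborel. - of_int k + 2 powr (- of_int j) * x \<notin> A \<longrightarrow> wavelet u (j, k) x = 0"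
proof -
  have "AE x in lborel. - of_int k + 2 powr (- of_int j) * x \<notin> A \<longrightarrow>
      u (- of_int k + 2 powr (- of_int j) * x) = 0"
    by (rule AE_borel_affine[where P = "\<lambda>x. x \<notin> A \<longrightarrow> u x = 0"]) (use assms in auto)
  then show ?thesis
    by eventually_elim (auto simp: wavelet_eq)
qed

lemma L2_inner_indicator_right:
  assumes [measurable]: "A \<in> sets borel" and [simp]: "f \<in> L2" "g \<in> L2"
    and "AE x in lborel. x \<notin> A \<longrightarrow> g x = 0"
  shows "L2_inner f g = L2_inner (\<lambda>x. indicator A x * f x) g"
proof -
  have [measurable]: "f \<in> borel_measurable borel" "g \<in> borel_measurable borel"
    by (simp_all add: L2_measurable)
  have "AE x in lborel. f x * cnj (g x) = indicator A x * f x * cnj (g x)"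
    using assms(4) by eventually_elim (auto simp: indicator_def)
  then show ?thesis
    unfolding L2_inner_def by (intro integral_cong_AE) auto
qed

lemma L2_norm_indicator_sq:
  "(L2_norm (\<lambda>x. indicator A x * f x))\<^sup>2 = (LINT x|lborel. indicator A x * (cmod (f x))\<^sup>2)"
  unfolding L2_norm_sq by (intro Bochner_Integration.integral_cong) (auto simp: indicator_def)

definition energy :: "(real \<Rightarrow> complex) \<Rightarrow> int \<Rightarrow> (real \<Rightarrow> complex) \<Rightarrow> real" where
  "energy u j f = (\<Sum>\<^sub>\<infinity>k. (cmod (L2_inner f (wavelet u (j, k))))\<^sup>2)"

lemma energy_nonneg: "0 \<le> energy u j f"
  unfolding energy_def by (rule infsum_nonneg) simp

locale compact_generator =
  fixes u :: "real \<Rightarrow> complex" and R :: nat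
  assumes u_L2: "u \<in> L2"
    and u_supp: "AE x in lborel. x \<notin> {0..real R} \<longrightarrow> u x = 0"
begin

lemma u_measurable [measurable]: "u \<in> borel_measurable borel"
  using u_L2 by (rule L2_measurable)

lemma u_integrable: "integrable lborel u"
proof -
  have "integrable lborel (\<lambda>x. indicator {0..real R} x * u x)"
    using emeasure_bounded_finite[of "{0..real R}"]
    by (intro L2_mult_integrable u_L2 L2_indicator) auto
  then show ?thesis
    by (rule integrable_cong_AE_imp) (use u_supp in \<open>auto simp: indicator_def\<close>)
qed

text \<open>Bounded overlap takes the place of orthogonality. Each coefficient sees \<open>f\<close>
  only on the set \<open>A k\<close> that carries the \<open>k\<close>-th function, and no point
  lies in more than \<open>R + 1\<close> of these sets. The constant is independent of the scale
  \<open>j\<close>, which makes the later limits uniform.\<close>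

lemma finite_Bessel:
  assumes f: "f \<in> L2" and F: "finite F"
  shows "(\<Sum>k\<in>F. (cmod (L2_inner f (wavelet u (j, k))))\<^sup>2) \<le> (L2_norm u)\<^sup>2 * (real R + 1) * (L2_norm f)\<^sup>2"
proof -
  have [measurable]: "f \<in> borel_measurable borel"
    using f by (rule L2_measurable)
  define A where "A k = {x. - of_int k + 2 powr (- of_int j) * x \<in> {0..real R}}" for k :: int
  have A [measurable]: "A k \<in> sets borel" for k
    unfolding A_def by measurable
  have int: "integrable lborel (\<lambda>x. indicator (A k) x * (cmod (f x))\<^sup>2)" for k
    using L2_sq_integrable[OF f] by (rule Bochner_Integration.integrable_bound)
      (auto simp: indicator_def)
  have "(cmod (L2_inner f (wavelet u (j, k))))\<^sup>2 \<le>
      (L2_norm u)\<^sup>2 * (LINT x|lborel. indicator (A k) x * (cmod (f x))\<^sup>2)" for k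
  proof -
    have "L2_inner f (wavelet u (j, k)) = L2_inner (\<lambda>x. indicator (A k) x * f x) (wavelet u (j, k))"
      using wavelet_AE_zero[OF u_measurable _ u_supp, of k j]
      by (intro L2_inner_indicator_right A f L2_wavelet u_L2) (auto simp: A_def)
    then have "cmod (L2_inner f (wavelet u (j, k))) \<le> L2_norm (\<lambda>x. indicator (A k) x * f x) * L2_norm u"
      using L2_Cauchy_Schwarz[OF L2_indicator_times[OF f A] L2_wavelet[OF u_L2]]
      by (metis L2_norm_wavelet)
    from power_mono[OF this norm_ge_zero, of 2, unfolded power_mult_distrib L2_norm_indicator_sq]
    show ?thesis by (simp only: mult.commute)
  qed
  then have "(\<Sum>k\<in>F. (cmod (L2_inner f (wavelet u (j, k))))\<^sup>2) \<le>
     (\<Sum>k\<in>F. (L2_norm u)\<^sup>2 * (LINT x|lborel. indicator (A k) x * (cmod (f x))\<^sup>2))"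
    by (rule sum_mono)
  also have "\<dots> = (L2_norm u)\<^sup>2 * (LINT x|lborel. (\<Sum>k\<in>F. indicator (A k) x) * (cmod (f x))\<^sup>2)"
    by (simp add: int sum_distrib_right flip: sum_distrib_left)
  also have "(LINT x|lborel. (\<Sum>k\<in>F. indicator (A k) x) * (cmod (f x))\<^sup>2) \<le>
      (LINT x|lborel. (real R + 1) * (cmod (f x))\<^sup>2)"
  proof (rule integral_mono)
    show "integrable lborel (\<lambda>x. (\<Sum>k\<in>F. indicator (A k) x) * (cmod (f x))\<^sup>2)"
      using int by (simp add: sum_distrib_right)
    fix x
    have "(\<Sum>k\<in>F. indicator (A k) x) = real (card (F \<inter> {k. x \<in> A k}))"
      using F by (subst sum.inter_filter[symmetric, of F, simplified] | simp add: indicator_def Int_def sum.If_cases)+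
    \<comment> \<open>A point of \<open>A k\<close> satisfies 0 \<le> 2^(-j) x - k \<le> R, which
      leaves \<open>k\<close> among these R + 1 consecutive integers.\<close>
    also have "card (F \<inter> {k. x \<in> A k}) \<le>
       card {\<lfloor>2 powr (- of_int j) * x\<rfloor> - int R .. \<lfloor>2 powr (- of_int j) * x\<rfloor>}"
      by (rule card_mono) (auto simp: A_def le_floor_iff; linarith)+
    finally have "(\<Sum>k\<in>F. indicator (A k) x) \<le> real R + 1" by simp
    then show "(\<Sum>k\<in>F. indicator (A k) x) * (cmod (f x))\<^sup>2 \<le> (real R + 1) * (cmod (f x))\<^sup>2"
      by (rule mult_right_mono) simp
  qed (use f in auto)
  also have "(LINT x|lborel. (real R + 1) * (cmod (f x))\<^sup>2) = (real R + 1) * (L2_norm f)\<^sup>2"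
    by (simp add: L2_norm_sq)
  finally show ?thesis
    by (simp add: mult_left_mono mult.assoc)
qed

lemma energy_summable:
  assumes "f \<in> L2"
  shows "(\<lambda>k. (cmod (L2_inner f (wavelet u (j, k))))\<^sup>2) summable_on UNIV"
  by (rule nonneg_bdd_above_summable_on)
     (auto intro!: bdd_aboveI2 finite_Bessel[OF assms])

lemma energy_le:
  assumes "f \<in> L2"
  shows "energy u j f \<le> (L2_norm u)\<^sup>2 * (real R + 1) * (L2_norm f)\<^sup>2"
  unfolding energy_def
  by (rule infsum_le_finite_sums[OF energy_summable[OF assms] finite_Bessel[OF assms]])

end

text \<open>The weighted inequality between arithmetic and geometric mean, applied to
  \<open>cmod (a - b) * (cmod a + cmod b)\<close>. The weight \<open>\<eta>\<close> will be the
  allowed distance of two functions, so that after summation all three terms are of order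
  \<open>\<eta>\<close>.\<close>

lemma abs_diff_sq_le:
  fixes a b :: complex
  assumes "0 < \<eta>"
  shows "\<bar>(cmod a)\<^sup>2 - (cmod b)\<^sup>2\<bar> \<le> (cmod (a - b))\<^sup>2 / \<eta> + \<eta> * (cmod a)\<^sup>2 + \<eta> * (cmod b)\<^sup>2"
proof -
  let ?d = "cmod (a - b)" and ?s = "cmod a + cmod b"
  have "\<bar>(cmod a)\<^sup>2 - (cmod b)\<^sup>2\<bar> = \<bar>cmod a - cmod b\<bar> * ?s"
    by (simp add: power2_eq_square square_diff_square_factored abs_mult)
  also have "\<dots> \<le> ?d * ?s"
    by (intro mult_right_mono norm_triangle_ineq3) auto
  also have "\<dots> \<le> (?d\<^sup>2 / \<eta> + \<eta> * ?s\<^sup>2) / 2"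
  proof -
    have "0 \<le> (?d - \<eta> * ?s)\<^sup>2 / \<eta>" using assms by simp
    also have "\<dots> = ?d\<^sup>2 / \<eta> + \<eta> * ?s\<^sup>2 - 2 * (?d * ?s)"
      using assms by (simp add: power2_eq_square field_simps)
    finally show ?thesis by simp
  qed
  also have "?s\<^sup>2 \<le> 2 * (cmod a)\<^sup>2 + 2 * (cmod b)\<^sup>2"
    using zero_le_power2[of "cmod a - cmod b"] by (simp add: power2_eq_square algebra_simps)
  finally have "\<bar>(cmod a)\<^sup>2 - (cmod b)\<^sup>2\<bar> \<le> (?d\<^sup>2 / \<eta> + \<eta> * (2 * (cmod a)\<^sup>2 + 2 * (cmod b)\<^sup>2)) / 2"
    using assms by (simp add: mult_left_mono)
  also have "\<dots> = ?d\<^sup>2 / \<eta> / 2 + \<eta> * (cmod a)\<^sup>2 + \<eta> * (cmod b)\<^sup>2"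
    by (simp add: field_simps)
  finally have "\<bar>(cmod a)\<^sup>2 - (cmod b)\<^sup>2\<bar> \<le> ?d\<^sup>2 / \<eta> / 2 + \<eta> * (cmod a)\<^sup>2 + \<eta> * (cmod b)\<^sup>2" .
  also have "?d\<^sup>2 / \<eta> / 2 \<le> ?d\<^sup>2 / \<eta>"
    using divide_right_mono[of "?d\<^sup>2 / 2" "?d\<^sup>2" \<eta>] assms by (simp add: mult.commute)
  finally show ?thesis by simp
qed

text \<open>Continuity of the energy, uniformly in the scale \<open>j\<close>:
  \<open>abs_diff_sq_le\<close> is summed over \<open>k\<close>, and \<open>energy_le\<close> bounds
  the energies of \<open>f\<close>, \<open>g\<close> and \<open>f - g\<close>.\<close>

lemma (in compact_generator) energy_diff_le:
  assumes [simp]: "f \<in> L2" "g \<in> L2" and \<eta>: "0 < \<eta>" "L2_norm (\<lambda>x. f x - g x) \<le> \<eta>"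
  shows "\<bar>energy u j f - energy u j g\<bar> \<le>
    (L2_norm u)\<^sup>2 * (real R + 1) * \<eta> * (1 + (L2_norm f)\<^sup>2 + (L2_norm g)\<^sup>2)"
proof -
  let ?c = "\<lambda>f k. L2_inner f (wavelet u (j, k))"
  let ?C = "(L2_norm u)\<^sup>2 * (real R + 1)"
  let ?h = "\<lambda>x. f x - g x"
  have C: "0 \<le> ?C" by simp
  have h: "?h \<in> L2" by (simp add: L2_diff)
  define p where "p k = (cmod (?c f k))\<^sup>2" for k
  define q where "q k = (cmod (?c g k))\<^sup>2" for k
  define d where "d k = (cmod (?c ?h k))\<^sup>2" for k
  have [simp]: "p summable_on UNIV" "q summable_on UNIV" "d summable_on UNIV"
    unfolding p_def q_def d_def using energy_summable h by simp_all
  have E: "energy u j f = infsum p UNIV" "energy u j g = infsum q UNIV" "energy u j ?h = infsum d UNIV"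
    unfolding energy_def by (auto intro!: infsum_cong simp: p_def q_def d_def)
  define r where "r k = inverse \<eta> * d k + \<eta> * p k + \<eta> * q k" for k
  have le: "\<bar>p k - q k\<bar> \<le> r k" for k
    using abs_diff_sq_le[OF \<eta>(1), of "?c f k" "?c g k"]
    by (simp add: L2_inner_diff_left L2_wavelet u_L2 p_def q_def r_def d_def divide_inverse mult.commute)
  have s: "(\<lambda>k. inverse \<eta> * d k) summable_on UNIV" "(\<lambda>k. \<eta> * p k) summable_on UNIV"
    "(\<lambda>k. \<eta> * q k) summable_on UNIV"
    by (intro summable_on_cmult_right; simp)+
  then have [simp]: "r summable_on UNIV"
    unfolding r_def by (intro summable_on_add)
  have r: "infsum r UNIV = inverse \<eta> * energy u j ?h + \<eta> * energy u j f + \<eta> * energy u j g"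
    using infsum_add[OF summable_on_add[OF s(1,2)] s(3)] infsum_add[OF s(1,2)]
    unfolding r_def E by (simp add: infsum_cmult_right')
  have "infsum p UNIV \<le> infsum q UNIV + infsum r UNIV"
    using le by (subst infsum_add[symmetric]) (auto intro!: infsum_mono summable_on_add simp: abs_le_iff algebra_simps)
  moreover have "infsum q UNIV \<le> infsum p UNIV + infsum r UNIV"
    using le by (subst infsum_add[symmetric]) (auto intro!: infsum_mono summable_on_add simp: abs_le_iff algebra_simps)
  ultimately have "\<bar>energy u j f - energy u j g\<bar> \<le> infsum r UNIV"
    unfolding E by linarith
  also have "\<dots> \<le> inverse \<eta> * (?C * \<eta>\<^sup>2) + \<eta> * (?C * (L2_norm f)\<^sup>2) + \<eta> * (?C * (L2_norm g)\<^sup>2)"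
    unfolding r
  proof (intro add_mono mult_left_mono energy_le)
    have "energy u j ?h \<le> ?C * (L2_norm ?h)\<^sup>2" by (rule energy_le[OF h])
    also have "\<dots> \<le> ?C * \<eta>\<^sup>2"
      using \<eta> C by (intro mult_left_mono power_mono L2_norm_nonneg)
    finally show "energy u j ?h \<le> ?C * \<eta>\<^sup>2" .
  qed (use \<eta> in auto)
  also have "\<dots> = ?C * \<eta> * (1 + (L2_norm f)\<^sup>2 + (L2_norm g)\<^sup>2)"
    using \<eta>(1) by (simp add: power2_eq_square field_simps)
  finally show ?thesis .
qed

text \<open>Brings the linear factor in \<open>L2_norm_sq_diff_le\<close> into the quadratic shape
  of \<open>energy_diff_le\<close>, so that one density lemma serves both.\<close>

lemma sum_le_sum_sq: "x + y \<le> 2 * (1 + x\<^sup>2 + y\<^sup>2)" for x y :: real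
proof -
  have "0 \<le> (x - 1)\<^sup>2 + (y - 1)\<^sup>2 + 3 * x\<^sup>2 + 3 * y\<^sup>2 + 2"
    by (intro add_nonneg_nonneg) auto
  then show ?thesis by (simp add: power2_diff)
qed

lemma L2_norm_sq_diff_le:
  assumes [simp]: "f \<in> L2" "g \<in> L2" and \<eta>: "0 < \<eta>" "L2_norm (\<lambda>x. f x - g x) \<le> \<eta>"
  shows "\<bar>(L2_norm f)\<^sup>2 - (L2_norm g)\<^sup>2\<bar> \<le> 2 * \<eta> * (1 + (L2_norm f)\<^sup>2 + (L2_norm g)\<^sup>2)"
proof -
  have "L2_norm f \<le> L2_norm (\<lambda>x. f x - g x) + L2_norm g"
    using L2_norm_add_le[of "\<lambda>x. f x - g x" g] by (simp add: L2_diff)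
  moreover have "L2_norm g \<le> L2_norm f + L2_norm (\<lambda>x. f x - g x)"
    using L2_norm_diff_le[of f "\<lambda>x. f x - g x"] by (simp add: L2_diff)
  ultimately have "\<bar>L2_norm f - L2_norm g\<bar> \<le> \<eta>" using \<eta> by linarith
  moreover have "\<bar>(L2_norm f)\<^sup>2 - (L2_norm g)\<^sup>2\<bar> = \<bar>L2_norm f - L2_norm g\<bar> * (L2_norm f + L2_norm g)"
    using L2_norm_nonneg[of f] L2_norm_nonneg[of g]
    by (simp add: power2_eq_square square_diff_square_factored abs_mult)
  ultimately have "\<bar>(L2_norm f)\<^sup>2 - (L2_norm g)\<^sup>2\<bar> \<le> \<eta> * (L2_norm f + L2_norm g)"
    by (simp add: mult_right_mono add_nonneg_nonneg L2_norm_nonneg)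
  also have "\<dots> \<le> \<eta> * (2 * (1 + (L2_norm f)\<^sup>2 + (L2_norm g)\<^sup>2))"
    using \<eta> by (intro mult_left_mono sum_le_sum_sq) auto
  finally show ?thesis by (simp add: mult_ac)
qed

text \<open>Equicontinuity together with convergence on a dense set: the bound \<open>K\<close> is
  the same for all \<open>n\<close>, so a test function close to \<open>f\<close> controls the whole
  sequence.\<close>

lemma L2_tendsto_0_by_density:
  fixes Q :: "nat \<Rightarrow> (real \<Rightarrow> complex) \<Rightarrow> real"
  assumes Lip: "\<And>n f g \<eta>. f \<in> L2 \<Longrightarrow> g \<in> L2 \<Longrightarrow> 0 < \<eta> \<Longrightarrow> L2_norm (\<lambda>x. f x - g x) \<le> \<eta> \<Longrightarrow>
      \<bar>Q n f - Q n g\<bar> \<le> K * \<eta> * (1 + (L2_norm f)\<^sup>2 + (L2_norm g)\<^sup>2)"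
    and test: "\<And>g. test_function g \<Longrightarrow> (\<lambda>n. Q n g) \<longlonglongrightarrow> 0"
    and f: "f \<in> L2"
  shows "(\<lambda>n. Q n f) \<longlonglongrightarrow> 0"
proof (rule LIMSEQ_I)
  fix r :: real assume r: "0 < r"
  \<comment> \<open>\<open>M\<close> dominates the last factor of \<open>Lip\<close> for every
    \<open>g\<close> at distance at most 1 from \<open>f\<close>; this is why \<open>\<eta>\<close>
    is cut off at 1.\<close>
  define M where "M = 1 + (L2_norm f)\<^sup>2 + (L2_norm f + 1)\<^sup>2"
  have M: "M > 0" unfolding M_def by (intro add_pos_nonneg) auto
  \<comment> \<open>\<open>K\<close> may have any sign, but the denominator of \<open>\<eta>\<close>
    has to be positive.\<close>
  define k where "k = \<bar>K\<bar> + 1"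
  have k: "0 < k" "K \<le> k" by (auto simp: k_def)
  define \<eta> where "\<eta> = min 1 (r / (2 * k * M))"
  have \<eta>: "0 < \<eta>" "\<eta> \<le> 1" using r M k by (auto simp: \<eta>_def)
  obtain g where g: "test_function g" "L2_norm (\<lambda>x. f x - g x) < \<eta>"
    using test_function_dense[OF f \<eta>(1)] by blast
  have gL: "g \<in> L2" using g L2_test_function by blast
  have "L2_norm g \<le> L2_norm f + L2_norm (\<lambda>x. f x - g x)"
    using L2_norm_diff_le[of f "\<lambda>x. f x - g x"] f gL by (simp add: L2_diff)
  then have "L2_norm g \<le> L2_norm f + 1" using g \<eta> by linarith
  then have "1 + (L2_norm f)\<^sup>2 + (L2_norm g)\<^sup>2 \<le> M"
    unfolding M_def by (intro add_mono power_mono L2_norm_nonneg) auto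
  then have "K * \<eta> * (1 + (L2_norm f)\<^sup>2 + (L2_norm g)\<^sup>2) \<le> k * \<eta> * M"
    using \<eta> k by (intro mult_mono) auto
  also have "\<dots> \<le> k * (r / (2 * k * M)) * M"
    using M k by (intro mult_right_mono mult_left_mono) (auto simp: \<eta>_def)
  also have "\<dots> = r / 2" using M k by (simp add: field_simps)
  finally have 1: "\<bar>Q n f - Q n g\<bar> \<le> r / 2" for n
    using Lip[OF f gL \<eta>(1), of n] g(2) by linarith
  obtain N where N: "\<And>n. n \<ge> N \<Longrightarrow> norm (Q n g - 0) < r / 2"
    using LIMSEQ_D[OF test[OF g(1)], of "r / 2"] r by auto
  then have "norm (Q n f - 0) < r" if "n \<ge> N" for n
  proof -
    have "\<bar>Q n g\<bar> < r / 2" using N[OF that] by simp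
    then show ?thesis using 1[of n] unfolding real_norm_def diff_zero by linarith
  qed
  then show "\<exists>N. \<forall>n\<ge>N. norm (Q n f - 0) < r" by blast
qed

lemma mult_floor_bounds:
  fixes q s :: real
  assumes "0 < q"
  shows "s - q \<le> q * of_int \<lfloor>s / q\<rfloor>" "q * of_int \<lfloor>s / q\<rfloor> \<le> s"
proof -
  have "q * (s / q - 1) \<le> q * of_int \<lfloor>s / q\<rfloor>" "q * of_int \<lfloor>s / q\<rfloor> \<le> q * (s / q)"
    using assms by (intro mult_left_mono; linarith)+
  then show "s - q \<le> q * of_int \<lfloor>s / q\<rfloor>" "q * of_int \<lfloor>s / q\<rfloor> \<le> s"
    using assms by (simp_all add: right_diff_distrib)
qed

section \<open>Limits of the energies at fine and coarse scales\<close>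

context compact_generator
begin

lemma L2_inner_generator_eq_0:
  assumes [measurable]: "f \<in> borel_measurable borel" and "\<And>y. 0 \<le> y \<Longrightarrow> y \<le> real R \<Longrightarrow> f y = 0"
  shows "L2_inner f u = 0"
  unfolding L2_inner_def
proof (rule integral_eq_zero_AE)
  show "AE x in lborel. f x * cnj (u x) = 0"
    using u_supp by eventually_elim (use assms(2) in auto)
qed

text \<open>A Riemann-sum argument. With mesh q = 2^(-n) the energy is the integral of the step
  function s -> |F n s|^2, where \<open>F n s\<close> averages values of \<open>g\<close> near
  \<open>s\<close> against \<open>cnj u\<close>. As \<open>u\<close> has integral 1,
  \<open>F n s\<close> tends to \<open>g s\<close> wherever \<open>g\<close> is continuous, and
  dominated convergence applies.\<close>

lemma energy_fine_scale_test_function: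
  assumes g: "test_function g" and u1: "(LINT x|lborel. u x) = 1"
  shows "(\<lambda>n. energy u (- int n) g) \<longlonglongrightarrow> (L2_norm g)\<^sup>2"
proof -
  have gm [measurable]: "g \<in> borel_measurable borel" and gc: "AE x in lborel. isCont g x"
    using g by (auto simp: test_function_def)
  obtain B r0 where B: "\<And>x. cmod (g x) \<le> B" and r0: "\<And>x. r0 < \<bar>x\<bar> \<Longrightarrow> g x = 0"
    using g by (auto simp: test_function_def)
  define r where "r = \<bar>r0\<bar>"
  have r: "0 \<le> r" "\<And>x. r < \<bar>x\<bar> \<Longrightarrow> g x = 0"
    using r0 by (auto simp: r_def)
  have B0: "0 \<le> B" using B[of 0] norm_ge_zero order_trans by blast
  define q where "q n = 2 powr (- real n)" for n :: nat
  have q: "0 < q n" "q n \<le> 1" for n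
    using powr_mono[of "- real n" 0 2] by (simp_all add: q_def)
  have q_lim: "q \<longlonglongrightarrow> 0"
  proof -
    have "(\<lambda>n. (1/2::real) ^ n) \<longlonglongrightarrow> 0" by (intro LIMSEQ_power_zero) auto
    moreover have "q = (\<lambda>n. (1/2) ^ n)"
      by (rule ext) (simp add: q_def powr_minus_divide powr_realpow power_one_over)
    ultimately show ?thesis by (simp only:)
  qed
  define c where "c n k = L2_inner (\<lambda>y. g (q n * (y + of_int k))) u" for n and k :: int
  have coef: "(cmod (L2_inner g (wavelet u (- int n, k))))\<^sup>2 = q n * (cmod (c n k))\<^sup>2" for n k
    unfolding L2_inner_wavelet c_def q_def
    by (simp add: norm_mult power_mult_distrib power2_eq_square powr_add[symmetric])
  \<comment> \<open>Beyond \<open>K n\<close> the rescaled support of \<open>u\<close> misses the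
    support of \<open>g\<close>, so the energy is a finite sum.\<close>
  define K where "K n = \<lceil>r / q n\<rceil> + int R + 1" for n
  have c0: "c n k = 0" if "k \<notin> {- K n..K n}" for n k
    unfolding c_def
  proof (rule L2_inner_generator_eq_0)
    fix y assume y: "0 \<le> y" "y \<le> real R"
    have "K n + 1 \<le> \<bar>k\<bar>" using that by auto
    then have "real_of_int (K n) + 1 \<le> \<bar>real_of_int k\<bar>" by linarith
    moreover have "r / q n + real R + 1 \<le> real_of_int (K n)"
      unfolding K_def by linarith
    ultimately have "r / q n < \<bar>y + real_of_int k\<bar>" using y by linarith
    then have "r < q n * \<bar>y + real_of_int k\<bar>"
      using q(1)[of n] by (simp add: pos_divide_less_eq mult.commute)
    then have "r < \<bar>q n * (y + real_of_int k)\<bar>"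
      using q(1)[of n] by (simp add: abs_mult)
    then show "g (q n * (y + real_of_int k)) = 0" by (rule r(2))
  qed auto
  have en: "energy u (- int n) g = (\<Sum>k\<in>{- K n..K n}. q n * (cmod (c n k))\<^sup>2)" for n
    unfolding energy_def coef
    by (subst infsum_finite[symmetric], simp) (rule infsum_cong_neutral; use c0 in auto)
  define F where "F n s = c n \<lfloor>s / q n\<rfloor>" for n s
  have Fsum: "(cmod (F n s))\<^sup>2 =
      (\<Sum>k\<in>{- K n..K n}. (cmod (c n k))\<^sup>2 * indicator {q n * of_int k..<q n * (of_int k + 1)} s)" for n s
  proof -
    have *: "s \<in> {q n * of_int k..<q n * (of_int k + 1)} \<longleftrightarrow> k = \<lfloor>s / q n\<rfloor>" for k
      using q(1)[of n] by (auto simp: floor_eq_iff field_simps eq_commute[of k])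
    have "(\<Sum>k\<in>{- K n..K n}. (cmod (c n k))\<^sup>2 * indicator {q n * of_int k..<q n * (of_int k + 1)} s) =
      (\<Sum>k\<in>{- K n..K n}. if k = \<lfloor>s / q n\<rfloor> then (cmod (c n k))\<^sup>2 else 0)"
      unfolding indicator_def of_bool_def * by (intro sum.cong) simp_all
    also have "\<dots> = (cmod (F n s))\<^sup>2"
      using c0[of "\<lfloor>s / q n\<rfloor>" n] by (simp add: F_def)
    finally show ?thesis by simp
  qed
  have Fmeas [measurable]: "(\<lambda>s. (cmod (F n s))\<^sup>2) \<in> borel_measurable borel" for n
    unfolding Fsum by measurable
  have int_F: "(LINT s|lborel. (cmod (F n s))\<^sup>2) = energy u (- int n) g" for n
  proof -
    have "q n * real_of_int k \<le> q n * (real_of_int k + 1)" for k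
      using q(1)[of n] by simp
    then show ?thesis
      unfolding Fsum en
      by (subst Bochner_Integration.integral_sum)
         (auto intro!: sum.cong integrable_real_indicator simp: algebra_simps)
  qed
  have floor_lim: "(\<lambda>n. q n * (y + of_int \<lfloor>s / q n\<rfloor>)) \<longlonglongrightarrow> s" for y s
  proof -
    have "(\<lambda>n. q n * (y + of_int \<lfloor>s / q n\<rfloor>) - s) \<longlonglongrightarrow> 0"
    proof (rule Lim_null_comparison[OF always_eventually[OF allI]])
      fix n
      note mult_floor_bounds[OF q(1)[of n], of s]
      moreover have "\<bar>q n * y\<bar> = q n * \<bar>y\<bar>" using q(1)[of n] by (simp add: abs_mult)
      ultimately show "norm (q n * (y + of_int \<lfloor>s / q n\<rfloor>) - s) \<le> q n * (\<bar>y\<bar> + 1)"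
        unfolding real_norm_def distrib_left by linarith
    next
      show "(\<lambda>n. q n * (\<bar>y\<bar> + 1)) \<longlonglongrightarrow> 0"
        using tendsto_mult_left_zero[OF q_lim] by simp
    qed
    then show ?thesis by (rule LIM_zero_cancel)
  qed
  have F_lim: "(\<lambda>n. F n s) \<longlonglongrightarrow> g s" if "isCont g s" for s
  proof -
    have "(\<lambda>n. F n s) \<longlonglongrightarrow> (LINT y|lborel. g s * cnj (u y))"
      unfolding F_def c_def L2_inner_def
    proof (rule integral_dominated_convergence[where w = "\<lambda>y. B * cmod (u y)"])
      show "integrable lborel (\<lambda>y. B * cmod (u y))" using u_integrable by simp
      show "AE y in lborel. (\<lambda>n. g (q n * (y + of_int \<lfloor>s / q n\<rfloor>)) * cnj (u y)) \<longlonglongrightarrow> g s * cnj (u y)"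
        by (intro AE_I2 tendsto_mult tendsto_const isCont_tendsto_compose[OF that] floor_lim)
      show "AE y in lborel. norm (g (q n * (y + of_int \<lfloor>s / q n\<rfloor>)) * cnj (u y)) \<le> B * cmod (u y)" for n
        by (intro AE_I2) (simp add: norm_mult mult_right_mono B)
    qed auto
    then show ?thesis using u1 by simp
  qed
  \<comment> \<open>\<open>D\<close> bounds all the averages. The radius \<open>r\<close> of the
    support of \<open>g\<close> is enlarged by \<open>R\<close> for the support of \<open>u\<close>
    and by 1 for rounding down; both enter multiplied by q \<le> 1.\<close>
  define D where "D = B * (LINT y|lborel. cmod (u y))"
  have F_bound: "(cmod (F n s))\<^sup>2 \<le> D\<^sup>2 * indicator {-(r + real R + 1)..r + real R + 1} s" for n s
  proof (cases "\<bar>s\<bar> \<le> r + real R + 1")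
    case True
    have "cmod (F n s) \<le> (LINT y|lborel. B * cmod (u y))"
      unfolding F_def c_def L2_inner_def
    proof (rule Bochner_Integration.integral_norm_bound_integral)
      show "integrable lborel (\<lambda>y. g (q n * (y + of_int \<lfloor>s / q n\<rfloor>)) * cnj (u y))"
        by (rule Bochner_Integration.integrable_bound[where f = "\<lambda>y. B * cmod (u y)"])
           (use u_integrable B0 in \<open>auto simp: norm_mult intro!: mult_right_mono B\<close>)
    qed (use u_integrable in \<open>auto simp: norm_mult intro!: mult_right_mono B\<close>)
    then have "cmod (F n s) \<le> D" by (simp add: D_def)
    then show ?thesis using True power_mono[of "cmod (F n s)" D 2] by (auto simp: indicator_def abs_le_iff)
  next
    case False
    have "F n s = 0"
      unfolding F_def c_def
    proof (rule L2_inner_generator_eq_0)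
      fix y assume y: "0 \<le> y" "y \<le> real R"
      note mult_floor_bounds[OF q(1)[of n], of s]
      moreover have "0 \<le> q n * y" "q n * y \<le> real R"
        using q[of n] y mult_mono[of "q n" 1 y "real R"] by auto
      ultimately have "r < \<bar>q n * (y + of_int \<lfloor>s / q n\<rfloor>)\<bar>"
        using False q(2)[of n] unfolding distrib_left by linarith
      then show "g (q n * (y + of_int \<lfloor>s / q n\<rfloor>)) = 0" by (rule r(2))
    qed auto
    then show ?thesis by simp
  qed
  have "(\<lambda>n. LINT s|lborel. (cmod (F n s))\<^sup>2) \<longlonglongrightarrow> (LINT s|lborel. (cmod (g s))\<^sup>2)"
  proof (rule integral_dominated_convergence[where
        w = "\<lambda>s. D\<^sup>2 * indicator {-(r + real R + 1)..r + real R + 1} s"])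
    show "AE s in lborel. (\<lambda>n. (cmod (F n s))\<^sup>2) \<longlonglongrightarrow> (cmod (g s))\<^sup>2"
      using gc by eventually_elim (intro tendsto_intros F_lim)
    show "integrable lborel (\<lambda>s. D\<^sup>2 * indicator {-(r + real R + 1)..r + real R + 1} s)"
      using emeasure_bounded_finite[of "{-(r + real R + 1)..r + real R + 1}"]
      by (intro integrable_mult_right integrable_real_indicator) auto
  qed (use F_bound in auto)
  then show ?thesis
    unfolding int_F L2_norm_sq .
qed

text \<open>After rescaling, \<open>g\<close> becomes \<open>G n k\<close>, which lives on a set
  \<open>A n k\<close> shrinking to the point \<open>- k\<close>. By Cauchy-Schwarz the coefficient
  is controlled by the mass of \<open>u\<close> on that set, which tends to 0, and only finitely
  many \<open>k\<close>, the same for all \<open>n\<close>, contribute.\<close>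

lemma energy_coarse_scale_test_function:
  assumes g: "test_function g"
  shows "(\<lambda>n. energy u (int n) g) \<longlonglongrightarrow> 0"
proof -
  have gm [measurable]: "g \<in> borel_measurable borel" and gL: "g \<in> L2"
    using g L2_test_function[OF g] by (simp_all add: test_function_def)
  obtain r0 where r0: "\<And>x. r0 < \<bar>x\<bar> \<Longrightarrow> g x = 0"
    using g by (auto simp: test_function_def)
  define r where "r = \<bar>r0\<bar>"
  have r: "0 \<le> r" "\<And>x. r < \<bar>x\<bar> \<Longrightarrow> g x = 0"
    using r0 by (auto simp: r_def)
  define q where "q n = 2 powr real n" for n :: nat
  have q: "1 \<le> q n" for n
    by (auto simp: q_def ge_one_powr_ge_zero)
  define G where "G n k y = g (q n * (y + of_int k))" for n and k :: int and y
  define A where "A n k = {y. \<bar>q n * (y + of_int k)\<bar> \<le> r}" for n and k :: int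
  have A [measurable]: "A n k \<in> sets borel" for n k
    unfolding A_def by measurable
  have GL: "G n k \<in> L2" for n k
  proof -
    have "G n k = (\<lambda>y. g (q n * of_int k + q n * y))"
      by (auto simp: G_def algebra_simps)
    then show ?thesis
      using L2_affine[OF gL, of "q n" "q n * of_int k"] q[of n] by simp
  qed
  have Gnorm: "q n * (L2_norm (G n k))\<^sup>2 = (L2_norm g)\<^sup>2" for n k
  proof -
    have "L2_inner g g = of_real \<bar>q n\<bar> * L2_inner (G n k) (G n k)"
      using q[of n] by (subst L2_inner_affine[of "q n" g g "q n * of_int k"])
        (auto simp: G_def[abs_def] algebra_simps)
    then have "complex_of_real (q n * (L2_norm (G n k))\<^sup>2) = of_real ((L2_norm g)\<^sup>2)"
      using q[of n] by (simp add: L2_inner_self)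
    then show ?thesis by (simp only: of_real_eq_iff)
  qed
  have coef: "(cmod (L2_inner g (wavelet u (int n, k))))\<^sup>2 = q n * (cmod (L2_inner (G n k) u))\<^sup>2" for n k
    unfolding L2_inner_wavelet G_def q_def
    by (simp add: norm_mult power_mult_distrib power2_eq_square powr_add[symmetric])
  define K where "K = \<lceil>r\<rceil> + int R + 1"
  have c0: "L2_inner (G n k) u = 0" if "k \<notin> {- K..K}" for n k
  proof (rule L2_inner_generator_eq_0)
    fix y assume y: "0 \<le> y" "y \<le> real R"
    have "K + 1 \<le> \<bar>k\<bar>" using that by auto
    then have "real_of_int K + 1 \<le> \<bar>real_of_int k\<bar>" by linarith
    moreover have "r + real R + 1 \<le> real_of_int K"
      unfolding K_def by linarith
    ultimately have "r < \<bar>y + real_of_int k\<bar>" using y by linarith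
    also have "\<dots> \<le> \<bar>q n * (y + real_of_int k)\<bar>"
      using mult_right_mono[OF q[of n], of "\<bar>y + real_of_int k\<bar>"] q[of n] by (simp add: abs_mult)
    finally show "G n k y = 0" unfolding G_def by (rule r(2))
  qed (use GL in auto)
  have en: "energy u (int n) g = (\<Sum>k\<in>{- K..K}. q n * (cmod (L2_inner (G n k) u))\<^sup>2)" for n
    unfolding energy_def coef
    by (subst infsum_finite[symmetric], simp) (rule infsum_cong_neutral; use c0 in auto)
  have le: "q n * (cmod (L2_inner (G n k) u))\<^sup>2 \<le>
      (L2_norm g)\<^sup>2 * (L2_norm (\<lambda>y. indicator (A n k) y * u y))\<^sup>2" for n k
  proof -
    have "L2_inner (G n k) u = L2_inner (G n k) (\<lambda>y. indicator (A n k) y * u y)"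
      unfolding L2_inner_def
      by (intro Bochner_Integration.integral_cong) (auto simp: indicator_def A_def G_def r)
    then have "cmod (L2_inner (G n k) u) \<le> L2_norm (G n k) * L2_norm (\<lambda>y. indicator (A n k) y * u y)"
      using L2_Cauchy_Schwarz[OF GL L2_indicator_times[OF u_L2 A]] by metis
    from power_mono[OF this norm_ge_zero, of 2]
    have "q n * (cmod (L2_inner (G n k) u))\<^sup>2 \<le>
        q n * ((L2_norm (G n k))\<^sup>2 * (L2_norm (\<lambda>y. indicator (A n k) y * u y))\<^sup>2)"
      using q[of n] by (intro mult_left_mono) (auto simp: power_mult_distrib)
    then show ?thesis
      unfolding Gnorm[of n k, symmetric] by (simp only: mult.assoc)
  qed
  have lim: "(\<lambda>n. L2_norm (\<lambda>y. indicator (A n k) y * u y)) \<longlonglongrightarrow> 0" for k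
  proof -
    have "(\<lambda>n. L2_norm (\<lambda>y. indicator (A n k) y * u y - 0)) \<longlonglongrightarrow> 0"
    proof (rule L2_norm_tendsto_0_dominated[where w = "\<lambda>y. (cmod (u y))\<^sup>2"])
      show "AE y in lborel. (\<lambda>n. indicator (A n k) y * u y) \<longlonglongrightarrow> 0"
      \<comment> \<open>The point \<open>- k\<close> lies in \<open>A n k\<close> for all
        \<open>n\<close>; every other point eventually leaves.\<close>
      proof (rule AE_mp[OF AE_lborel_singleton[of "- of_int k"]], intro AE_I2 impI)
        fix y :: real assume "y \<noteq> - of_int k"
        then have d: "0 < \<bar>y + of_int k\<bar>" by linarith
        have "filterlim q at_top sequentially"
        proof (rule filterlim_at_top_mono[OF filterlim_real_sequentially always_eventually[OF allI]])
          fix n show "real n \<le> q n"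
            using of_nat_less_two_power[of n, where 'a = real] by (simp add: q_def powr_realpow less_imp_le)
        qed
        then have "eventually (\<lambda>n. r / \<bar>y + of_int k\<bar> < q n) sequentially"
          by (simp add: filterlim_at_top_dense)
        then have "eventually (\<lambda>n. 0 = indicator (A n k) y * u y) sequentially"
        proof eventually_elim
          case (elim n)
          then have "r < q n * \<bar>y + of_int k\<bar>"
            using d by (simp add: pos_divide_less_eq)
          then have "r < \<bar>q n * (y + of_int k)\<bar>"
            using q[of n] by (simp add: abs_mult)
          then show ?case by (simp add: A_def)
        qed
        then show "(\<lambda>n. indicator (A n k) y * u y) \<longlonglongrightarrow> 0"
          by (rule Lim_transform_eventually[OF tendsto_const])
      qed
    qed (use u_L2 in \<open>auto simp: indicator_def\<close>)
    then show ?thesis by simp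
  qed
  show ?thesis
  proof (rule Lim_null_comparison[OF always_eventually[OF allI]])
    fix n
    show "norm (energy u (int n) g) \<le>
        (\<Sum>k\<in>{- K..K}. (L2_norm g)\<^sup>2 * (L2_norm (\<lambda>y. indicator (A n k) y * u y))\<^sup>2)"
      using energy_nonneg[of u "int n" g] by (simp only: real_norm_def abs_of_nonneg en) (rule sum_mono, rule le)
  next
    have "(\<lambda>n. \<Sum>k\<in>{- K..K}. (L2_norm g)\<^sup>2 * (L2_norm (\<lambda>y. indicator (A n k) y * u y))\<^sup>2)
        \<longlonglongrightarrow> (\<Sum>k\<in>{- K..K}. (L2_norm g)\<^sup>2 * 0\<^sup>2)"
      by (intro tendsto_intros lim)
    then show "(\<lambda>n. \<Sum>k\<in>{- K..K}. (L2_norm g)\<^sup>2 * (L2_norm (\<lambda>y. indicator (A n k) y * u y))\<^sup>2) \<longlonglongrightarrow> 0"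
      by simp
  qed
qed

lemma energy_coarse_scale:
  assumes "f \<in> L2"
  shows "(\<lambda>n. energy u (int n) f) \<longlonglongrightarrow> 0"
  by (rule L2_tendsto_0_by_density[OF energy_diff_le energy_coarse_scale_test_function assms])

lemma energy_fine_scale:
  assumes f: "f \<in> L2" and u1: "(LINT x|lborel. u x) = 1"
  shows "(\<lambda>n. energy u (- int n) f) \<longlonglongrightarrow> (L2_norm f)\<^sup>2"
proof -
  have "(\<lambda>n. energy u (- int n) f - (L2_norm f)\<^sup>2) \<longlonglongrightarrow> 0"
  proof (rule L2_tendsto_0_by_density[OF _ _ f])
    fix n f g \<eta> assume "f \<in> L2" "g \<in> L2" "0 < \<eta>" "L2_norm (\<lambda>x. f x - g x) \<le> \<eta>"
    from energy_diff_le[OF this, of "- int n"] L2_norm_sq_diff_le[OF this]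
    show "\<bar>(energy u (- int n) f - (L2_norm f)\<^sup>2) - (energy u (- int n) g - (L2_norm g)\<^sup>2)\<bar>
       \<le> ((L2_norm u)\<^sup>2 * (real R + 1) + 2) * \<eta> * (1 + (L2_norm f)\<^sup>2 + (L2_norm g)\<^sup>2)"
      unfolding distrib_right by linarith
  next
    fix g assume "test_function g"
    from energy_fine_scale_test_function[OF this u1]
    show "(\<lambda>n. energy u (- int n) g - (L2_norm g)\<^sup>2) \<longlonglongrightarrow> 0"
      by (rule LIM_zero)
  qed
  then show ?thesis by (rule LIM_zero_cancel)
qed

end

section \<open>Quadrature mirror filters and the tight frame\<close>

text \<open>Tonelli's theorem for unordered sums. Finite index sets are enclosed in rectangles, so
  the iterated sums bound all finite partial sums and joint summability follows.\<close>

lemma has_sum_product_nonneg: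
  fixes f :: "'a \<times> 'b \<Rightarrow> real"
  assumes nonneg: "\<And>i. 0 \<le> f i" and inner: "\<And>x. ((\<lambda>y. f (x, y)) has_sum g x) UNIV"
    and outer: "(g has_sum s) UNIV"
  shows "(f has_sum s) UNIV"
proof -
  have "sum f F \<le> s" if F: "finite F" for F
  proof -
    have "sum f F \<le> sum f (fst ` F \<times> snd ` F)"
      using F nonneg by (intro sum_mono2) (auto simp: image_iff; force)+
    also have "\<dots> = (\<Sum>x\<in>fst ` F. \<Sum>y\<in>snd ` F. f (x, y))"
      using F by (simp add: sum.cartesian_product)
    also have "\<dots> \<le> (\<Sum>x\<in>fst ` F. g x)"
      using F nonneg
      by (intro sum_mono has_sum_mono2[OF has_sum_finite inner]) auto
    also have "\<dots> \<le> s"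
      using F nonneg has_sum_nonneg[OF inner]
      by (intro has_sum_mono2[OF has_sum_finite outer]) auto
    finally show ?thesis .
  qed
  then have summable: "f summable_on (UNIV \<times> UNIV)"
    using nonneg by (intro nonneg_bdd_above_summable_on bdd_aboveI2) auto
  have "infsum f (UNIV \<times> UNIV) = infsum (\<lambda>x. infsum (\<lambda>y. f (x, y)) UNIV) UNIV"
    using infsum_Sigma_banach[OF summable] by simp
  also have "\<dots> = s"
    using infsumI[OF inner] infsumI[OF outer] by simp
  finally show ?thesis
    using has_sum_infsum[OF summable] by simp
qed

lemma has_sum_int_shift:
  fixes x :: "int \<Rightarrow> 'a :: topological_comm_monoid_add"
  assumes "(x has_sum s) UNIV"
  shows "((\<lambda>k. x (k + 1)) has_sum s) UNIV"
proof -
  have "range (\<lambda>k::int. k + 1) = UNIV"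
    by (rule surjI[of _ "\<lambda>k. k - 1"]) simp
  then show ?thesis
    using assms has_sum_reindex[of "\<lambda>k::int. k + 1" UNIV x s] by (simp add: o_def)
qed

lemma has_sum_int_parity:
  fixes f :: "int \<Rightarrow> real"
  assumes "((\<lambda>k. f (2 * k)) has_sum x) UNIV" "((\<lambda>k. f (2 * k + 1)) has_sum y) UNIV"
  shows "(f has_sum (x + y)) UNIV"
proof -
  have "(f has_sum x) (range (\<lambda>k. 2 * k))" "(f has_sum y) (range (\<lambda>k. 2 * k + 1))"
    using assms by (subst has_sum_reindex; simp add: inj_on_def o_def)+
  moreover have "range (\<lambda>k::int. 2 * k) \<inter> range (\<lambda>k. 2 * k + 1) = {}"
    by (auto; presburger)
  moreover have "range (\<lambda>k::int. 2 * k) \<union> range (\<lambda>k. 2 * k + 1) = UNIV"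
    by (auto simp: image_iff; presburger)
  ultimately show ?thesis
    using has_sum_Un_disjoint by metis
qed

text \<open>Mixed terms at distance two cancel by the hypothesis, those in p0 p3 and p1 p2 cancel
  between the two squares. What remains is a difference of one expression at (p0, p1) and at (p2,
  p3), so it telescopes along a sequence.\<close>

lemma qmf_square_identity:
  fixes a0 a1 a2 a3 p0 p1 p2 p3 :: real
  assumes "a0 * a2 + a1 * a3 = 0"
  shows "(a0*p0 + a1*p1 + a2*p2 + a3*p3)\<^sup>2 + (a3*p0 - a2*p1 + a1*p2 - a0*p3)\<^sup>2 =
    (a0\<^sup>2 + a3\<^sup>2) * (p0\<^sup>2 + p3\<^sup>2) + (a1\<^sup>2 + a2\<^sup>2) * (p1\<^sup>2 + p2\<^sup>2)
     + (a0*a1 - a2*a3) * (2 * p0 * p1 - 2 * p2 * p3)"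
  using assms by algebra

text \<open>The two-channel filter bank preserves energy. Read (p0, p1, p2, p3) as c (2k), ..., c
  (2k + 3) and sum \<open>qmf_square_identity\<close> over \<open>k\<close>, for real and imaginary
  parts. The pair (p2, p3) is (p0, p1) with \<open>k\<close> advanced by one, so the mixed terms
  cancel and \<open>unit\<close> collects the squares.\<close>

lemma qmf_energy_split:
  fixes a :: "nat \<Rightarrow> real" and c :: "int \<Rightarrow> complex"
  assumes unit: "(a 0)\<^sup>2 + (a 1)\<^sup>2 + (a 2)\<^sup>2 + (a 3)\<^sup>2 = 1" and orth: "a 0 * a 2 + a 1 * a 3 = 0"
    and c: "(\<lambda>k. (cmod (c k))\<^sup>2) summable_on UNIV"
  shows "((\<lambda>k. (cmod (\<Sum>n=0..3. of_real (a n) * c (2 * k + int n)))\<^sup>2 +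
       (cmod (\<Sum>n=0..3. of_real ((-1) ^ n * a (3 - n)) * c (2 * k + int n)))\<^sup>2)
      has_sum (\<Sum>\<^sub>\<infinity>k. (cmod (c k))\<^sup>2)) UNIV"
proof -
  define x where "x k = (cmod (c (2 * k)))\<^sup>2" for k
  define y where "y k = (cmod (c (2 * k + 1)))\<^sup>2" for k
  define z where "z k = 2 * (Re (c (2 * k)) * Re (c (2 * k + 1)) + Im (c (2 * k)) * Im (c (2 * k + 1)))" for k
  have sub: "(\<lambda>k. (cmod (c k))\<^sup>2) summable_on A" for A
    using summable_on_subset_banach[OF c] by auto
  have "x summable_on UNIV" "y summable_on UNIV"
    using sub[of "range (\<lambda>k. 2 * k)"] sub[of "range (\<lambda>k. 2 * k + 1)"]
    unfolding x_def y_def by (subst (asm) (1 2) summable_on_reindex; simp add: inj_on_def o_def)+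
  then obtain X Y where X: "(x has_sum X) UNIV" and Y: "(y has_sum Y) UNIV"
    by (auto simp: summable_on_def)
  have XY: "(\<Sum>\<^sub>\<infinity>k. (cmod (c k))\<^sup>2) = X + Y"
    using X Y unfolding x_def y_def by (intro infsumI has_sum_int_parity)
  have zle: "\<bar>z k\<bar> \<le> x k + y k" for k
  proof -
    have "\<bar>2 * (p * q + r * s)\<bar> \<le> (p\<^sup>2 + r\<^sup>2) + (q\<^sup>2 + s\<^sup>2)" for p q r s :: real
    proof -
      have "0 \<le> (p - q)\<^sup>2 + (r - s)\<^sup>2" "0 \<le> (p + q)\<^sup>2 + (r + s)\<^sup>2" by simp_all
      then show ?thesis unfolding abs_le_iff power2_diff power2_sum by (simp add: algebra_simps)
    qed
    then show ?thesis unfolding x_def y_def z_def cmod_power2 .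
  qed
  \<comment> \<open>The mixed terms cancel by a shift of the index, which presupposes a convergent
    sum.\<close>
  have "z summable_on UNIV"
  proof (rule abs_summable_summable, rule nonneg_bdd_above_summable_on)
    have "(\<Sum>k\<in>F. norm (z k)) \<le> X + Y" if "finite F" for F
    proof -
      have "(\<Sum>k\<in>F. norm (z k)) \<le> (\<Sum>k\<in>F. x k + y k)"
        using zle by (intro sum_mono) simp
      also have "\<dots> \<le> X + Y"
        using that by (intro has_sum_mono2[OF has_sum_finite has_sum_add[OF X Y]]) (auto simp: x_def y_def)
      finally show ?thesis .
    qed
    then show "bdd_above (sum (\<lambda>k. norm (z k)) ` {F. F \<subseteq> UNIV \<and> finite F})"
      by (intro bdd_aboveI2) auto
  qed simp
  then obtain Z where Z: "(z has_sum Z) UNIV"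
    by (auto simp: summable_on_def)
  let ?A = "(a 0)\<^sup>2 + (a 3)\<^sup>2" and ?B = "(a 1)\<^sup>2 + (a 2)\<^sup>2" and ?C = "a 0 * a 1 - a 2 * a 3"
  have "((\<lambda>k. ?A * (x k + y (k + 1)) + ?B * (y k + x (k + 1)) + ?C * (z k + (-1) * z (k + 1)))
     has_sum (?A * (X + Y) + ?B * (Y + X) + ?C * (Z + (-1) * Z))) UNIV"
    by (intro has_sum_add has_sum_cmult_right has_sum_int_shift X Y Z)
  also have "?A * (X + Y) + ?B * (Y + X) + ?C * (Z + (-1) * Z) =
      ((a 0)\<^sup>2 + (a 1)\<^sup>2 + (a 2)\<^sup>2 + (a 3)\<^sup>2) * (X + Y)"
    by (simp add: algebra_simps)
  also have "\<dots> = (\<Sum>\<^sub>\<infinity>k. (cmod (c k))\<^sup>2)"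
    by (simp only: unit XY mult_1_left)
  also have "(\<lambda>k. ?A * (x k + y (k + 1)) + ?B * (y k + x (k + 1)) + ?C * (z k + (-1) * z (k + 1))) =
    (\<lambda>k. (cmod (\<Sum>n=0..3. of_real (a n) * c (2 * k + int n)))\<^sup>2 +
       (cmod (\<Sum>n=0..3. of_real ((-1) ^ n * a (3 - n)) * c (2 * k + int n)))\<^sup>2)"
  proof
    fix k
    have s: "(\<Sum>n=0..3. of_real (b n) * c (2 * k + int n)) = of_real (b 0) * c (2 * k) +
       of_real (b 1) * c (2 * k + 1) + of_real (b 2) * c (2 * (k + 1)) + of_real (b 3) * c (2 * (k + 1) + 1)"
      for b :: "nat \<Rightarrow> real"
      by (simp add: numeral_eq_Suc algebra_simps)
    show "?A * (x k + y (k + 1)) + ?B * (y k + x (k + 1)) + ?C * (z k + (-1) * z (k + 1)) =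
      (cmod (\<Sum>n=0..3. of_real (a n) * c (2 * k + int n)))\<^sup>2 +
       (cmod (\<Sum>n=0..3. of_real ((-1) ^ n * a (3 - n)) * c (2 * k + int n)))\<^sup>2"
      unfolding s x_def y_def z_def cmod_power2
      using qmf_square_identity[OF orth, of "Re (c (2 * k))" "Re (c (2 * k + 1))" "Re (c (2 * (k + 1)))" "Re (c (2 * (k + 1) + 1))"]
        qmf_square_identity[OF orth, of "Im (c (2 * k))" "Im (c (2 * k + 1))" "Im (c (2 * (k + 1)))" "Im (c (2 * (k + 1) + 1))"]
      by (simp add: numeral_eq_Suc) (simp add: algebra_simps)
  qed
  finally show ?thesis .
qed

text \<open>The two-scale relation at the point 2^(1 - j) x - 2 k. The factor 1 / sqrt 2 is the
  quotient of the normalisations at levels \<open>j\<close> and \<open>j - 1\<close>.\<close>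

lemma wavelet_two_scale:
  fixes b :: "nat \<Rightarrow> real"
  assumes [measurable]: "v \<in> borel_measurable borel" "w \<in> borel_measurable borel"
    and vw: "AE x in lborel. of_real (1 / sqrt 2) * w (x / 2) = (\<Sum>n=0..3. of_real (b n) * v (x - real n))"
  shows "AE x in lborel. wavelet w (j, k) x = (\<Sum>n=0..3. of_real (b n) * wavelet v (j - 1, 2 * k + int n) x)"
proof -
  define t where "t = - 2 * real_of_int k"
  define s :: real where "s = 2 powr (- of_int (j - 1))"
  have s: "s = 2 * 2 powr (- of_int j)"
    unfolding s_def by (simp add: powr_diff powr_minus field_simps)
  have "AE x in lborel. of_real (1 / sqrt 2) * w ((t + s * x) / 2) =
      (\<Sum>n=0..3. of_real (b n) * v ((t + s * x) - real n))"
    by (rule AE_borel_affine[OF _ _ vw]) (simp add: s_def, measurable)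
  then show ?thesis
  proof eventually_elim
    case (elim x)
    have e: "(t + s * x) / 2 = - of_int k + 2 powr (- of_int j) * x"
      by (simp add: t_def s field_simps)
    have c: "complex_of_real (2 powr (- of_int j / 2)) = of_real (2 powr (- of_int (j - 1) / 2)) * of_real (1 / sqrt 2)"
    proof -
      have "2 powr (- of_int (j - 1) / 2) = 2 powr (- of_int j / 2) * 2 powr (1 / 2 :: real)"
        by (subst powr_add[symmetric]) (simp add: field_simps)
      also have "2 powr (1 / 2 :: real) = sqrt 2" by (simp add: powr_half_sqrt)
      finally have *: "2 powr (- of_int (j - 1) / 2) = 2 powr (- of_int j / 2) * sqrt 2" .
      show ?thesis
        unfolding * of_real_mult[symmetric] of_real_eq_iff by simp
    qed
    have "wavelet w (j, k) x = of_real (2 powr (- of_int (j - 1) / 2)) *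
       (of_real (1 / sqrt 2) * w ((t + s * x) / 2))"
      unfolding wavelet_eq c e by simp
    also have "\<dots> = (\<Sum>n=0..3. of_real (b n) * wavelet v (j - 1, 2 * k + int n) x)"
      unfolding elim sum_distrib_left
      by (intro sum.cong refl) (simp add: wavelet_eq t_def s_def algebra_simps)
    finally show ?case .
  qed
qed

text \<open>Collects what the frame argument takes from the father function, so that it runs once
  for all angles. The coefficients enter through two quadratic relations and the two-scale
  equations.\<close>

locale scaling_function = compact_generator \<phi> 3 for \<phi> :: "real \<Rightarrow> complex" +
  fixes a :: "nat \<Rightarrow> real" and \<psi> :: "real \<Rightarrow> complex"
  assumes unit: "(a 0)\<^sup>2 + (a 1)\<^sup>2 + (a 2)\<^sup>2 + (a 3)\<^sup>2 = 1"
    and orth: "a 0 * a 2 + a 1 * a 3 = 0"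
    and integral_1: "(LINT x|lborel. \<phi> x) = 1"
    and refinement: "AE x in lborel. of_real (1 / sqrt 2) * \<phi> (x / 2) =
        (\<Sum>n=0..3. of_real (a n) * \<phi> (x - real n))"
    and mother_L2: "\<psi> \<in> L2"
    and mother: "AE x in lborel. of_real (1 / sqrt 2) * \<psi> (x / 2) =
        (\<Sum>n=0..3. of_real ((- 1) ^ n * a (3 - n)) * \<phi> (x - real n))"
begin

lemma L2_inner_two_scale:
  fixes b :: "nat \<Rightarrow> real"
  assumes f: "f \<in> L2" and w: "w \<in> L2"
    and "AE x in lborel. of_real (1 / sqrt 2) * w (x / 2) = (\<Sum>n=0..3. of_real (b n) * \<phi> (x - real n))"
  shows "L2_inner f (wavelet w (j, k)) =
    (\<Sum>n=0..3. of_real (b n) * L2_inner f (wavelet \<phi> (j - 1, 2 * k + int n)))"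
proof -
  have "L2_inner f (wavelet w (j, k)) =
      L2_inner f (\<lambda>x. \<Sum>n=0..3. of_real (b n) * wavelet \<phi> (j - 1, 2 * k + int n) x)"
    using wavelet_two_scale[OF u_measurable L2_measurable[OF w] assms(3)]
    by (intro L2_inner_cong_AE L2_measurable L2_sum L2_scale L2_wavelet f w u_L2) auto
  also have "\<dots> = (\<Sum>n=0..3. L2_inner f (\<lambda>x. of_real (b n) * wavelet \<phi> (j - 1, 2 * k + int n) x))"
    by (intro L2_inner_sum_right L2_scale L2_wavelet u_L2 f)
  finally show ?thesis
    by (simp add: L2_inner_scale_right)
qed

lemma mother_energy_has_sum:
  assumes f: "f \<in> L2"
  shows "((\<lambda>k. (cmod (L2_inner f (wavelet \<psi> (j, k))))\<^sup>2) has_sum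
    (energy \<phi> (j - 1) f - energy \<phi> j f)) UNIV"
proof -
  have "((\<lambda>k. (cmod (L2_inner f (wavelet \<phi> (j, k))))\<^sup>2 + (cmod (L2_inner f (wavelet \<psi> (j, k))))\<^sup>2)
      has_sum energy \<phi> (j - 1) f) UNIV"
  proof -
    define c where "c m = L2_inner f (wavelet \<phi> (j - 1, m))" for m
    have "L2_inner f (wavelet \<phi> (j, k)) = (\<Sum>n=0..3. of_real (a n) * c (2 * k + int n))"
      and "L2_inner f (wavelet \<psi> (j, k)) = (\<Sum>n=0..3. of_real ((-1) ^ n * a (3 - n)) * c (2 * k + int n))" for k
      unfolding c_def by (rule L2_inner_two_scale[OF f u_L2 refinement] L2_inner_two_scale[OF f mother_L2 mother])+
    moreover have "energy \<phi> (j - 1) f = (\<Sum>\<^sub>\<infinity>k. (cmod (c k))\<^sup>2)"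
      by (simp add: energy_def c_def)
    moreover have "(\<lambda>k. (cmod (c k))\<^sup>2) summable_on UNIV"
      unfolding c_def by (rule energy_summable[OF f])
    ultimately show ?thesis
      using qmf_energy_split[OF unit orth, of c] by presburger
  qed
  moreover have "((\<lambda>k. (-1) * (cmod (L2_inner f (wavelet \<phi> (j, k))))\<^sup>2) has_sum (-1) * energy \<phi> j f) UNIV"
    unfolding energy_def by (intro has_sum_cmult_right has_sum_infsum energy_summable f)
  ultimately have "((\<lambda>k. ((cmod (L2_inner f (wavelet \<phi> (j, k))))\<^sup>2 + (cmod (L2_inner f (wavelet \<psi> (j, k))))\<^sup>2)
      + (-1) * (cmod (L2_inner f (wavelet \<phi> (j, k))))\<^sup>2) has_sum
      (energy \<phi> (j - 1) f + (-1) * energy \<phi> j f)) UNIV"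
    by (rule has_sum_add)
  then show ?thesis by simp
qed

lemma energy_antimono:
  assumes f: "f \<in> L2" shows "energy \<phi> j f \<le> energy \<phi> (j - 1) f"
  using has_sum_nonneg[OF mother_energy_has_sum[OF f, of j]] by simp

lemma energy_minus_Suc:
  assumes f: "f \<in> L2" shows "energy \<phi> (- int n) f \<le> energy \<phi> (- int (Suc n)) f"
proof -
  have "- int n - 1 = - int (Suc n)" by simp
  then show ?thesis
    using energy_antimono[OF f, of "- int n"] by (simp only:)
qed

text \<open>Energies grow towards finer scales, where they tend to the squared norm. Applied to the
  father function itself this bounds its norm by 1.\<close>

lemma energy_0_le:
  assumes f: "f \<in> L2" shows "energy \<phi> 0 f \<le> (L2_norm f)\<^sup>2"
proof (rule LIMSEQ_le_const[OF energy_fine_scale[OF f integral_1]], intro exI allI impI)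
  fix n :: nat
  show "energy \<phi> 0 f \<le> energy \<phi> (- int n) f"
  proof (induction n)
    case (Suc n)
    then show ?case using energy_minus_Suc[OF f] order_trans by blast
  qed simp
qed

lemma Parseval:
  assumes f: "f \<in> L2"
  shows "((\<lambda>i. (cmod (L2_inner f (wavelet \<psi> i)))\<^sup>2) has_sum (L2_norm f)\<^sup>2) UNIV"
proof (rule has_sum_product_nonneg[OF _ mother_energy_has_sum[OF f]])
  let ?e = "\<lambda>j. energy \<phi> j f"
  let ?d = "\<lambda>j. ?e (j - 1) - ?e j"
  \<comment> \<open>Levels j \<ge> 1, along which the energies fall from \<open>?e 0\<close> to
    0.\<close>
  have "(\<lambda>n. ?e (int n) - ?e (int (Suc n))) sums (?e (int 0) - 0)"
    by (rule telescope_sums'[OF energy_coarse_scale[OF f]])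
  then have "((\<lambda>n. ?e (int n) - ?e (int (Suc n))) has_sum (?e 0 - 0)) UNIV"
    using energy_antimono[OF f, of "int (Suc n)" for n] by (intro sums_nonneg_imp_has_sum) auto
  then have 1: "(?d has_sum ?e 0) (range (\<lambda>n. int n + 1))"
    by (subst has_sum_reindex) (auto simp: inj_on_def o_def add.commute)
  \<comment> \<open>Levels j \<le> 0, along which they rise from \<open>?e 0\<close> to the squared
    norm of \<open>f\<close>.\<close>
  have "(\<lambda>n. ?e (- int (Suc n)) - ?e (- int n)) sums ((L2_norm f)\<^sup>2 - ?e (- int 0))"
    by (rule telescope_sums[OF energy_fine_scale[OF f integral_1]])
  then have "((\<lambda>n. ?e (- int (Suc n)) - ?e (- int n)) has_sum ((L2_norm f)\<^sup>2 - ?e 0)) UNIV"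
    using energy_minus_Suc[OF f] by (intro sums_nonneg_imp_has_sum) (simp_all only: diff_ge_0_iff_ge minus_zero of_nat_0)
  then have 2: "(?d has_sum ((L2_norm f)\<^sup>2 - ?e 0)) (range (\<lambda>n. - int n))"
    by (subst has_sum_reindex) (auto simp: inj_on_def o_def minus_diff_commute)
  have "range (\<lambda>n. int n + 1) \<inter> range (\<lambda>n. - int n) = {}" by auto
  moreover have "range (\<lambda>n. int n + 1) \<union> range (\<lambda>n. - int n) = UNIV"
  proof -
    have "j \<in> range (\<lambda>n. int n + 1) \<union> range (\<lambda>n. - int n)" for j :: int
    proof (cases "j > 0")
      case True
      then have "j = int (nat (j - 1)) + 1" by simp
      then show ?thesis by blast
    next
      case False
      then have "j = - int (nat (- j))" by simp
      then show ?thesis by blast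
    qed
    then show ?thesis by blast
  qed
  ultimately show "(?d has_sum (L2_norm f)\<^sup>2) UNIV"
    using has_sum_Un_disjoint[OF 1 2] by simp
qed simp

lemma tight_frame: "is_tight_frame (wavelet \<psi>)"
  unfolding is_tight_frame_def
  using Parseval by (auto intro!: L2_wavelet mother_L2 exI[of _ "1::real"])

text \<open>For a member of the family with norm 1, Parseval's identity reads 1 = 1 + the squares of
  its inner products with all other members, so these vanish. Completeness is Parseval again: the
  squared distance of \<open>f\<close> to a finite part of its expansion is the missing part of the
  sum.\<close>

lemma orthonormal_basis_iff: "is_orthonormal_basis (wavelet \<psi>) \<longleftrightarrow> L2_norm \<psi> = 1"
proof
  assume "is_orthonormal_basis (wavelet \<psi>)"
  then have "L2_inner (wavelet \<psi> (0, 0)) (wavelet \<psi> (0, 0)) = 1"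
    unfolding is_orthonormal_basis_def by presburger
  then have "(L2_norm \<psi>)\<^sup>2 = 1"
    unfolding L2_inner_self L2_norm_wavelet by (simp only: of_real_eq_1_iff)
  then show "L2_norm \<psi> = 1"
    using L2_norm_nonneg[of \<psi>] by (simp add: power2_eq_1_iff)
next
  assume norm: "L2_norm \<psi> = 1"
  have self: "L2_inner (wavelet \<psi> i) (wavelet \<psi> i) = 1" for i
    by (simp add: L2_inner_self L2_norm_wavelet norm)
  have ortho: "L2_inner (wavelet \<psi> i) (wavelet \<psi> i') = (if i = i' then 1 else 0)" for i i'
  proof (cases "i = i'")
    case False
    have "(\<Sum>l\<in>{i, i'}. (cmod (L2_inner (wavelet \<psi> i) (wavelet \<psi> l)))\<^sup>2) \<le> (L2_norm (wavelet \<psi> i))\<^sup>2"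
      by (rule has_sum_mono2[OF has_sum_finite Parseval[OF L2_wavelet[OF mother_L2]]]) auto
    then show ?thesis
      using False by (simp add: self L2_norm_wavelet norm)
  qed (simp add: self)
  have "\<exists>F c. finite F \<and> L2_norm (\<lambda>x. f x - (\<Sum>i\<in>F. c i * wavelet \<psi> i x)) < \<epsilon>"
    if f: "f \<in> L2" and \<epsilon>: "\<epsilon> > 0" for f \<epsilon>
  proof -
    define c where "c i = L2_inner f (wavelet \<psi> i)" for i
    have "(sum (\<lambda>i. (cmod (c i))\<^sup>2) \<longlongrightarrow> (L2_norm f)\<^sup>2) (finite_subsets_at_top UNIV)"
      using Parseval[OF f] unfolding has_sum_def c_def .
    then have "eventually (\<lambda>F. (L2_norm f)\<^sup>2 - \<epsilon>\<^sup>2 < (\<Sum>i\<in>F. (cmod (c i))\<^sup>2)) (finite_subsets_at_top UNIV)"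
      using \<epsilon> by (intro order_tendstoD) auto
    then obtain F where F: "finite F" "(L2_norm f)\<^sup>2 - \<epsilon>\<^sup>2 < (\<Sum>i\<in>F. (cmod (c i))\<^sup>2)"
      unfolding eventually_finite_subsets_at_top by blast
    let ?g = "\<lambda>x. \<Sum>i\<in>F. c i * wavelet \<psi> i x"
    have g: "?g \<in> L2"
      by (intro L2_sum L2_scale L2_wavelet mother_L2)
    have fg: "L2_inner f ?g = of_real (\<Sum>i\<in>F. (cmod (c i))\<^sup>2)"
    proof -
      have "L2_inner f ?g = (\<Sum>i\<in>F. cnj (c i) * c i)"
        by (subst L2_inner_sum_right)
           (auto intro!: L2_scale L2_wavelet mother_L2 f simp: L2_inner_scale_right c_def)
      also have "\<dots> = (\<Sum>i\<in>F. of_real ((cmod (c i))\<^sup>2))"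
        by (intro sum.cong refl) (simp only: complex_norm_square mult.commute)
      finally show ?thesis by simp
    qed
    have gg: "(L2_norm ?g)\<^sup>2 = (\<Sum>i\<in>F. (cmod (c i))\<^sup>2)"
    proof -
      have inner: "L2_inner h ?g = (\<Sum>l\<in>F. cnj (c l) * L2_inner h (wavelet \<psi> l))" if "h \<in> L2" for h
        by (subst L2_inner_sum_right)
           (auto intro!: L2_scale L2_wavelet mother_L2 that simp: L2_inner_scale_right)
      have "L2_inner ?g ?g = (\<Sum>i\<in>F. c i * L2_inner (wavelet \<psi> i) ?g)"
        using g by (subst L2_inner_sum_left)
           (auto intro!: L2_scale L2_wavelet mother_L2 simp: L2_inner_scale_left)
      also have "\<dots> = (\<Sum>i\<in>F. c i * (\<Sum>l\<in>F. cnj (c l) * L2_inner (wavelet \<psi> i) (wavelet \<psi> l)))"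
        by (simp only: inner L2_wavelet mother_L2)
      also have "\<dots> = (\<Sum>i\<in>F. of_real ((cmod (c i))\<^sup>2))"
        using F(1) by (intro sum.cong refl) (simp add: ortho complex_norm_square if_distrib[of "\<lambda>x. cnj _ * x"] del: of_real_power cong: if_cong)
      finally have "complex_of_real ((L2_norm ?g)\<^sup>2) = of_real (\<Sum>i\<in>F. (cmod (c i))\<^sup>2)"
        by (simp add: L2_inner_self)
      then show ?thesis by (simp only: of_real_eq_iff)
    qed
    have "(L2_norm (\<lambda>x. f x - ?g x))\<^sup>2 = (L2_norm f)\<^sup>2 - (\<Sum>i\<in>F. (cmod (c i))\<^sup>2)"
      unfolding L2_norm_diff_sq[OF f g] fg gg by simp
    then have "(L2_norm (\<lambda>x. f x - ?g x))\<^sup>2 < \<epsilon>\<^sup>2"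
      using F(2) by simp
    then have "L2_norm (\<lambda>x. f x - ?g x) < \<epsilon>"
      by (rule power2_less_imp_less) (use \<epsilon> in simp)
    then show ?thesis using F(1) by blast
  qed
  then show "is_orthonormal_basis (wavelet \<psi>)"
    unfolding is_orthonormal_basis_def using ortho L2_wavelet[OF mother_L2] by blast
qed

end

section \<open>Fourier transforms of trapezoids\<close>

text \<open>A Fejer kernel, 2 sin^2 (a t / 2) / t^2. Its integral is proportional to the absolute
  value of \<open>a\<close>, which is how piecewise linear functions arise. Division by zero gives
  the value 0 at t = 0, a null set.\<close>

definition cos_kernel :: "real \<Rightarrow> real \<Rightarrow> real" where
  "cos_kernel a t = (1 - cos (a * t)) / t\<^sup>2"

lemma cos_kernel_nonneg: "0 \<le> cos_kernel a t"
  by (simp add: cos_kernel_def)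

lemma cos_kernel_measurable [measurable]: "cos_kernel a \<in> borel_measurable borel"
  unfolding cos_kernel_def[abs_def] by measurable

lemma one_minus_cos_le: "1 - cos x \<le> x\<^sup>2 / 2" for x :: real
proof -
  have "(sin (x / 2))\<^sup>2 \<le> (x / 2)\<^sup>2"
    using abs_sin_x_le_abs_x[of "x / 2"] by (simp only: abs_le_square_iff)
  moreover have "cos x = 1 - 2 * (sin (x / 2))\<^sup>2"
    using cos_double_sin[of "x / 2"] by simp
  ultimately show ?thesis by (simp add: power_divide)
qed

lemma cos_kernel_le: "cos_kernel a t \<le> a\<^sup>2 / 2"
  using one_minus_cos_le[of "a * t"]
  by (cases "t = 0") (simp_all add: cos_kernel_def power_mult_distrib field_simps)

lemma integrable_cos_kernel_1: "integrable lborel (cos_kernel 1)"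
proof -
  let ?h = "\<lambda>t::real. inverse (1 + t\<^sup>2) * indicator {0..} t"
  have "(\<integral>\<^sup>+t. ennreal (inverse (1 + t\<^sup>2)) * indicator {0..} t \<partial>lborel) = ennreal (pi / 2 - arctan 0)"
  proof (rule nn_integral_FTC_atLeast)
    show "(arctan \<longlongrightarrow> pi / 2) at_top" by (rule tendsto_arctan_at_top)
    show "DERIV arctan x :> inverse (1 + x\<^sup>2)" for x by (rule DERIV_arctan)
  qed auto
  then have "(\<integral>\<^sup>+t. ennreal (?h t) \<partial>lborel) < \<infinity>"
    by (simp add: ennreal_mult' ennreal_indicator)
  then have h: "integrable lborel ?h"
    by (intro integrableI_bounded) (auto simp: abs_mult)
  from lborel_integrable_real_affine[OF this, of "-1" 0]
  have "integrable lborel (\<lambda>t. ?h (- t))" by simp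
  then have "integrable lborel (\<lambda>t. 4 * (?h t + ?h (- t)))"
    using h by (intro integrable_mult_right Bochner_Integration.integrable_add)
  then show ?thesis
  proof (rule Bochner_Integration.integrable_bound)
    \<comment> \<open>The constant 4 covers both ranges: the kernel is at most 1/2 everywhere, and
      for |t| > 1 one has 1 - cos t \<le> 2 and 1 + t^2 \<le> 2 t^2.\<close>
    have "cos_kernel 1 t \<le> 4 * inverse (1 + t\<^sup>2)" for t
    proof (cases "t\<^sup>2 \<le> 1")
      case True
      then have "1 / 2 \<le> 4 * inverse (1 + t\<^sup>2)"
        by (simp add: field_simps add_pos_nonneg)
      then show ?thesis using cos_kernel_le[of 1 t] by simp
    next
      case False
      then have "t\<^sup>2 > 0" "1 + t\<^sup>2 > 0" by linarith+
      moreover have "(1 - cos t) * (1 + t\<^sup>2) \<le> 2 * (2 * t\<^sup>2)"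
        using False cos_ge_minus_one[of t] by (intro mult_mono) linarith+
      ultimately show ?thesis
        by (simp add: cos_kernel_def field_simps)
    qed
    moreover have "inverse (1 + t\<^sup>2) \<le> ?h t + ?h (- t)" for t :: real
      by (auto simp: indicator_def)
    ultimately have "cos_kernel 1 t \<le> 4 * (?h t + ?h (- t))" for t
      by (smt (verit) mult_left_mono)
    then show "AE t in lborel. norm (cos_kernel 1 t) \<le> norm (4 * (?h t + ?h (- t)))"
      using cos_kernel_nonneg by (intro AE_I2) (simp add: abs_of_nonneg)
  qed simp
qed

lemma cos_kernel_scale: "cos_kernel a t = a\<^sup>2 * cos_kernel 1 (0 + a * t)"
  by (simp add: cos_kernel_def power_mult_distrib)

lemma integrable_cos_kernel: "integrable lborel (cos_kernel a)"
proof (cases "a = 0")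
  case False
  then show ?thesis
    unfolding cos_kernel_scale[of a, abs_def]
    by (intro integrable_mult_right lborel_integrable_real_affine integrable_cos_kernel_1)
qed (simp add: cos_kernel_def[abs_def])

text \<open>The value is \<open>pi\<close>, but only its positivity matters.\<close>

definition kernel_const :: real where
  "kernel_const = (LINT t|lborel. cos_kernel 1 t)"

lemma integral_cos_kernel: "(LINT t|lborel. cos_kernel a t) = \<bar>a\<bar> * kernel_const"
proof (cases "a = 0")
  case False
  have "kernel_const = \<bar>a\<bar> * (LINT t|lborel. cos_kernel 1 (0 + a * t))"
    unfolding kernel_const_def using lborel_integral_real_affine[OF False, of "cos_kernel 1" 0] by simp
  then have "\<bar>a\<bar> * kernel_const = (\<bar>a\<bar> * \<bar>a\<bar>) * (LINT t|lborel. cos_kernel 1 (0 + a * t))"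
    by (simp only: mult.assoc)
  then have "\<bar>a\<bar> * kernel_const = a\<^sup>2 * (LINT t|lborel. cos_kernel 1 (0 + a * t))"
    by (simp only: abs_mult_self_eq power2_eq_square)
  then show ?thesis
    unfolding cos_kernel_scale[of a] by simp
qed (simp add: cos_kernel_def[abs_def])

lemma kernel_const_pos: "kernel_const > 0"
proof -
  \<comment> \<open>A lower bound of the kernel on [1, 2], where cos t \<le> cos 1 and t^2 \<le>
    4.\<close>
  have "0 < (1 - cos 1) / (4::real)"
    using cos_monotone_0_pi[of 0 1] pi_gt3 by simp
  also have "\<dots> = (LINT t|lborel. (1 - cos (1::real)) / 4 * indicator {1..2::real} t)" by simp
  also have "\<dots> \<le> kernel_const"
    unfolding kernel_const_def
  proof (rule integral_mono[OF _ integrable_cos_kernel_1])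
    show "integrable lborel (\<lambda>t. (1 - cos (1::real)) / 4 * indicator {1..2::real} t)" by simp
    fix t :: real
    show "(1 - cos 1) / 4 * indicator {1..2} t \<le> cos_kernel 1 t"
    proof (cases "t \<in> {1..2}")
      case True
      then have "cos t \<le> cos 1" "t\<^sup>2 \<le> 2\<^sup>2" "0 < t"
        using pi_gt3 power_mono[of t 2 2] by (auto intro!: cos_monotone_0_pi_le)
      then have "(1 - cos 1) / 4 \<le> (1 - cos t) / t\<^sup>2"
        by (intro frac_le) auto
      then show ?thesis using True by (simp add: cos_kernel_def)
    qed (simp add: cos_kernel_nonneg)
  qed
  finally show ?thesis .
qed

text \<open>For 0 \<le> q \<le> p this is a plateau of height 2 (p - q) on [-q, q] with linear
  flanks reaching 0 at distance \<open>p\<close>. It is written with absolute values because these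
  are what \<open>integral_cos_kernel\<close> produces.\<close>

definition trapezoid :: "real \<Rightarrow> real \<Rightarrow> real \<Rightarrow> real" where
  "trapezoid p q y = \<bar>y + p\<bar> + \<bar>y - p\<bar> - \<bar>y + q\<bar> - \<bar>y - q\<bar>"

lemma trapezoid_measurable [measurable]: "trapezoid p q \<in> borel_measurable borel"
  unfolding trapezoid_def[abs_def] by measurable

lemma trapezoid_eq_0: "0 \<le> q \<Longrightarrow> q \<le> p \<Longrightarrow> p \<le> \<bar>y\<bar> \<Longrightarrow> trapezoid p q y = 0"
  by (auto simp: trapezoid_def)

lemma trapezoid_eq: "q \<le> p \<Longrightarrow> \<bar>y\<bar> \<le> q \<Longrightarrow> trapezoid p q y = 2 * (p - q)"
  by (auto simp: trapezoid_def)

lemma trapezoid_bounds: "0 \<le> q \<Longrightarrow> q \<le> p \<Longrightarrow> 0 \<le> trapezoid p q y \<and> trapezoid p q y \<le> 2 * (p - q)"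
  by (auto simp: trapezoid_def)

lemma trapezoid_half: "trapezoid p q (y / 2) = trapezoid (2 * p) (2 * q) y / 2"
  by (auto simp: trapezoid_def abs_if field_simps)

text \<open>Up to a constant, the inverse Fourier transform of a translated trapezoid.\<close>

definition trapezoid_hat :: "real \<Rightarrow> real \<Rightarrow> real \<Rightarrow> real \<Rightarrow> complex" where
  "trapezoid_hat p q c t = exp (\<i> * of_real (t * c)) * of_real ((cos (q * t) - cos (p * t)) / t\<^sup>2)"

lemma cos_diff_kernel: "(cos (q * t) - cos (p * t)) / t\<^sup>2 = cos_kernel p t - cos_kernel q t"
  by (simp add: cos_kernel_def diff_divide_distrib)

lemma trapezoid_hat_measurable [measurable]: "trapezoid_hat p q c \<in> borel_measurable borel"
  unfolding trapezoid_hat_def[abs_def] by measurable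

lemma norm_trapezoid_hat: "cmod (trapezoid_hat p q c t) = \<bar>cos_kernel p t - cos_kernel q t\<bar>"
  unfolding trapezoid_hat_def cos_diff_kernel norm_mult norm_of_real by simp

lemma integrable_trapezoid_hat: "integrable lborel (trapezoid_hat p q c)"
proof (rule Bochner_Integration.integrable_bound)
  show "integrable lborel (\<lambda>t. cos_kernel p t - cos_kernel q t)"
    by (intro Bochner_Integration.integrable_diff integrable_cos_kernel)
qed (auto simp: norm_trapezoid_hat)

lemma L2_trapezoid_hat: "trapezoid_hat p q c \<in> L2"
proof (rule L2_I)
  let ?M = "p\<^sup>2 / 2 + q\<^sup>2 / 2"
  show "integrable lborel (\<lambda>t. ?M * cmod (trapezoid_hat p q c t))"
    using integrable_trapezoid_hat by simp
  fix t
  have "cmod (trapezoid_hat p q c t) \<le> ?M"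
    using cos_kernel_le[of p t] cos_kernel_le[of q t] cos_kernel_nonneg[of p t] cos_kernel_nonneg[of q t]
    unfolding norm_trapezoid_hat by linarith
  then show "(cmod (trapezoid_hat p q c t))\<^sup>2 \<le> ?M * cmod (trapezoid_hat p q c t)"
    unfolding power2_eq_square by (rule mult_right_mono) simp
qed simp

lemma integral_odd_real:
  fixes f :: "real \<Rightarrow> real"
  assumes "\<And>x. f (- x) = - f x"
  shows "(LINT x|lborel. f x) = 0"
  using lborel_integral_real_affine[of "-1" f 0] assms by simp

text \<open>The sine part is odd and integrates to 0. In the cosine part the product formula turns
  cos (t y) (cos (q t) - cos (p t)) into four kernels, whose integrals are multiples of |y + p|, |y
  - p|, |y + q| and |y - q|.\<close>

lemma fourier_trapezoid_hat:
  "(LINT t|lborel. exp (- \<i> * of_real (t * x)) * trapezoid_hat p q c t) =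
     of_real (kernel_const / 2 * trapezoid p q (x - c))"
proof -
  define y where "y = x - c"
  define k where "k t = cos_kernel p t - cos_kernel q t" for t
  have k: "integrable lborel k"
    unfolding k_def by (intro Bochner_Integration.integrable_diff integrable_cos_kernel)
  have km [measurable]: "k \<in> borel_measurable borel"
    unfolding k_def[abs_def] by measurable
  have i1: "integrable lborel (\<lambda>t. cos (t * y) * k t)" and i2: "integrable lborel (\<lambda>t. - sin (t * y) * k t)"
    by (rule Bochner_Integration.integrable_bound[OF k];
        auto simp: abs_mult intro!: mult_left_le_one_le)+
  have "exp (- \<i> * of_real (t * x)) * trapezoid_hat p q c t =
      of_real (cos (t * y) * k t) + \<i> * of_real (- sin (t * y) * k t)" for t
  proof -
    have "exp (- \<i> * of_real (t * x)) * exp (\<i> * of_real (t * c)) = cis (- (t * y))"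
      by (simp add: exp_add[symmetric] cis_conv_exp y_def algebra_simps)
    then show ?thesis
      unfolding trapezoid_hat_def cos_diff_kernel k_def[symmetric] mult.assoc[symmetric]
      by (simp add: complex_eq_iff)
  qed
  then have "(LINT t|lborel. exp (- \<i> * of_real (t * x)) * trapezoid_hat p q c t) =
      (LINT t|lborel. complex_of_real (cos (t * y) * k t)) + \<i> * (LINT t|lborel. complex_of_real (- sin (t * y) * k t))"
    using i1 i2 by (simp only:) (subst Bochner_Integration.integral_add, auto simp del: of_real_mult)
  also have "(LINT t|lborel. complex_of_real (- sin (t * y) * k t)) = 0"
    unfolding integral_complex_of_real
    by (subst integral_odd_real) (auto simp: k_def cos_kernel_def)
  also have "(LINT t|lborel. complex_of_real (cos (t * y) * k t)) = of_real (LINT t|lborel. cos (t * y) * k t)"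
    by (rule integral_complex_of_real)
  also have "(LINT t|lborel. cos (t * y) * k t) =
     (LINT t|lborel. (cos_kernel (y + p) t + cos_kernel (y - p) t - cos_kernel (y + q) t - cos_kernel (y - q) t) / 2)"
  proof (rule Bochner_Integration.integral_cong[OF refl])
    fix t :: real
    have c: "cos ((y + a) * t) + cos ((y - a) * t) = 2 * cos (t * y) * cos (a * t)" for a
      unfolding distrib_right left_diff_distrib cos_add cos_diff by (simp add: mult.commute)
    have *: "cos (t * y) * (cos (q * t) - cos (p * t)) =
      ((1 - cos ((y + p) * t)) + (1 - cos ((y - p) * t)) - (1 - cos ((y + q) * t)) - (1 - cos ((y - q) * t))) / 2"
      using c[of p] c[of q] by (simp add: algebra_simps)
    then show "cos (t * y) * k t =
      (cos_kernel (y + p) t + cos_kernel (y - p) t - cos_kernel (y + q) t - cos_kernel (y - q) t) / 2"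
      unfolding k_def cos_diff_kernel[symmetric] times_divide_eq_right *
      unfolding cos_kernel_def add_divide_distrib[symmetric] diff_divide_distrib[symmetric]
      by simp
  qed
  also have "\<dots> = kernel_const / 2 * trapezoid p q y"
    by (simp add: integrable_cos_kernel integral_cos_kernel trapezoid_def field_simps)
  finally show ?thesis by (simp add: y_def)
qed

section \<open>The multiplication formula for the transform in the mean\<close>

lemma integral_cis_bounded_product_swap:
  fixes f h :: "real \<Rightarrow> complex"
  assumes f: "integrable lborel f" and h: "integrable lborel h"
  shows "(LINT t|lborel. (LINT x|lborel. exp (- \<i> * of_real (t * x)) * f x) * h t) =
         (LINT x|lborel. f x * (LINT t|lborel. exp (- \<i> * of_real (t * x)) * h t))"
proof -
  have [measurable]: "f \<in> borel_measurable borel" "h \<in> borel_measurable borel"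
    using f h by (auto dest: borel_measurable_integrable)
  let ?F = "\<lambda>t x. exp (- \<i> * of_real (t * x)) * f x * h t"
  have norm: "norm (?F t x) = cmod (f x) * cmod (h t)" for t x
    by (simp add: norm_mult)
  have "integrable (lborel \<Otimes>\<^sub>M lborel) (case_prod ?F)"
  proof (rule lborel_pair.Fubini_integrable)
    show "case_prod ?F \<in> borel_measurable (lborel \<Otimes>\<^sub>M lborel)" by measurable
    show "integrable lborel (\<lambda>t. LINT x|lborel. norm (case_prod ?F (t, x)))"
      unfolding prod.case norm using h by simp
    show "AE t in lborel. integrable lborel (\<lambda>x. case_prod ?F (t, x))"
    proof (rule AE_I2)
      fix t
      have "integrable lborel (\<lambda>x. cmod (f x) * cmod (h t))" using f by simp
      then show "integrable lborel (\<lambda>x. case_prod ?F (t, x))"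
        by (rule Bochner_Integration.integrable_bound) (auto simp: norm_mult)
    qed
  qed
  from lborel_pair.Fubini_integral[OF this]
  have "(LINT x|lborel. LINT t|lborel. ?F t x) = (LINT t|lborel. LINT x|lborel. ?F t x)" .
  moreover have "(LINT t|lborel. ?F t x) = f x * (LINT t|lborel. exp (- \<i> * of_real (t * x)) * h t)" for x
    by (simp flip: integral_mult_right_zero) (simp add: ac_simps)
  ultimately show ?thesis by simp
qed

text \<open>For a truncation of \<open>f\<close> this is Fubini's theorem. As the truncation grows,
  the left side converges by Cauchy-Schwarz and the limit in mean, while the right side is constant
  as soon as [-N, N] contains the support of the transform of \<open>h\<close>.\<close>

lemma L2_fourier_multiplication_formula:
  assumes F: "has_L2_fourier_transform f F"
    and h: "integrable lborel h" "h \<in> L2"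
    and supp: "\<And>x. r < \<bar>x\<bar> \<Longrightarrow> (LINT t|lborel. exp (- \<i> * of_real (t * x)) * h t) = 0"
  shows "(LINT t|lborel. F t * h t) = complex_of_real (1 / sqrt (2 * pi)) *
    (LINT x|lborel. f x * (LINT t|lborel. exp (- \<i> * of_real (t * x)) * h t))"
proof -
  define g where "g x = (LINT t|lborel. exp (- \<i> * of_real (t * x)) * h t)" for x
  define fN where "fN N x = indicator {- real N..real N} x * f x" for N :: nat and x
  define D where "D N t = F t - fourier_integral (fN N) t" for N t
  have f: "f \<in> L2" "F \<in> L2"
    and lim: "(\<lambda>N. \<integral>\<^sup>+ t. ennreal ((cmod (D N t))\<^sup>2) \<partial>lborel) \<longlonglongrightarrow> 0"
    using F unfolding has_L2_fourier_transform_def D_def fN_def[abs_def] by auto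
  have [measurable]: "f \<in> borel_measurable borel" "F \<in> borel_measurable borel" "h \<in> borel_measurable borel"
    using f h by (auto intro: L2_measurable)
  have [measurable]: "fN N \<in> borel_measurable borel" for N
    unfolding fN_def[abs_def] by measurable
  have fN: "integrable lborel (fN N)" for N
    unfolding fN_def[abs_def] using emeasure_bounded_finite[of "{- real N..real N}"]
    by (intro L2_mult_integrable f L2_indicator) auto
  have [measurable]: "D N \<in> borel_measurable borel" for N
    unfolding D_def[abs_def] fourier_integral_def[abs_def] by measurable
  have swap: "(LINT t|lborel. fourier_integral (fN N) t * h t) =
      complex_of_real (1 / sqrt (2 * pi)) * (LINT x|lborel. fN N x * g x)" for N
    unfolding fourier_integral_def g_def mult.assoc integral_mult_right_zero
    by (simp only: integral_cis_bounded_product_swap[OF fN h(1)])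
  have ev: "eventually (\<lambda>N. (LINT x|lborel. fN N x * g x) = (LINT x|lborel. f x * g x)) sequentially"
  proof -
    obtain N0 where N0: "r < real N0" using reals_Archimedean2 by blast
    show ?thesis
      using eventually_ge_at_top[of N0]
    proof eventually_elim
      case (elim N)
      then have "r < real N" using N0 by linarith
      then have "fN N x * g x = f x * g x" for x
        using supp[of x] unfolding g_def[symmetric]
        by (cases "x \<in> {- real N..real N}") (auto simp: fN_def abs_le_iff)
      then show ?case by (intro Bochner_Integration.integral_cong refl)
    qed
  qed
  \<comment> \<open>Convergence to 0 among extended reals makes the integrals finite only
    eventually, so \<open>D N\<close> lies in \<open>L2\<close> only for large
    \<open>N\<close>.\<close>
  have "eventually (\<lambda>N. (\<integral>\<^sup>+ t. ennreal ((cmod (D N t))\<^sup>2) \<partial>lborel) < 1) sequentially"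
    using order_tendstoD(2)[OF lim, of 1] by simp
  then have DL2: "eventually (\<lambda>N. D N \<in> L2) sequentially"
  proof eventually_elim
    case (elim N)
    then have "(\<integral>\<^sup>+ t. ennreal (norm ((cmod (D N t))\<^sup>2)) \<partial>lborel) < \<infinity>"
      using order_less_trans by fastforce
    then have "integrable lborel (\<lambda>t. (cmod (D N t))\<^sup>2)"
      by (intro integrableI_bounded) auto
    then show ?case by (intro L2_I[of "D N"]) auto
  qed
  have "(\<lambda>N. enn2real (\<integral>\<^sup>+ t. ennreal ((cmod (D N t))\<^sup>2) \<partial>lborel)) \<longlonglongrightarrow> 0"
    using tendsto_enn2real[of _ 0] lim by simp
  from tendsto_real_sqrt[OF this]
  have Dnorm: "(\<lambda>N. L2_norm (D N)) \<longlonglongrightarrow> 0"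
    unfolding L2_norm_def by (subst integral_eq_nn_integral) auto
  have "(\<lambda>N. (LINT t|lborel. F t * h t) - (LINT t|lborel. fourier_integral (fN N) t * h t)) \<longlonglongrightarrow> 0"
  proof (rule Lim_null_comparison)
    show "(\<lambda>N. L2_norm (D N) * L2_norm (\<lambda>t. cnj (h t))) \<longlonglongrightarrow> 0"
      using tendsto_mult_left_zero[OF Dnorm] .
    show "eventually (\<lambda>N. norm ((LINT t|lborel. F t * h t) - (LINT t|lborel. fourier_integral (fN N) t * h t))
        \<le> L2_norm (D N) * L2_norm (\<lambda>t. cnj (h t))) sequentially"
      using DL2
    proof eventually_elim
      case (elim N)
      have "(LINT t|lborel. fourier_integral (fN N) t * h t) = (LINT t|lborel. F t * h t - D N t * h t)"
        by (intro Bochner_Integration.integral_cong) (auto simp: D_def algebra_simps)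
      also have "\<dots> = (LINT t|lborel. F t * h t) - (LINT t|lborel. D N t * h t)"
        by (intro Bochner_Integration.integral_diff L2_mult_integrable f h elim)
      finally have "(LINT t|lborel. F t * h t) - (LINT t|lborel. fourier_integral (fN N) t * h t) =
          L2_inner (D N) (\<lambda>t. cnj (h t))"
        by (simp add: L2_inner_def)
      then show ?case
        using L2_Cauchy_Schwarz[OF elim L2_cnj[OF h(2)]] by simp
    qed
  qed
  then have "(\<lambda>N. (LINT t|lborel. F t * h t) - complex_of_real (1 / sqrt (2 * pi)) * (LINT x|lborel. fN N x * g x)) \<longlonglongrightarrow> 0"
    by (simp only: swap)
  then have "(\<lambda>N::nat. (LINT t|lborel. F t * h t) - complex_of_real (1 / sqrt (2 * pi)) * (LINT x|lborel. f x * g x)) \<longlonglongrightarrow> 0"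
    by (rule Lim_transform_eventually) (use ev in \<open>eventually_elim, simp\<close>)
  then show ?thesis
    by (simp add: LIMSEQ_const_iff g_def)
qed

section \<open>The scaling function\<close>

lemma filter_coeff_unit:
  "(filter_coeff \<theta> 0)\<^sup>2 + (filter_coeff \<theta> 1)\<^sup>2 + (filter_coeff \<theta> 2)\<^sup>2 + (filter_coeff \<theta> 3)\<^sup>2 = 1"
proof -
  let ?c = "cos \<theta>" and ?s = "sin \<theta>"
  have "(1 - ?c + ?s)\<^sup>2 + (1 - ?c - ?s)\<^sup>2 + (1 + ?c - ?s)\<^sup>2 + (1 + ?c + ?s)\<^sup>2 = 4 + 4 * (?s\<^sup>2 + ?c\<^sup>2)"
    by algebra
  also have "\<dots> = 8" by simp
  finally show ?thesis
    by (simp add: filter_coeff_def power_mult_distrib power_divide add_divide_distrib[symmetric])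
qed

lemma filter_coeff_orth:
  "filter_coeff \<theta> 0 * filter_coeff \<theta> 2 + filter_coeff \<theta> 1 * filter_coeff \<theta> 3 = 0"
proof -
  let ?c = "cos \<theta>" and ?s = "sin \<theta>"
  have "(1 - ?c + ?s) * (1 + ?c - ?s) + (1 - ?c - ?s) * (1 + ?c + ?s) = 2 - 2 * (?s\<^sup>2 + ?c\<^sup>2)"
    by (simp add: power2_eq_square algebra_simps)
  also have "\<dots> = 0" by simp
  finally show ?thesis
    by (simp add: filter_coeff_def add_divide_distrib[symmetric])
qed

text \<open>The low-pass normalisation: \<open>m0\<close> divided by sqrt 2 is 1 at z = 1, so the
  factors of the infinite product tend to 1.\<close>

lemma filter_coeff_sum: "(\<Sum>k=0..3. filter_coeff \<theta> k / sqrt 2) = 1"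
  by (simp add: filter_coeff_def numeral_eq_Suc field_simps)

text \<open>Split \<open>m0\<close> into its even and odd parts, A + z B, with A and B functions of
  w = z^2. In 2 |A|^2 + 2 |B|^2 the terms with Re w cancel by \<open>filter_coeff_orth\<close>, and
  \<open>filter_coeff_unit\<close> leaves 2.\<close>

lemma norm_m0_le:
  assumes "cmod z = 1"
  shows "cmod (complex_of_real (1 / sqrt 2) * m0 \<theta> z) \<le> 1"
proof -
  let ?a = "filter_coeff \<theta>"
  define w where "w = z\<^sup>2"
  have w: "(Re w)\<^sup>2 + (Im w)\<^sup>2 = 1"
    using assms unfolding cmod_power2[symmetric] by (simp add: w_def norm_power)
  let ?A = "of_real (?a 0) + of_real (?a 2) * w" and ?B = "of_real (?a 1) + of_real (?a 3) * w"
  have sq: "(cmod (of_real r + of_real s * w))\<^sup>2 = r\<^sup>2 + s\<^sup>2 + 2 * (r * s) * Re w" for r s :: real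
  proof -
    have "(cmod (of_real r + of_real s * w))\<^sup>2 = r\<^sup>2 + 2 * (r * s) * Re w + s\<^sup>2 * ((Re w)\<^sup>2 + (Im w)\<^sup>2)"
      unfolding cmod_power2 by (simp add: power2_eq_square algebra_simps)
    then show ?thesis using w by simp
  qed
  have "m0 \<theta> z = ?A + z * ?B"
    by (simp add: m0_def w_def numeral_eq_Suc algebra_simps)
  then have "(cmod (m0 \<theta> z))\<^sup>2 \<le> 2 * (cmod ?A)\<^sup>2 + 2 * (cmod (z * ?B))\<^sup>2"
    using cmod_add_sq_le by metis
  also have "\<dots> = 2 * ((?a 0)\<^sup>2 + (?a 1)\<^sup>2 + (?a 2)\<^sup>2 + (?a 3)\<^sup>2) +
      4 * (?a 0 * ?a 2 + ?a 1 * ?a 3) * Re w"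
    unfolding norm_mult assms mult_1_left sq by (simp add: algebra_simps)
  also have "\<dots> = 2"
    unfolding filter_coeff_unit filter_coeff_orth by simp
  finally have "cmod (m0 \<theta> z) \<le> sqrt 2"
    by (simp add: real_le_rsqrt)
  then show ?thesis
    by (simp add: norm_mult norm_divide divide_le_eq)
qed

lemma norm_exp_minus_i_minus_1_le: "cmod (exp (- \<i> * of_real s) - 1) \<le> \<bar>s\<bar>"
proof (rule power2_le_imp_le)
  have "exp (- \<i> * of_real s) = cis (- s)"
    by (simp add: cis_conv_exp)
  then have "(cmod (exp (- \<i> * of_real s) - 1))\<^sup>2 = (cos s - 1)\<^sup>2 + (sin s)\<^sup>2"
    by (simp add: cmod_power2)
  also have "\<dots> = 2 * (1 - cos s) + ((sin s)\<^sup>2 + (cos s)\<^sup>2 - 1)"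
    by (simp only: power2_eq_square) (simp add: algebra_simps)
  also have "\<dots> \<le> \<bar>s\<bar>\<^sup>2"
    using one_minus_cos_le[of s] by simp
  finally show "(cmod (exp (- \<i> * of_real s) - 1))\<^sup>2 \<le> \<bar>s\<bar>\<^sup>2" .
qed simp

definition product_factor :: "real \<Rightarrow> nat \<Rightarrow> real \<Rightarrow> complex" where
  "product_factor \<theta> k t = complex_of_real (1 / sqrt 2) * m0 \<theta> (exp (- \<i> * of_real (t / 2 ^ Suc k)))"

lemma product_factor_measurable [measurable]: "product_factor \<theta> k \<in> borel_measurable borel"
  unfolding product_factor_def[abs_def] m0_def by measurable

lemma norm_product_factor: "cmod (product_factor \<theta> k t) \<le> 1"
  unfolding product_factor_def by (rule norm_m0_le) simp

text \<open>As the weights sum to 1, the difference is a combination of terms exp (- i s) - 1, each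
  bounded by |s|. The geometric decay in \<open>k\<close> gives absolute convergence of the
  product.\<close>

lemma product_factor_minus_1:
  "cmod (product_factor \<theta> k t - 1) \<le> (\<Sum>l=0..3. \<bar>filter_coeff \<theta> l / sqrt 2\<bar> * real l) * \<bar>t\<bar> * (1/2) ^ Suc k"
proof -
  let ?s = "t / 2 ^ Suc k"
  have one: "(\<Sum>l=0..3. complex_of_real (filter_coeff \<theta> l / sqrt 2)) = 1"
    unfolding of_real_sum[symmetric] filter_coeff_sum by simp
  have "product_factor \<theta> k t = (\<Sum>l=0..3. of_real (filter_coeff \<theta> l / sqrt 2) * exp (- \<i> * of_real (real l * ?s)))"
    unfolding product_factor_def m0_def sum_distrib_left
    by (intro sum.cong refl) (simp add: exp_of_nat_mult[symmetric] ac_simps)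
  then have eq: "product_factor \<theta> k t - 1 =
      (\<Sum>l=0..3. of_real (filter_coeff \<theta> l / sqrt 2) * (exp (- \<i> * of_real (real l * ?s)) - 1))"
    by (simp only: one sum_subtractf right_diff_distrib mult_1_right)
  have "cmod (product_factor \<theta> k t - 1) \<le>
      (\<Sum>l=0..3. cmod (of_real (filter_coeff \<theta> l / sqrt 2) * (exp (- \<i> * of_real (real l * ?s)) - 1)))"
    unfolding eq by (rule norm_sum)
  also have "\<dots> \<le> (\<Sum>l=0..3. \<bar>filter_coeff \<theta> l / sqrt 2\<bar> * \<bar>real l * ?s\<bar>)"
    unfolding norm_mult norm_of_real
    by (intro sum_mono mult_left_mono norm_exp_minus_i_minus_1_le) simp
  also have "\<dots> = (\<Sum>l=0..3. \<bar>filter_coeff \<theta> l / sqrt 2\<bar> * real l) * \<bar>t\<bar> * (1/2) ^ Suc k"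
    unfolding sum_distrib_right
    by (intro sum.cong refl) (simp add: abs_mult power_one_over)
  finally show ?thesis .
qed

lemma product_factor_prod_tendsto:
  "(\<lambda>n. \<Prod>k<n. product_factor \<theta> k t) \<longlonglongrightarrow> (\<Prod>k. product_factor \<theta> k t)"
proof -
  have "summable (\<lambda>k. cmod (product_factor \<theta> k t - 1))"
  proof (rule summable_comparison_test'[OF _ order.trans[OF _ product_factor_minus_1]])
    show "summable (\<lambda>k. (\<Sum>l=0..3. \<bar>filter_coeff \<theta> l / sqrt 2\<bar> * real l) * \<bar>t\<bar> * (1/2) ^ Suc k)"
      by (intro summable_mult) (simp add: summable_mult)
  qed simp
  then have "convergent_prod (\<lambda>k. product_factor \<theta> k t)"
    by (intro abs_convergent_prod_imp_convergent_prod summable_imp_abs_convergent_prod)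
  then show ?thesis
    by (intro has_prod_imp_tendsto' convergent_prod_has_prod)
qed

lemma father_hat_eq: "father_hat \<theta> t = complex_of_real (1 / sqrt (2 * pi)) * (\<Prod>k. product_factor \<theta> k t)"
  by (simp add: father_hat_def product_factor_def)

text \<open>Integration against the \<open>n\<close>-th approximation of the scaling function, a signed measure
  with finite support whose Fourier transform is the \<open>n\<close>-th partial product.\<close>

primrec cascade :: "real \<Rightarrow> nat \<Rightarrow> (real \<Rightarrow> complex) \<Rightarrow> complex" where
  "cascade \<theta> 0 g = g 0"
| "cascade \<theta> (Suc n) g =
    (\<Sum>k=0..3. of_real (filter_coeff \<theta> k / sqrt 2) * cascade \<theta> n (\<lambda>x. g ((x + real k) / 2)))"

lemma cascade_scale: "cascade \<theta> n (\<lambda>x. c * g x) = c * cascade \<theta> n g"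
  by (induction n arbitrary: g) (simp_all add: sum_distrib_left mult.left_commute)

text \<open>The maps x -> (x + k) / 2 with k = 0, ..., 3 send [0, 3] into itself, and the recursion
  ends with evaluation at 0. This is where the support of the father function comes from.\<close>

lemma cascade_cong:
  assumes "\<And>x. 0 \<le> x \<Longrightarrow> x \<le> 3 \<Longrightarrow> g x = h x"
  shows "cascade \<theta> n g = cascade \<theta> n h"
  using assms
proof (induction n arbitrary: g h)
  case (Suc n)
  have "cascade \<theta> n (\<lambda>x. g ((x + real k) / 2)) = cascade \<theta> n (\<lambda>x. h ((x + real k) / 2))"
    if "k \<in> {0..3}" for k
    using that by (intro Suc.IH Suc.prems) auto
  then show ?case by simp
qed simp

lemma cascade_const: "cascade \<theta> n (\<lambda>x. c) = c"
proof (induction n)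
  case (Suc n)
  have "(\<Sum>k=0..3. complex_of_real (filter_coeff \<theta> k / sqrt 2)) = 1"
    unfolding of_real_sum[symmetric] filter_coeff_sum by simp
  then show ?case
    using Suc by (simp only: cascade.simps sum_distrib_right[symmetric] mult_1_left)
qed simp

text \<open>The frequency is generalised in the induction because one recursion step halves it; the
  shifts by \<open>k\<close> contribute the powers of exp (- i t / 2) that make up the
  filter.\<close>

lemma cascade_exp:
  "cascade \<theta> n (\<lambda>x. exp (- \<i> * of_real (t * x))) = (\<Prod>k<n. product_factor \<theta> k t)"
proof (induction n arbitrary: t)
  case (Suc n)
  have shift: "product_factor \<theta> (Suc k) t = product_factor \<theta> k (t / 2)" for k
    by (simp add: product_factor_def)
  have "cascade \<theta> n (\<lambda>x. exp (- \<i> * of_real (t * ((x + real k) / 2)))) =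
      exp (- \<i> * of_real (t / 2)) ^ k * (\<Prod>k<n. product_factor \<theta> k (t / 2))" for k
  proof -
    have "(\<lambda>x. exp (- \<i> * of_real (t * ((x + real k) / 2)))) =
        (\<lambda>x. exp (- \<i> * of_real (t / 2)) ^ k * exp (- \<i> * of_real (t / 2 * x)))"
      by (rule ext) (simp add: exp_of_nat_mult[symmetric] exp_add[symmetric] algebra_simps add_divide_distrib)
    then show ?thesis
      by (simp only: cascade_scale Suc.IH)
  qed
  then have "cascade \<theta> (Suc n) (\<lambda>x. exp (- \<i> * of_real (t * x))) =
     (\<Sum>k=0..3. of_real (filter_coeff \<theta> k / sqrt 2) * exp (- \<i> * of_real (t / 2)) ^ k) *
     (\<Prod>k<n. product_factor \<theta> k (t / 2))"
    by (simp only: cascade.simps sum_distrib_right mult.assoc)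
  also have "(\<Sum>k=0..3. of_real (filter_coeff \<theta> k / sqrt 2) * exp (- \<i> * of_real (t / 2)) ^ k) = product_factor \<theta> 0 t"
    unfolding product_factor_def m0_def sum_distrib_left
    by (intro sum.cong refl) simp
  finally show ?case
    unfolding prod.lessThan_Suc_shift shift .
qed simp

lemma cascade_integral:
  fixes g :: "real \<Rightarrow> real \<Rightarrow> complex"
  assumes "\<And>x. integrable lborel (\<lambda>t. g t x)"
  shows "integrable lborel (\<lambda>t. cascade \<theta> n (g t))"
    and "cascade \<theta> n (\<lambda>x. LINT t|lborel. g t x) = (LINT t|lborel. cascade \<theta> n (g t))"
proof -
  have "integrable lborel (\<lambda>t. cascade \<theta> n (g t)) \<and>
      cascade \<theta> n (\<lambda>x. LINT t|lborel. g t x) = (LINT t|lborel. cascade \<theta> n (g t))"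
    using assms
  proof (induction n arbitrary: g)
    case (Suc n)
    have IH: "integrable lborel (\<lambda>t. cascade \<theta> n (\<lambda>x. g t ((x + real k) / 2)))"
      "cascade \<theta> n (\<lambda>x. LINT t|lborel. g t ((x + real k) / 2)) =
       (LINT t|lborel. cascade \<theta> n (\<lambda>x. g t ((x + real k) / 2)))" for k
      using Suc.IH[of "\<lambda>t x. g t ((x + real k) / 2)"] Suc.prems by auto
    show ?case
      unfolding cascade.simps
    proof
      show "integrable lborel (\<lambda>t. \<Sum>k=0..3. of_real (filter_coeff \<theta> k / sqrt 2) *
          cascade \<theta> n (\<lambda>x. g t ((x + real k) / 2)))"
        by (intro Bochner_Integration.integrable_sum integrable_mult_right IH(1))
      show "(\<Sum>k=0..3. of_real (filter_coeff \<theta> k / sqrt 2) *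
          cascade \<theta> n (\<lambda>x. LINT t|lborel. g t ((x + real k) / 2))) =
        (LINT t|lborel. (\<Sum>k=0..3. of_real (filter_coeff \<theta> k / sqrt 2) *
          cascade \<theta> n (\<lambda>x. g t ((x + real k) / 2))))"
        by (subst Bochner_Integration.integral_sum)
           (intro integrable_mult_right IH(1), simp only: IH(2) integral_mult_right_zero)
    qed
  qed simp
  then show "integrable lborel (\<lambda>t. cascade \<theta> n (g t))"
    "cascade \<theta> n (\<lambda>x. LINT t|lborel. g t x) = (LINT t|lborel. cascade \<theta> n (g t))" by auto
qed

text \<open>Weak convergence of the discrete approximations, seen on the Fourier side. A trapezoid
  is, up to a nonzero constant, the transform of the integrable function \<open>H\<close>; against
  \<open>H\<close> the partial products converge dominatedly, and
  \<open>L2_fourier_multiplication_formula\<close> identifies the limit.\<close>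

lemma cascade_tendsto_father:
  assumes father: "is_father_function \<theta> \<phi>" and q: "0 \<le> q" "q \<le> p"
  shows "(\<lambda>n. cascade \<theta> n (\<lambda>x. of_real (trapezoid p q (x - c)))) \<longlonglongrightarrow>
    (LINT x|lborel. \<phi> x * of_real (trapezoid p q (x - c)))"
proof -
  define H where "H = trapezoid_hat p q c"
  define P where "P n t = (\<Prod>k<n. product_factor \<theta> k t)" for n t
  define P' where "P' t = (\<Prod>k. product_factor \<theta> k t)" for t
  define \<kappa> where "\<kappa> = complex_of_real (kernel_const / 2)"
  have \<kappa>: "\<kappa> \<noteq> 0" using kernel_const_pos by (simp add: \<kappa>_def)
  have [measurable]: "H \<in> borel_measurable borel" "P n \<in> borel_measurable borel" for n
    unfolding H_def P_def[abs_def] by measurable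
  have P_lim: "(\<lambda>n. P n t) \<longlonglongrightarrow> P' t" for t
    unfolding P_def P'_def by (rule product_factor_prod_tendsto)
  have [measurable]: "P' \<in> borel_measurable borel"
    by (rule borel_measurable_LIMSEQ_metric[OF _ P_lim]) simp
  have P_le: "cmod (P n t) \<le> 1" for n t
    unfolding P_def prod_norm[symmetric]
    by (intro prod_le_1) (auto simp: norm_product_factor)
  have G: "(LINT t|lborel. exp (- \<i> * of_real (t * x)) * H t) = \<kappa> * of_real (trapezoid p q (x - c))" for x
    unfolding H_def fourier_trapezoid_hat \<kappa>_def by simp
  have "(\<lambda>n. LINT t|lborel. P n t * H t) \<longlonglongrightarrow> (LINT t|lborel. P' t * H t)"
  proof (rule integral_dominated_convergence[where w = "\<lambda>t. cmod (H t)"])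
    show "integrable lborel (\<lambda>t. cmod (H t))"
      unfolding H_def using integrable_trapezoid_hat by simp
    show "AE t in lborel. (\<lambda>n. P n t * H t) \<longlonglongrightarrow> P' t * H t"
      by (intro AE_I2 tendsto_intros P_lim)
    show "AE t in lborel. norm (P n t * H t) \<le> cmod (H t)" for n
      using P_le by (intro AE_I2) (simp add: norm_mult mult_left_le_one_le)
  qed auto
  moreover have "(LINT t|lborel. P n t * H t) = \<kappa> * cascade \<theta> n (\<lambda>x. of_real (trapezoid p q (x - c)))" for n
  proof -
    have int: "integrable lborel (\<lambda>t. exp (- \<i> * of_real (t * x)) * H t)" for x
      unfolding H_def
      by (rule Bochner_Integration.integrable_bound[OF integrable_trapezoid_hat[of p q c]]) (auto simp: norm_mult)
    have "\<kappa> * cascade \<theta> n (\<lambda>x. of_real (trapezoid p q (x - c))) =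
        cascade \<theta> n (\<lambda>x. LINT t|lborel. exp (- \<i> * of_real (t * x)) * H t)"
      unfolding G by (rule cascade_scale[symmetric])
    also have "\<dots> = (LINT t|lborel. cascade \<theta> n (\<lambda>x. exp (- \<i> * of_real (t * x)) * H t))"
      by (rule cascade_integral(2)[OF int])
    also have "\<dots> = (LINT t|lborel. P n t * H t)"
      unfolding mult.commute[of _ "H _"] cascade_scale cascade_exp P_def ..
    finally show ?thesis by simp
  qed
  moreover have "(LINT t|lborel. P' t * H t) = \<kappa> * (LINT x|lborel. \<phi> x * of_real (trapezoid p q (x - c)))"
  proof -
    let ?d = "complex_of_real (1 / sqrt (2 * pi))"
    have "?d * (LINT t|lborel. P' t * H t) = (LINT t|lborel. father_hat \<theta> t * H t)"
      unfolding father_hat_eq P'_def mult.assoc by (rule integral_mult_right_zero[symmetric])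
    also have "\<dots> = ?d * (LINT x|lborel. \<phi> x * (LINT t|lborel. exp (- \<i> * of_real (t * x)) * H t))"
    proof (rule L2_fourier_multiplication_formula)
      show "has_L2_fourier_transform \<phi> (father_hat \<theta>)"
        using father by (simp add: is_father_function_def)
      fix x :: real assume "\<bar>c\<bar> + p < \<bar>x\<bar>"
      then have "p \<le> \<bar>x - c\<bar>" by linarith
      then show "(LINT t|lborel. exp (- \<i> * of_real (t * x)) * H t) = 0"
        unfolding G using trapezoid_eq_0[OF q] by simp
    qed (simp_all add: H_def integrable_trapezoid_hat L2_trapezoid_hat)
    also have "\<dots> = ?d * (\<kappa> * (LINT x|lborel. \<phi> x * of_real (trapezoid p q (x - c))))"
      unfolding G mult.left_commute[of _ \<kappa>] integral_mult_right_zero ..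
    finally show ?thesis by simp
  qed
  ultimately have "(\<lambda>n. \<kappa> * cascade \<theta> n (\<lambda>x. of_real (trapezoid p q (x - c)))) \<longlonglongrightarrow>
      \<kappa> * (LINT x|lborel. \<phi> x * of_real (trapezoid p q (x - c)))"
    by simp
  from tendsto_mult[OF tendsto_const[of "inverse \<kappa>"] this] show ?thesis
    using \<kappa> by (simp flip: mult.assoc)
qed

text \<open>Trapezoids vanishing outside [c - p, c + p], scaled to height 1, converge to the
  indicator of the open interval as the plateau fills it.\<close>

lemma interval_integral_zero_if_trapezoid:
  assumes f: "f \<in> L2" and p: "0 < p"
    and zero: "\<And>q. 0 \<le> q \<Longrightarrow> q < p \<Longrightarrow> (LINT x|lborel. f x * of_real (trapezoid p q (x - c))) = 0"
  shows "(LINT x|lborel. indicator {c - p<..<c + p} x * f x) = 0"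
proof -
  have [measurable]: "f \<in> borel_measurable borel" using f by (rule L2_measurable)
  \<comment> \<open>Tends to \<open>p\<close> from strictly below, so that the height
    \<open>2 * (p - q m)\<close> can be divided out.\<close>
  define q where "q m = p * (1 - 1 / real (m + 1))" for m :: nat
  have q: "0 \<le> q m" "q m < p" for m
    using p by (auto simp: q_def field_simps)
  have q_lim: "q \<longlonglongrightarrow> p"
  proof -
    have "(\<lambda>m. p * (1 - 1 / real (m + 1))) \<longlonglongrightarrow> p * (1 - 0)"
      using LIMSEQ_inverse_real_of_nat by (intro tendsto_intros) (simp add: inverse_eq_divide)
    then show ?thesis unfolding q_def[abs_def] by simp
  qed
  define g where "g m x = trapezoid p (q m) (x - c) / (2 * (p - q m))" for m x
  have [measurable]: "g m \<in> borel_measurable borel" for m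
    unfolding g_def[abs_def] by measurable
  have g_bounds: "0 \<le> g m x" "g m x \<le> indicator {c - p..c + p} x" for m x
  proof -
    have b: "0 \<le> trapezoid p (q m) (x - c)" "trapezoid p (q m) (x - c) \<le> 2 * (p - q m)"
      using trapezoid_bounds[of "q m" p "x - c"] q[of m] by auto
    then show "0 \<le> g m x" using q[of m] by (simp add: g_def)
    show "g m x \<le> indicator {c - p..c + p} x"
    proof (cases "x \<in> {c - p..c + p}")
      case True
      then show ?thesis using b q[of m] by (simp add: g_def)
    next
      case False
      then have "p \<le> \<bar>x - c\<bar>" by auto
      then show ?thesis using False trapezoid_eq_0[of "q m" p "x - c"] q[of m] by (simp add: g_def)
    qed
  qed
  have "(\<lambda>m. LINT x|lborel. f x * of_real (g m x)) \<longlonglongrightarrow> (LINT x|lborel. indicator {c - p<..<c + p} x * f x)"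
  proof (rule integral_dominated_convergence[where w = "\<lambda>x. cmod (indicator {c - p..c + p} x * f x)"])
    show "integrable lborel (\<lambda>x. cmod (indicator {c - p..c + p} x * f x))"
      using emeasure_bounded_finite[of "{c - p..c + p}"]
      by (intro integrable_norm L2_mult_integrable f L2_indicator) auto
    show "AE x in lborel. norm (f x * of_real (g m x)) \<le> cmod (indicator {c - p..c + p} x * f x)" for m
    proof (rule AE_I2)
      fix x
      have "cmod (f x) * g m x \<le> cmod (f x) * indicator {c - p..c + p} x"
        using g_bounds by (intro mult_left_mono) auto
      then show "norm (f x * of_real (g m x)) \<le> cmod (indicator {c - p..c + p} x * f x)"
        using g_bounds(1)[of m x] by (auto simp: norm_mult indicator_def)
    qed
    show "AE x in lborel. (\<lambda>m. f x * of_real (g m x)) \<longlonglongrightarrow> indicator {c - p<..<c + p} x * f x"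
    proof (rule AE_I2)
      fix x
      have "eventually (\<lambda>m. indicator {c - p<..<c + p} x * f x = f x * of_real (g m x)) sequentially"
      proof (cases "\<bar>x - c\<bar> < p")
        case True
        have "eventually (\<lambda>m. \<bar>x - c\<bar> < q m) sequentially"
          using order_tendstoD(1)[OF q_lim True] .
        then show ?thesis
        proof eventually_elim
          case (elim m)
          then have "g m x = 1"
            using trapezoid_eq[of "q m" p "x - c"] q[of m] by (simp add: g_def)
          moreover have "x \<in> {c - p<..<c + p}" using True by auto
          ultimately show ?case by simp
        qed
      next
        case False
        then have "x \<notin> {c - p<..<c + p}" by auto
        moreover have "g m x = 0" for m
          using False trapezoid_eq_0[of "q m" p "x - c"] q[of m] by (simp add: g_def)
        ultimately show ?thesis by simp
      qed
      then show "(\<lambda>m. f x * of_real (g m x)) \<longlonglongrightarrow> indicator {c - p<..<c + p} x * f x"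
        by (rule Lim_transform_eventually[OF tendsto_const])
    qed
  qed auto
  moreover have "(LINT x|lborel. f x * of_real (g m x)) = 0" for m
  proof -
    have "(LINT x|lborel. f x * of_real (g m x)) =
        (LINT x|lborel. f x * of_real (trapezoid p (q m) (x - c))) / of_real (2 * (p - q m))"
      unfolding g_def of_real_divide times_divide_eq_right by (rule integral_divide_zero)
    then show ?thesis using zero[OF q] by simp
  qed
  ultimately show ?thesis
    by (simp add: LIMSEQ_const_iff)
qed

lemma L2_AE_zero_if_trapezoid:
  assumes f: "f \<in> L2"
    and zero: "\<And>p q c. 0 \<le> q \<Longrightarrow> q < p \<Longrightarrow> (LINT x|lborel. f x * of_real (trapezoid p q (x - c))) = 0"
  shows "AE x in lborel. f x = 0"
proof (rule L2_AE_zero_if_interval_integrals_zero[OF f])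
  fix a b :: real assume "a < b"
  moreover define c p where "c = (a + b) / 2" and "p = (b - a) / 2"
  ultimately have cp: "c - p = a" "c + p = b" "0 < p"
    by (auto simp: field_simps)
  have "(LINT x|lborel. indicator {c - p<..<c + p} x * f x) = 0"
    by (rule interval_integral_zero_if_trapezoid[OF f cp(3)]) (rule zero)
  then show "(LINT x|lborel. indicator {a<..<b} x * f x) = 0"
    by (simp only: cp(1,2))
qed

section \<open>Support, integral and refinement equation of the father function\<close>

context
  fixes \<theta> :: real and \<phi> :: "real \<Rightarrow> complex"
  assumes father: "is_father_function \<theta> \<phi>"
begin

lemma father_L2: "\<phi> \<in> L2"
  using father by (simp add: is_father_function_def has_L2_fourier_transform_def)

lemma father_measurable [measurable]: "\<phi> \<in> borel_measurable borel"
  using father_L2 by (rule L2_measurable)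

text \<open>The trapezoids over such an interval vanish on [0, 3], the only place where
  \<open>cascade\<close> evaluates them.\<close>

lemma father_interval_outside:
  assumes "b \<le> 0 \<or> 3 \<le> a" "a < b"
  shows "(LINT x|lborel. indicator {a<..<b} x * \<phi> x) = 0"
proof -
  define c p where "c = (a + b) / 2" and "p = (b - a) / 2"
  have cp: "c - p = a" "c + p = b" "0 < p"
    using assms by (auto simp: c_def p_def field_simps)
  have "(LINT x|lborel. indicator {c - p<..<c + p} x * \<phi> x) = 0"
  proof (rule interval_integral_zero_if_trapezoid[OF father_L2 cp(3)])
    fix q assume q: "0 \<le> q" "q < p"
    have "cascade \<theta> n (\<lambda>x. of_real (trapezoid p q (x - c))) = cascade \<theta> n (\<lambda>x. 0)" for n
    proof (rule cascade_cong)
      fix x :: real assume "0 \<le> x" "x \<le> 3"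
      then have "p \<le> \<bar>x - c\<bar>" using assms(1) cp by linarith
      then show "complex_of_real (trapezoid p q (x - c)) = 0"
        using trapezoid_eq_0[of q p] q by simp
    qed
    then show "(LINT x|lborel. \<phi> x * of_real (trapezoid p q (x - c))) = 0"
      using cascade_tendsto_father[OF father, of q p c] q by (simp add: cascade_const LIMSEQ_const_iff)
  qed
  then show ?thesis by (simp add: cp)
qed

lemma father_support: "AE x in lborel. x \<notin> {0..3} \<longrightarrow> \<phi> x = 0"
proof -
  let ?f = "\<lambda>x. indicator (- {0..3}) x * \<phi> x"
  have "AE x in lborel. ?f x = 0"
  proof (rule L2_AE_zero_if_interval_integrals_zero)
    show "?f \<in> L2" by (intro L2_indicator_times father_L2) auto
    fix a b :: real assume "a < b"
    have z: "(LINT x|lborel. indicator {a'<..<b'} x * \<phi> x) = 0" if "b' \<le> 0 \<or> 3 \<le> a'" for a' b'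
      using father_interval_outside[OF that] by (cases "a' < b'") auto
    have int: "integrable lborel (\<lambda>x. indicator {a'<..<b'} x * \<phi> x)" for a' b' :: real
      by (intro L2_mult_integrable L2_indicator_interval father_L2)
    have "(LINT x|lborel. indicator {a<..<b} x * ?f x) =
       (LINT x|lborel. indicator {a<..<min b 0} x * \<phi> x + indicator {max a 3<..<b} x * \<phi> x)"
    proof (rule Bochner_Integration.integral_cong[OF refl])
      show "indicator {a<..<b} x * ?f x =
          indicator {a<..<min b 0} x * \<phi> x + indicator {max a 3<..<b} x * \<phi> x" for x
        by (auto simp: indicator_def)
    qed
    also have "\<dots> = 0"
      using z[of "min b 0" a] z[of b "max a 3"] int by simp
    finally show "(LINT x|lborel. indicator {a<..<b} x * ?f x) = 0" .
  qed
  then show ?thesis by eventually_elim (auto simp: indicator_def split: if_splits)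
qed

lemma father_integral: "(LINT x|lborel. \<phi> x) = 1"
proof -
  \<comment> \<open>The plateau is [-1/2, 7/2], which contains [0, 3]; its height is 2 (3 - 2) =
    2.\<close>
  let ?g = "\<lambda>x. complex_of_real (trapezoid 3 2 (x - 3 / 2))"
  have g: "?g x = 2" if "0 \<le> x" "x \<le> 3" for x
    using trapezoid_eq[of 2 3 "x - 3 / 2"] that by (simp add: abs_le_iff)
  have "cascade \<theta> n ?g = 2" for n
    using cascade_cong[of ?g "\<lambda>x. 2" \<theta> n] g by (simp add: cascade_const)
  then have "(LINT x|lborel. \<phi> x * ?g x) = 2"
    using cascade_tendsto_father[OF father, of 2 3 "3 / 2"] by (simp add: LIMSEQ_const_iff)
  moreover have "(LINT x|lborel. \<phi> x * ?g x) = (LINT x|lborel. 2 * \<phi> x)"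
  proof (rule integral_cong_AE)
    show "AE x in lborel. \<phi> x * ?g x = 2 * \<phi> x"
      using father_support by eventually_elim (use g in fastforce)
  qed measurable
  ultimately show ?thesis by simp
qed

text \<open>For the approximations the equation is the recursion defining \<open>cascade\<close>.
  Under x -> (x + k) / 2 a trapezoid becomes half a trapezoid with doubled parameters and centre
  \<open>2 * c - k\<close>, so both sides pass to the limit. Trapezoids separate the elements of
  \<open>L2\<close>.\<close>

lemma father_refinement:
  "AE x in lborel. of_real (1 / sqrt 2) * \<phi> (x / 2) = (\<Sum>k=0..3. of_real (filter_coeff \<theta> k) * \<phi> (x - real k))"
proof -
  let ?a = "filter_coeff \<theta>"
  define F where "F y = (\<Sum>k=0..3. of_real (?a k) * \<phi> (- real k + 2 * y))" for y
  have FL: "(\<lambda>y. \<phi> (- real k + 2 * y)) \<in> L2" for k :: nat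
    by (intro L2_affine father_L2) simp
  have F: "F \<in> L2"
    unfolding F_def by (intro L2_sum L2_scale FL)
  have "AE y in lborel. \<phi> y - of_real (sqrt 2) * F y = 0"
  proof (rule L2_AE_zero_if_trapezoid)
    show "(\<lambda>y. \<phi> y - of_real (sqrt 2) * F y) \<in> L2"
      by (intro L2_diff L2_scale father_L2 F)
    fix p q c :: real assume q: "0 \<le> q" "q < p"
    define g where "g x = complex_of_real (trapezoid p q (x - c))" for x
    have gL: "g \<in> L2"
    proof (rule L2_I)
      show "integrable lborel (\<lambda>x. (2 * (p - q))\<^sup>2 * indicator {c - p..c + p} x)"
        using emeasure_bounded_finite[of "{c - p..c + p}"]
        by (intro integrable_mult_right integrable_real_indicator) auto
      show "g \<in> borel_measurable borel" unfolding g_def[abs_def] by measurable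
      fix x
      show "(cmod (g x))\<^sup>2 \<le> (2 * (p - q))\<^sup>2 * indicator {c - p..c + p} x"
      proof (cases "x \<in> {c - p..c + p}")
        case True
        then show ?thesis
          using trapezoid_bounds[of q p "x - c"] q by (simp add: g_def abs_le_square_iff[symmetric])
      next
        case False
        then have "p \<le> \<bar>x - c\<bar>" by auto
        then show ?thesis
          using trapezoid_eq_0[of q p "x - c"] q by (simp add: g_def)
      qed
    qed
    have half: "g ((x + real k) / 2) = of_real (1 / 2) * of_real (trapezoid (2 * p) (2 * q) (x - (2 * c - real k)))" for x k
    proof -
      have "(x + real k) / 2 - c = (x - (2 * c - real k)) / 2" by (simp add: field_simps)
      then show ?thesis unfolding g_def by (simp only: trapezoid_half) simp
    qed
    have lim: "(\<lambda>n. cascade \<theta> n g) \<longlonglongrightarrow> (LINT x|lborel. \<phi> x * g x)"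
      unfolding g_def using q by (intro cascade_tendsto_father[OF father]) auto
    have limk: "(\<lambda>n. cascade \<theta> n (\<lambda>x. g ((x + real k) / 2))) \<longlonglongrightarrow>
        (LINT x|lborel. \<phi> x * g ((x + real k) / 2))" for k
      unfolding half cascade_scale mult.left_commute[of _ "of_real (1 / 2)"] integral_mult_right_zero
      using q by (intro tendsto_mult tendsto_const cascade_tendsto_father[OF father]) auto
    have "(\<lambda>n. cascade \<theta> (Suc n) g) \<longlonglongrightarrow>
        (\<Sum>k=0..3. of_real (?a k / sqrt 2) * (LINT x|lborel. \<phi> x * g ((x + real k) / 2)))"
      unfolding cascade.simps by (intro tendsto_intros limk)
    with LIMSEQ_Suc[OF lim]
    have "(LINT x|lborel. \<phi> x * g x) =
        (\<Sum>k=0..3. of_real (?a k / sqrt 2) * (LINT x|lborel. \<phi> x * g ((x + real k) / 2)))"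
      by (rule LIMSEQ_unique)
    also have "\<dots> = (\<Sum>k=0..3. of_real (?a k / sqrt 2) * (2 * (LINT y|lborel. \<phi> (- real k + 2 * y) * g y)))"
    proof -
      have "(LINT x|lborel. \<phi> x * g ((x + real k) / 2)) = 2 * (LINT y|lborel. \<phi> (- real k + 2 * y) * g y)" for k
        using lborel_integral_real_affine[of 2 "\<lambda>x. \<phi> x * g ((x + real k) / 2)" "- real k"]
        by (simp add: scaleR_conv_of_real)
      then show ?thesis by (simp only:)
    qed
    also have "\<dots> = (\<Sum>k=0..3. of_real (sqrt 2) * (LINT y|lborel. of_real (?a k) * \<phi> (- real k + 2 * y) * g y))"
    proof (rule sum.cong[OF refl])
      fix k
      have "?a k / sqrt 2 * 2 = sqrt 2 * ?a k"
        using real_sqrt_mult_self[of 2] by (simp add: field_simps)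
      then have "complex_of_real (?a k / sqrt 2) * 2 = of_real (sqrt 2) * of_real (?a k)"
        by (metis of_real_mult of_real_numeral)
      then show "of_real (?a k / sqrt 2) * (2 * (LINT y|lborel. \<phi> (- real k + 2 * y) * g y)) =
        of_real (sqrt 2) * (LINT y|lborel. of_real (?a k) * \<phi> (- real k + 2 * y) * g y)"
        unfolding mult.assoc integral_mult_right_zero by (simp only: mult.assoc[symmetric])
    qed
    also have "\<dots> = of_real (sqrt 2) * (LINT y|lborel. F y * g y)"
      unfolding F_def sum_distrib_right sum_distrib_left[symmetric]
      by (subst Bochner_Integration.integral_sum) (intro L2_mult_integrable L2_scale FL gL, simp)
    also have "\<dots> = (LINT y|lborel. of_real (sqrt 2) * F y * g y)"
      unfolding mult.assoc by simp
    finally have *: "(LINT x|lborel. \<phi> x * g x) = (LINT y|lborel. of_real (sqrt 2) * F y * g y)" .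
    have "(LINT x|lborel. (\<phi> x - of_real (sqrt 2) * F x) * g x) = 0"
      unfolding left_diff_distrib
      by (subst Bochner_Integration.integral_diff)
         (intro L2_mult_integrable L2_scale father_L2 F gL, intro L2_mult_integrable L2_scale father_L2 F gL, simp add: *)
    then show "(LINT x|lborel. (\<phi> x - of_real (sqrt 2) * F x) * of_real (trapezoid p q (x - c))) = 0"
      by (simp add: g_def)
  qed
  moreover have [measurable]: "F \<in> borel_measurable borel"
    using F by (rule L2_measurable)
  ultimately have "AE x in lborel. \<phi> (0 + 1 / 2 * x) - of_real (sqrt 2) * F (0 + 1 / 2 * x) = 0"
    by (intro AE_borel_affine) (simp_all, measurable)
  then show ?thesis
  proof eventually_elim
    case (elim x)
    have "complex_of_real (1 / sqrt 2) * of_real (sqrt 2) = 1"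
      by (simp flip: of_real_mult)
    with elim have "of_real (1 / sqrt 2) * \<phi> (x / 2) = F (x / 2)"
      by (simp flip: mult.assoc)
    then show ?case by (simp add: F_def)
  qed
qed

end

section \<open>Autocorrelation and orthonormality\<close>

context scaling_function
begin

definition autocorr :: "int \<Rightarrow> complex" where
  "autocorr m = L2_inner (\<lambda>y. \<phi> (y + of_int m)) \<phi>"

lemma L2_inner_wavelet_autocorr:
  "L2_inner (wavelet \<phi> (j, k)) (wavelet \<phi> (j, l)) = autocorr (l - k)"
proof -
  have "(\<lambda>y. wavelet \<phi> (j, k) (2 powr of_int j * (y + of_int l))) =
      (\<lambda>y. of_real (2 powr (- of_int j / 2)) * \<phi> (y + of_int (l - k)))"
    by (rule ext) (simp add: wavelet_eq powr_minus algebra_simps)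
  then have "L2_inner (wavelet \<phi> (j, k)) (wavelet \<phi> (j, l)) =
     of_real (2 powr (of_int j / 2)) * (of_real (2 powr (- of_int j / 2)) * autocorr (l - k))"
    unfolding L2_inner_wavelet[of "wavelet \<phi> (j, k)"] autocorr_def
    by (simp only: L2_inner_scale_left)
  then show ?thesis
    by (simp add: powr_add[symmetric] flip: of_real_mult mult.assoc)
qed

lemma autocorr_minus: "autocorr (- m) = cnj (autocorr m)"
  using L2_inner_wavelet_autocorr[of 0 m 0] L2_inner_wavelet_autocorr[of 0 0 m]
    L2_inner_commute[of "wavelet \<phi> (0, m)" "wavelet \<phi> (0, 0)"] by simp

lemma autocorr_0: "autocorr 0 = of_real ((L2_norm \<phi>)\<^sup>2)"
  by (simp add: autocorr_def L2_inner_self)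

lemma autocorr_eq_0:
  assumes "3 \<le> \<bar>m\<bar>" shows "autocorr m = 0"
  unfolding autocorr_def L2_inner_def
proof (rule integral_eq_zero_AE)
  have "AE y in lborel. of_int m + 1 * y \<notin> {0..real 3} \<longrightarrow> \<phi> (of_int m + 1 * y) = 0"
    by (rule AE_borel_affine[OF _ _ u_supp]) auto
  then show "AE y in lborel. \<phi> (y + of_int m) * cnj (\<phi> y) = 0"
    \<comment> \<open>For shifts of length exactly 3 the supports still share the point 0 or
      3.\<close>
    using u_supp AE_lborel_singleton[of 0] AE_lborel_singleton[of 3]
  proof eventually_elim
    case (elim y)
    have "\<not> (y \<in> {0..3} \<and> y + of_int m \<in> {0..3})"
    proof
      assume "y \<in> {0..3} \<and> y + of_int m \<in> {0..3}"
      moreover have "real_of_int m \<ge> 3 \<or> real_of_int m \<le> -3" using assms by linarith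
      ultimately show False using elim(3,4) by auto
    qed
    then show ?case using elim(1,2) by (auto simp: add.commute)
  qed
qed

lemma two_scale_autocorr:
  fixes b :: "nat \<Rightarrow> real"
  assumes v: "v \<in> L2"
    and two_scale: "AE x in lborel. of_real (1 / sqrt 2) * v (x / 2) = (\<Sum>n=0..3. of_real (b n) * \<phi> (x - real n))"
  shows "L2_inner (wavelet v (0, 0)) (wavelet v (0, l)) =
    (\<Sum>m=0..3. \<Sum>n=0..3. of_real (b m * b n) * autocorr (2 * l + int m - int n))"
proof -
  note expand = L2_inner_two_scale[OF _ v two_scale]
  have "L2_inner (wavelet v (0, 0)) (wavelet \<phi> (- 1, k)) = (\<Sum>n=0..3. of_real (b n) * autocorr (k - int n))" for k
  proof -
    have "L2_inner (wavelet v (0, 0)) (wavelet \<phi> (- 1, k)) = cnj (L2_inner (wavelet \<phi> (- 1, k)) (wavelet v (0, 0)))"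
      by (rule L2_inner_commute)
    also have "\<dots> = (\<Sum>n=0..3. of_real (b n) * cnj (autocorr (int n - k)))"
      by (subst expand) (simp_all add: L2_wavelet u_L2 L2_inner_wavelet_autocorr)
    finally show ?thesis by (simp add: autocorr_minus[symmetric])
  qed
  then show ?thesis
    by (subst expand) (simp_all add: L2_wavelet v sum_distrib_left mult.assoc)
qed

lemma mother_norm_sq:
  "complex_of_real ((L2_norm \<psi>)\<^sup>2) = (\<Sum>m=0..3. \<Sum>n=0..3.
     of_real ((- 1) ^ m * a (3 - m) * ((- 1) ^ n * a (3 - n))) * autocorr (int m - int n))"
  using two_scale_autocorr[OF mother_L2 mother, of 0] by (simp add: L2_inner_self L2_norm_wavelet)

lemma autocorr_recursion:
  "autocorr l = (\<Sum>m=0..3. \<Sum>n=0..3. of_real (a m * a n) * autocorr (2 * l + int m - int n))"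
  using two_scale_autocorr[OF u_L2 refinement, of l] L2_inner_wavelet_autocorr[of 0 0 l] by simp

text \<open>The vector \<open>(autocorr 1, autocorr 2)\<close> is fixed by Lawton's transition matrix.\<close>

lemma autocorr_1_2_eq_0:
  assumes sum: "(a 0 + a 1 + a 2 + a 3)\<^sup>2 = 2" and r: "\<bar>a 0 * a 3\<bar> \<noteq> 1 / 2"
  shows "autocorr 1 = 0" "autocorr 2 = 0"
proof -
  have zero: "autocorr 3 = 0" "autocorr 4 = 0" "autocorr 5 = 0" "autocorr 6 = 0" "autocorr 7 = 0"
    by (simp_all add: autocorr_eq_0)
  let ?r = "complex_of_real (a 0 * a 3)"
  have e: "(\<Sum>m=0..3. \<Sum>n=0..3. F m n) = F 0 0 + F 0 1 + F 0 2 + F 0 3 + F 1 0 + F 1 1 + F 1 2 + F 1 3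
     + F 2 0 + F 2 1 + F 2 2 + F 2 3 + F 3 0 + F 3 1 + F 3 2 + F 3 3" for F :: "nat \<Rightarrow> nat \<Rightarrow> complex"
    by (simp add: numeral_eq_Suc)
  have orth': "complex_of_real (a 0 * a 2) + of_real (a 1 * a 3) = 0"
    using orth by (metis of_real_add of_real_0)
  \<comment> \<open>At l = 2 the recursion reaches only the shifts 1, ..., 7, and those from 3 on
    vanish.\<close>
  have "autocorr 2 = of_real (a 0 * a 2) * autocorr 2 + ?r * autocorr 1 + of_real (a 1 * a 3) * autocorr 2"
    by (subst autocorr_recursion) (simp add: e zero)
  then have 2: "autocorr 2 = ?r * autocorr 1"
    using orth' by algebra
  define r1 where "r1 = a 0 * a 1 + a 1 * a 2 + a 2 * a 3"
  \<comment> \<open>Expanding the square of the coefficient sum gives 2 = 1 + 2 (r1 + a0 a3),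
    because the products at distance two cancel by \<open>orth\<close>.\<close>
  have r1: "r1 = 1 / 2 - a 0 * a 3"
    using sum unit orth by (simp add: r1_def power2_eq_square algebra_simps)
  have "autocorr 1 = of_real ((a 0)\<^sup>2 + (a 1)\<^sup>2 + (a 2)\<^sup>2 + (a 3)\<^sup>2) * autocorr 2 + of_real r1 * autocorr 1
      + (of_real (a 0 * a 2) + of_real (a 1 * a 3)) * autocorr 0 + ?r * autocorr (- 1)"
    by (subst autocorr_recursion) (simp add: e zero r1_def power2_eq_square algebra_simps)
  then have "autocorr 1 = autocorr 2 + of_real r1 * autocorr 1 + ?r * cnj (autocorr 1)"
    unfolding unit orth' by (simp add: autocorr_minus del: of_real_mult)
  then have "autocorr 1 = ?r * autocorr 1 + of_real (1 / 2 - a 0 * a 3) * autocorr 1 + ?r * cnj (autocorr 1)"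
    unfolding r1 2 .
  then have "autocorr 1 = autocorr 1 / 2 + ?r * cnj (autocorr 1)"
    by (simp add: algebra_simps)
  then have "autocorr 1 - autocorr 1 / 2 = ?r * cnj (autocorr 1)"
    by (metis add_diff_cancel_left')
  then have "autocorr 1 = 2 * ?r * cnj (autocorr 1)"
    by (simp add: field_simps)
  \<comment> \<open>Moduli remove the conjugation; a nonzero value would now force 2 |a0 a3| =
    1.\<close>
  then have "cmod (autocorr 1) = 2 * \<bar>a 0 * a 3\<bar> * cmod (autocorr 1)"
    by (metis complex_mod_cnj norm_mult norm_numeral norm_of_real)
  then show "autocorr 1 = 0"
    using r by auto
  then show "autocorr 2 = 0"
    using 2 by simp
qed

text \<open>In the energy of the function itself, its own coefficient already contributes the fourth
  power of the norm, so x^2 \<le> x for the squared norm x.\<close>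

lemma norm_father_le_1: "(L2_norm \<phi>)\<^sup>2 \<le> 1"
proof -
  have "(\<Sum>k\<in>{0}. (cmod (L2_inner \<phi> (wavelet \<phi> (0, k))))\<^sup>2) \<le> energy \<phi> 0 \<phi>"
    unfolding energy_def
    by (rule has_sum_mono2[OF has_sum_finite has_sum_infsum[OF energy_summable[OF u_L2]]]) auto
  moreover have "wavelet \<phi> (0, 0) = \<phi>"
    by (rule ext) (simp add: wavelet_eq)
  ultimately have "((L2_norm \<phi>)\<^sup>2)\<^sup>2 \<le> (L2_norm \<phi>)\<^sup>2"
    using energy_0_le[OF u_L2] by (simp add: L2_inner_self norm_power)
  then show ?thesis
    using mult_strict_left_mono[of 1 "(L2_norm \<phi>)\<^sup>2" "(L2_norm \<phi>)\<^sup>2"]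
    unfolding power2_eq_square[of "(L2_norm \<phi>)\<^sup>2"] by (simp only: mult_1_right) linarith
qed

text \<open>The lower bound is a Cauchy-Schwarz estimate. A sum of N translates has squared norm N c
  by orthogonality. Its inner product with the indicator of (0, N + 3), which covers the supports up
  to a null set, is N because each translate has integral 1. Hence N \<le> (N + 3) c for all
  N.\<close>

lemma norm_father_eq_1:
  assumes "autocorr 1 = 0" "autocorr 2 = 0"
  shows "(L2_norm \<phi>)\<^sup>2 = 1"
proof -
  define c where "c = (L2_norm \<phi>)\<^sup>2"
  have delta: "autocorr m = (if m = 0 then of_real c else 0)" for m
  proof -
    consider "3 \<le> \<bar>m\<bar>" | "m = 0" | "m = 1" | "m = 2" | "m = - 1" | "m = - 2" by linarith
    then show ?thesis
      by cases (use assms in \<open>auto simp: autocorr_eq_0 autocorr_0 autocorr_minus c_def\<close>)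
  qed
  have key: "real N \<le> (real N + 3) * c" if "0 < N" for N :: nat
  proof -
    define f where "f x = complex_of_real (indicator {0<..<real N + 3} x)" for x :: real
    have f: "f \<in> L2"
    proof -
      have "f = (\<lambda>x. indicator {0<..<real N + 3} x)" by (auto simp: f_def indicator_def)
      then show ?thesis using L2_indicator_interval by simp
    qed
    have fnorm: "(L2_norm f)\<^sup>2 = real N + 3"
    proof -
      have "(cmod (f x))\<^sup>2 = indicator {0<..<real N + 3} x" for x
        by (auto simp: f_def indicator_def)
      then show ?thesis by (simp add: L2_norm_sq)
    qed
    define S where "S x = (\<Sum>k<N. wavelet \<phi> (0, int k) x)" for x
    have S: "S \<in> L2"
      unfolding S_def by (intro L2_sum L2_wavelet u_L2)
    have "L2_inner S S = (\<Sum>k<N. \<Sum>l<N. autocorr (int l - int k))"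
      unfolding S_def
      by (simp add: L2_inner_sum_left L2_inner_sum_right L2_sum L2_wavelet u_L2 L2_inner_wavelet_autocorr)
    also have "\<dots> = (\<Sum>k<N. \<Sum>l<N. if l = k then of_real c else 0)"
      by (intro sum.cong refl) (simp add: delta)
    also have "\<dots> = of_real (real N * c)" by simp
    finally have Snorm: "(L2_norm S)\<^sup>2 = real N * c"
      unfolding L2_inner_self by (simp only: of_real_eq_iff)
    have "L2_inner f (wavelet \<phi> (0, int k)) = 1" if k: "k < N" for k
    proof -
      have "AE y in lborel. f (y + real k) * cnj (\<phi> y) = cnj (\<phi> y)"
        using u_supp AE_lborel_singleton[of 0]
      proof eventually_elim
        case (elim y)
        then show ?case using k by (cases "y \<in> {0..3}") (auto simp: f_def indicator_def)
      qed
      moreover have "f \<in> borel_measurable borel" using f by (rule L2_measurable)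
      ultimately have "(LINT y|lborel. f (y + real k) * cnj (\<phi> y)) = (LINT y|lborel. cnj (\<phi> y))"
        by (intro integral_cong_AE) auto
      then show ?thesis
        unfolding L2_inner_wavelet by (simp add: L2_inner_def integral_1)
    qed
    then have "L2_inner f S = of_nat N"
      unfolding S_def by (simp add: L2_inner_sum_right L2_wavelet u_L2 f)
    with L2_Cauchy_Schwarz[OF f S] have "real N \<le> L2_norm f * L2_norm S" by simp
    from power_mono[OF this, of 2] have "(real N)\<^sup>2 \<le> (real N + 3) * (real N * c)"
      by (simp add: power_mult_distrib fnorm Snorm)
    then have "real N * real N \<le> real N * ((real N + 3) * c)"
      by (simp add: power2_eq_square mult_ac)
    then show ?thesis
      using that by (simp only: mult_le_cancel_left_pos of_nat_0_less_iff)
  qed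
  have "1 \<le> c"
  proof (rule ccontr)
    assume "\<not> 1 \<le> c"
    then have c: "0 < 1 - c" by simp
    obtain N where N: "3 * c / (1 - c) < real N" using reals_Archimedean2 by blast
    then have "3 * c < real (Suc N) * (1 - c)"
      using c by (simp add: pos_divide_less_eq algebra_simps)
    then show False
      using key[of "Suc N"] by (simp add: algebra_simps)
  qed
  then show ?thesis
    using norm_father_le_1 by (simp add: c_def)
qed

lemma norm_mother_eq_1:
  assumes "autocorr 1 = 0" "autocorr 2 = 0"
  shows "L2_norm \<psi> = 1"
proof -
  have "autocorr 0 = 1" "autocorr 3 = 0"
    using norm_father_eq_1[OF assms] by (simp_all add: autocorr_0 autocorr_eq_0 flip: of_real_power)
  moreover have "autocorr (- 1) = 0" "autocorr (- 2) = 0" "autocorr (- 3) = 0"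
    using assms by (simp_all add: autocorr_minus autocorr_eq_0)
  ultimately have "complex_of_real ((L2_norm \<psi>)\<^sup>2) = of_real ((a 0)\<^sup>2 + (a 1)\<^sup>2 + (a 2)\<^sup>2 + (a 3)\<^sup>2)"
    unfolding mother_norm_sq using assms by (simp add: numeral_eq_Suc power2_eq_square)
  then have "(L2_norm \<psi>)\<^sup>2 = 1"
    unfolding unit by (simp only: of_real_eq_iff)
  then show ?thesis
    using L2_norm_nonneg[of \<psi>] by (simp add: power2_eq_1_iff)
qed

end

section \<open>Generic angles and the exceptional angle\<close>

lemma scaling_function_father:
  assumes father: "is_father_function \<theta> \<phi>" and mother: "is_mother_function \<theta> \<phi> \<psi>"
  shows "scaling_function \<phi> (filter_coeff \<theta>) \<psi>"
proof
  show "AE x in lborel. x \<notin> {0..real 3} \<longrightarrow> \<phi> x = 0"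
    using father_support[OF father] by simp
qed (use mother father_L2[OF father] father_integral[OF father] father_refinement[OF father]
    filter_coeff_unit filter_coeff_orth in \<open>auto simp: is_mother_function_def\<close>)

lemma sin_eq_1_imp:
  assumes "sin \<theta> = 1" "\<theta> \<in> {0..<2 * pi}" shows "\<theta> = pi / 2"
proof -
  have "cos \<theta> = 0" using assms(1) sin_cos_squared_add[of \<theta>] by simp
  then obtain n :: int where n: "\<theta> = n * pi + pi / 2"
    unfolding cos_zero_iff_int2 by blast
  consider "n \<le> - 1" | "n = 0" | "n = 1" | "2 \<le> n" by linarith
  then show ?thesis
  proof cases
    case 1
    then have "n * pi \<le> (- 1) * pi" by (intro mult_right_mono) auto
    then show ?thesis using n assms(2) pi_gt_zero by auto
  next
    case 3
    then have "\<theta> = pi / 2 + pi" using n by simp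
    then have "sin \<theta> = - 1" by (simp only: sin_periodic_pi sin_pi_half)
    then show ?thesis using assms(1) by simp
  next
    case 4
    then have "2 * pi \<le> n * pi" by (intro mult_right_mono) auto
    then show ?thesis using n assms(2) pi_gt_zero by (simp only: atLeastLessThan_iff) linarith
  qed (use n in simp)
qed

text \<open>Reduces the exceptional condition to one variable: s (1 + s) = 2 has only the root s = 1
  in [-1, 1], and s (1 + s) = - 2 has no real root.\<close>

lemma filter_coeff_0_3: "filter_coeff \<theta> 0 * filter_coeff \<theta> 3 = sin \<theta> * (1 + sin \<theta>) / 4"
proof -
  have "(1 - cos \<theta> + sin \<theta>) * (1 + cos \<theta> + sin \<theta>) = 2 * (sin \<theta> * (1 + sin \<theta>)) + (1 - ((sin \<theta>)\<^sup>2 + (cos \<theta>)\<^sup>2))"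
    by algebra
  then show ?thesis by (simp add: filter_coeff_def)
qed

lemma norm_mother_generic:
  assumes father: "is_father_function \<theta> \<phi>" and mother: "is_mother_function \<theta> \<phi> \<psi>"
    and \<theta>: "\<theta> \<in> {0..<2 * pi}" "\<theta> \<noteq> pi / 2"
  shows "L2_norm \<psi> = 1"
proof -
  interpret scaling_function \<phi> "filter_coeff \<theta>" \<psi>
    by (rule scaling_function_father[OF father mother])
  let ?s = "sin \<theta>"
  have s: "?s \<noteq> 1" using sin_eq_1_imp \<theta> by blast
  have "\<bar>filter_coeff \<theta> 0 * filter_coeff \<theta> 3\<bar> \<noteq> 1 / 2"
  proof
    assume "\<bar>filter_coeff \<theta> 0 * filter_coeff \<theta> 3\<bar> = 1 / 2"
    then have "?s * (1 + ?s) = 2 \<or> ?s * (1 + ?s) = - 2"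
      unfolding filter_coeff_0_3 by (auto simp: abs_if split: if_splits)
    moreover have "?s * (1 + ?s) \<noteq> 2"
    proof
      assume "?s * (1 + ?s) = 2"
      then have "(?s - 1) * (?s + 2) = 0" by (simp add: algebra_simps)
      then show False using s sin_ge_minus_one[of \<theta>] by auto
    qed
    moreover have "?s * (1 + ?s) > - 2"
      using sin_ge_minus_one[of \<theta>] zero_le_power2[of ?s] unfolding power2_eq_square distrib_left by linarith
    ultimately show False by simp
  qed
  moreover have "(filter_coeff \<theta> 0 + filter_coeff \<theta> 1 + filter_coeff \<theta> 2 + filter_coeff \<theta> 3)\<^sup>2 = 2"
  proof -
    have "(filter_coeff \<theta> 0 + filter_coeff \<theta> 1 + filter_coeff \<theta> 2 + filter_coeff \<theta> 3) / sqrt 2 = 1"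
      using filter_coeff_sum[of \<theta>] by (simp add: numeral_eq_Suc add_divide_distrib)
    then have "filter_coeff \<theta> 0 + filter_coeff \<theta> 1 + filter_coeff \<theta> 2 + filter_coeff \<theta> 3 = sqrt 2"
      by simp
    then show ?thesis by simp
  qed
  ultimately show ?thesis
    using autocorr_1_2_eq_0 norm_mother_eq_1 by blast
qed

text \<open>At \<open>pi / 2\<close> the refinement equation reads \<open>\<phi> x = \<phi> (2 x) + \<phi> (2 x - 3)\<close>, so \<open>\<phi>\<close> has mean \<open>1 / 3\<close>
  on every dyadic subinterval of \<open>[0, 3]\<close>; the Haar system then gives its norm.\<close>

lemma norm_father_pi_half:
  assumes father: "is_father_function (pi / 2) \<phi>"
  shows "(L2_norm \<phi>)\<^sup>2 = 1 / 3"
proof -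
  note [measurable] = father_measurable[OF father]
  define u where "u x = complex_of_real (indicator {0..1} x)" for x :: real
  have u_eq: "u = (\<lambda>x. indicator {0..1} x)" by (auto simp: u_def indicator_def)
  interpret haar: compact_generator u 1
    using emeasure_bounded_finite[of "{0..1::real}"]
    by unfold_locales (auto simp: u_eq intro!: L2_indicator)
  \<comment> \<open>\<open>J n k\<close> is the mean of the father function over
    [3 k / 2^n, 3 (k + 1) / 2^n].\<close>
  define J where "J n k = (LINT y|lborel. \<phi> (3 * (y + of_int k) / 2 ^ n) * u y)" for n and k :: int
  \<comment> \<open>Compresses [0, 3] to [0, 1], so that its dyadic intervals are those of the box
    \<open>u\<close>.\<close>
  define g where "g x = \<phi> (0 + 3 * x)" for x
  have gL: "g \<in> L2"
    unfolding g_def by (intro L2_affine father_L2[OF father]) simp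
  have um [measurable]: "u \<in> borel_measurable borel" by (rule haar.u_measurable)
  have int: "integrable lborel (\<lambda>y. \<phi> (s + c * y) * u y)" if "c \<noteq> 0" for s c
    using that by (intro L2_mult_integrable L2_affine father_L2[OF father] haar.u_L2)
  have refine: "AE x in lborel. \<phi> (x / 2) = \<phi> x + \<phi> (x - 3)"
    using father_refinement[OF father]
  proof eventually_elim
    case (elim x)
    then have "of_real (1 / sqrt 2) * \<phi> (x / 2) = of_real (1 / sqrt 2) * (\<phi> x + \<phi> (x - 3))"
      by (simp add: filter_coeff_def numeral_eq_Suc field_simps)
    then show ?case by (simp only: mult_cancel_left) auto
  qed
  \<comment> \<open>Measured in steps of 3 / 2^n, the translation by 3 in \<open>refine\<close> is a
    shift of \<open>k\<close> by 2^n.\<close>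
  have J_Suc: "J (Suc n) k = J n k + J n (k - 2 ^ n)" for n k
  proof -
    define s c where "s = 3 * real_of_int k / 2 ^ n" and "c = 3 / (2 ^ n :: real)"
    have c: "c \<noteq> 0" by (simp add: c_def)
    have eq: "3 * (y + real_of_int k) / 2 ^ Suc n = (s + c * y) / 2"
      "3 * (y + real_of_int k) / 2 ^ n = s + c * y"
      "3 * (y + real_of_int (k - 2 ^ n)) / 2 ^ n = (s - 3) + c * y" for y
      by (simp_all add: s_def c_def field_simps)
    have "AE y in lborel. \<phi> ((s + c * y) / 2) = \<phi> (s + c * y) + \<phi> (s + c * y - 3)"
      by (rule AE_borel_affine[OF c _ refine]) measurable
    then have "J (Suc n) k = (LINT y|lborel. \<phi> (s + c * y) * u y + \<phi> ((s - 3) + c * y) * u y)"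
      unfolding J_def eq
      by (intro integral_cong_AE) (auto simp: algebra_simps)
    also have "\<dots> = J n k + J n (k - 2 ^ n)"
      unfolding J_def eq by (intro Bochner_Integration.integral_add int c)
    finally show ?thesis .
  qed
  have J_0: "J 0 k = (if k = 0 then 1 / 3 else 0)" for k
  proof -
    have "(LINT x|lborel. \<phi> x * u (x / 3 - of_int k)) = 3 * J 0 k"
      using lborel_integral_real_affine[of 3 "\<lambda>x. \<phi> x * u (x / 3 - of_int k)" "3 * of_int k"]
      by (simp add: J_def scaleR_conv_of_real add_divide_distrib algebra_simps)
    also have "(LINT x|lborel. \<phi> x * u (x / 3 - of_int k)) = (LINT x|lborel. (if k = 0 then 1 else 0) * \<phi> x)"
    proof (rule integral_cong_AE)
      show "AE x in lborel. \<phi> x * u (x / 3 - of_int k) = (if k = 0 then 1 else 0) * \<phi> x"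
        using father_support[OF father] AE_lborel_singleton[of 0] AE_lborel_singleton[of 3]
      proof eventually_elim
        case (elim x)
        show ?case
        proof (cases "x \<in> {0..3}")
          case True
          with elim have x: "0 < x / 3" "x / 3 < 1" by auto
          have "u (x / 3 - of_int k) = (if k = 0 then 1 else 0)"
          proof (cases "k = 0")
            case False
            then have "real_of_int k \<ge> 1 \<or> real_of_int k \<le> -1" by linarith
            then have "x / 3 - real_of_int k \<notin> {0..1}" using x by auto
            then show ?thesis using False by (simp add: u_def)
          qed (use x in \<open>simp add: u_def\<close>)
          then show ?thesis by simp
        qed (use elim in simp)
      qed
    qed measurable
    also have "\<dots> = (if k = 0 then 1 else 0)"
      using father_integral[OF father] by simp
    finally show ?thesis by (auto simp: mult.commute[of 3] split: if_splits)
  qed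
  have J: "J n k = (if 0 \<le> k \<and> k < 2 ^ n then 1 / 3 else 0)" for n k
  proof (induction n arbitrary: k)
    case (Suc n)
    show ?case unfolding J_Suc Suc by auto
  qed (auto simp: J_0)
  \<comment> \<open>Each level has 2^n nonzero coefficients of squared modulus 2^(-n) / 9, so the
    energies are constant and equal to their limit, the squared norm of \<open>g\<close>.\<close>
  have energy: "energy u (- int n) g = 1 / 9" for n
  proof -
    have "(cmod (L2_inner g (wavelet u (- int n, k))))\<^sup>2 = (if 0 \<le> k \<and> k < 2 ^ n then 1 / (9 * 2 ^ n) else 0)" for k
    proof -
      have "L2_inner (\<lambda>y. g (2 powr of_int (- int n) * (y + of_int k))) u = J n k"
        unfolding J_def L2_inner_def g_def
        by (intro Bochner_Integration.integral_cong refl)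
           (simp add: u_def powr_minus powr_realpow field_simps)
      then have "cmod (L2_inner g (wavelet u (- int n, k))) = 2 powr (- real n / 2) * cmod (J n k)"
        unfolding L2_inner_wavelet by (simp add: norm_mult)
      then have "(cmod (L2_inner g (wavelet u (- int n, k))))\<^sup>2 = 2 powr (- real n) * (cmod (J n k))\<^sup>2"
        by (simp add: power_mult_distrib power2_eq_square powr_add[symmetric])
      then show ?thesis
        by (cases "0 \<le> k \<and> k < 2 ^ n")
           (simp_all add: J norm_divide power_divide powr_minus powr_realpow field_simps)
    qed
    then have "energy u (- int n) g = (\<Sum>\<^sub>\<infinity>k::int. if 0 \<le> k \<and> k < 2 ^ n then 1 / (9 * 2 ^ n) else 0)"
      by (simp add: energy_def)
    also have "\<dots> = (\<Sum>\<^sub>\<infinity>k\<in>{0..<2 ^ n :: int}. 1 / (9 * 2 ^ n))"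
      by (rule infsum_cong_neutral) auto
    also have "\<dots> = 1 / 9" by simp
    finally show ?thesis .
  qed
  have "(LINT x|lborel. u x) = 1"
    unfolding u_def integral_complex_of_real by simp
  from haar.energy_fine_scale[OF gL this] have "(L2_norm g)\<^sup>2 = 1 / 9"
    unfolding energy by (simp add: LIMSEQ_const_iff)
  moreover have "(L2_norm \<phi>)\<^sup>2 = 3 * (L2_norm g)\<^sup>2"
  proof -
    have "L2_inner \<phi> \<phi> = of_real \<bar>3\<bar> * L2_inner g g"
      unfolding g_def by (rule L2_inner_affine) simp
    then have "complex_of_real ((L2_norm \<phi>)\<^sup>2) = of_real (3 * (L2_norm g)\<^sup>2)"
      by (simp add: L2_inner_self)
    then show ?thesis by (simp only: of_real_eq_iff)
  qed
  ultimately show ?thesis by simp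
qed

text \<open>Only the taps at 0 and 3 are nonzero. The father function and its translate by 3 overlap
  in a null set, so the mother function has the same norm as the father function.\<close>

lemma norm_mother_pi_half:
  assumes father: "is_father_function (pi / 2) \<phi>" and mother: "is_mother_function (pi / 2) \<phi> \<psi>"
  shows "L2_norm \<psi> \<noteq> 1"
proof -
  interpret scaling_function \<phi> "filter_coeff (pi / 2)" \<psi>
    by (rule scaling_function_father[OF father mother])
  let ?a = "filter_coeff (pi / 2)"
  have a: "?a 0 = 1 / sqrt 2" "?a 1 = 0" "?a 2 = 0" "?a 3 = 1 / sqrt 2"
    by (simp_all add: filter_coeff_def)
  have z: "autocorr 3 = 0" "autocorr (- 3) = 0"
    by (simp_all add: autocorr_eq_0)
  have "complex_of_real ((L2_norm \<psi>)\<^sup>2) = of_real (2 * (1 / sqrt 2)\<^sup>2) * autocorr 0"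
  proof -
    have "complex_of_real (sqrt 2) * of_real (sqrt 2) = 2"
      by (simp flip: of_real_mult)
    then show ?thesis
      unfolding mother_norm_sq using a z by (simp add: numeral_eq_Suc power2_eq_square)
  qed
  also have "\<dots> = of_real (1 / 3)"
    by (simp add: autocorr_0 norm_father_pi_half[OF father] power_divide flip: of_real_power)
  finally have "(L2_norm \<psi>)\<^sup>2 = 1 / 3"
    by (simp only: of_real_eq_iff)
  then show ?thesis by auto
qed

theorem mainTheorem2:
  fixes \<phi> \<psi> :: "real \<Rightarrow> real \<Rightarrow> complex"
  assumes father: "\<And>\<theta>. \<theta> \<in> {0..<2 * pi} \<Longrightarrow> is_father_function \<theta> (\<phi> \<theta>)"
    and mother: "\<And>\<theta>. \<theta> \<in> {0..<2 * pi} \<Longrightarrow> is_mother_function \<theta> (\<phi> \<theta>) (\<psi> \<theta>)"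
  shows "(\<forall>\<theta>\<in>{0..<2 * pi}.
            (is_tight_frame (wavelet (\<psi> \<theta>)) \<and> \<not> is_orthonormal_basis (wavelet (\<psi> \<theta>)))
              \<longleftrightarrow> \<theta> = pi / 2) \<and>
         (\<forall>\<theta>\<in>{0..<2 * pi}. \<theta> \<noteq> pi / 2 \<longrightarrow> is_orthonormal_basis (wavelet (\<psi> \<theta>)))"
proof -
  have tight: "is_tight_frame (wavelet (\<psi> \<theta>))"
    and onb: "is_orthonormal_basis (wavelet (\<psi> \<theta>)) \<longleftrightarrow> \<theta> \<noteq> pi / 2"
    if \<theta>: "\<theta> \<in> {0..<2 * pi}" for \<theta>
  proof -
    interpret s: scaling_function "\<phi> \<theta>" "filter_coeff \<theta>" "\<psi> \<theta>"
      by (rule scaling_function_father[OF father[OF \<theta>] mother[OF \<theta>]])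
    show "is_tight_frame (wavelet (\<psi> \<theta>))"
      by (rule s.tight_frame)
    show "is_orthonormal_basis (wavelet (\<psi> \<theta>)) \<longleftrightarrow> \<theta> \<noteq> pi / 2"
      unfolding s.orthonormal_basis_iff
      using norm_mother_generic[OF father[OF \<theta>] mother[OF \<theta>] \<theta>] norm_mother_pi_half
        father[OF \<theta>] mother[OF \<theta>] by metis
  qed
  then show ?thesis by blast
qed

end
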